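(* Let $G=(V,E)$ be a point-line graph. Then $\mathcal{M}_{\rm PL}(G)=\mathcal{M}_\sharp(G)$, i.e. the generic 2-dimensional point-line rigidity matroid of $G$ is equal to the matroid $\mathcal{M}(\rho+\nu_L-1)$ on $E$ induced by $\rho+\nu_L-1$.
   Context: A point-line graph is a finite simple graph $G=(V,E)$ (no loops, no parallel edges) together with an ordered pair $(V_P,V_L)$ of (possibly empty) disjoint sets with $V=V_P\cup V_L$. Vertices in $V_P=\{u_1,\dots,u_s\}$ are point-vertices, vertices in $V_L=\{v_1,\dots,v_t\}$ are line-vertices. $E_{PP},E_{PL},E_{LL}$ are the sets of edges joining two point-vertices, a point-vertex and a line-vertex, and two line-vertices, respectively. Rigidity matroid. A point-line framework is a pair $(G,p)$ with $p:V\to\mathbb{R}^2$; write $p(u_i)=(x_i,y_i)$ for $u_i\in V_P$ and $p(v_i)=(a_i,b_i)$ for $v_i\in V_L$. The rigidity matrix $R(G,p)$ is the $|E|\times 2|V|$ real matrix with rows indexed by $E$, two columns $u_{i,x},u_{i,y}$ for each $u_i\in V_P$ and two columns $v_{i,a},v_{i,b}$ for each $v_i\in V_L$, with the following entries (zeros elsewhere): - row $u_ju_k\in E_{PP}$: $x_j-x_k,\ y_j-y_k,\ x_k-x_j,\ y_k-y_j$ in columns $u_{j,x},u_{j,y},u_{k,x},u_{k,y}$; - row $u_jv_k\in E_{PL}$: $1,\ -a_k,\ -x_ja_k-y_j,\ -1$ in columns $u_{j,x},u_{j,y},v_{k,a},v_{k,b}$; - row $v_jv_k\in E_{LL}$ with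 $j<k$: $1,\ -1$ in columns $v_{j,a},v_{k,a}$. $(G,p)$ is generic if the coordinates $x_i,y_i,a_j$ ($u_i\in V_P$, $v_j\in V_L$) are algebraically independent over $\mathbb{Q}$. $\mathcal{M}_{\rm PL}(G)$ is the matroid on $E$ in which $S\subseteq E$ is independent iff the rows of $R(G,p)$ indexed by $S$ are linearly independent for a generic $(G,p)$; it is the same for all generic $(G,p)$. Count matroid. For $A\subseteq E$, $\nu_P(A)$ and $\nu_L(A)$ are the numbers of point-vertices and line-vertices, respectively, incident to edges in $A$. Define $\rho:2^E\to\mathbb{Z}$ by $\rho(A)=\min\{\sum_{i=1}^s(2\nu_P(A_i)+\nu_L(A_i)-2)\}$, the minimum over all partitions $\{A_1,\dots,A_s\}$ of $A$ into nonempty sets (so $\rho(\emptyset)=0$). For a function $f:2^E\to\mathbb{Z}$ that is nondecreasing, intersecting submodular ($f(A)+f(B)\ge f(A\cup B)+f(A\cap B)$ whenever $A\cap B\ne\emptyset$) and nonnegative on nonempty sets, $\mathcal{M}(f)$ is the matroid on $E$ whose independent sets are those $I\subseteq E$ with $|J|\le f(J)$ for all $\emptyset\ne J\subseteq I$. $\mathcal{M}_\sharp(G):=\mathcal{M}(\rho+\nu_L-1)$. *)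

theory Defs
  imports Complex_Main "HOL-Library.Disjoint_Sets" "HOL-Library.Poly_Mapping"
begin

section \<open>Point-line graphs\<close>

record 'v pl_graph =
  point_verts :: "'v set"
  line_verts :: "'v set"
  edges :: "'v set set"

abbreviation verts :: "('v, 'm) pl_graph_scheme \<Rightarrow> 'v set" where
  "verts G \<equiv> point_verts G \<union> line_verts G"

definition point_line_graph :: "'v pl_graph \<Rightarrow> bool" where
  "point_line_graph G \<longleftrightarrow>
     finite (verts G) \<and> point_verts G \<inter> line_verts G = {} \<and>
     (\<forall>e\<in>edges G. e \<subseteq> verts G \<and> card e = 2)"

text \<open>A matroid is given by its ground set together with the family of its independent sets;
  two matroids are equal iff both components agree.\<close>

type_synonym 'e matroid = "'e set \<times> 'e set set"


section \<open>Algebraic independence over the rationals\<close>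

text \<open>A polynomial over the rationals in variables of type \<^typ>\<open>'i\<close> is a finitely supported map
  from monomials (finitely supported exponent maps) to coefficients.\<close>

type_synonym 'i ratpoly = "('i \<Rightarrow>\<^sub>0 nat) \<Rightarrow>\<^sub>0 rat"

definition ratpoly_vars :: "'i ratpoly \<Rightarrow> 'i set" where
  "ratpoly_vars P = (\<Union>m\<in>Poly_Mapping.keys P. Poly_Mapping.keys m)"

definition ratpoly_eval :: "('i \<Rightarrow> real) \<Rightarrow> 'i ratpoly \<Rightarrow> real" where
  "ratpoly_eval t P =
     (\<Sum>m\<in>Poly_Mapping.keys P. of_rat (Poly_Mapping.lookup P m) *
        (\<Prod>i\<in>Poly_Mapping.keys m. t i ^ Poly_Mapping.lookup m i))"

text \<open>Independence of the family \<^term>\<open>t\<close> restricted to the index set \<^term>\<open>I\<close>; in particular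
  the values at distinct indices are distinct.\<close>

definition alg_independent_rat :: "'i set \<Rightarrow> ('i \<Rightarrow> real) \<Rightarrow> bool" where
  "alg_independent_rat I t \<longleftrightarrow>
     (\<forall>P. ratpoly_vars P \<subseteq> I \<and> ratpoly_eval t P = 0 \<longrightarrow> P = 0)"


section \<open>The generic rigidity matroid\<close>

text \<open>A realisation is a map \<^term>\<open>p :: 'v \<Rightarrow> real \<times> real\<close>, with
  \<open>p u = (x, y)\<close> for a point-vertex and \<open>p v = (a, b)\<close> for a line-vertex. The columns of the
  rigidity matrix are indexed by pairs of a vertex and a coordinate: \<open>First\<close> stands for \<open>x\<close>
  or \<open>a\<close>, \<open>Second\<close> for \<open>y\<close> or \<open>b\<close>.\<close>

datatype coord = First | Second

fun coordinate :: "('v \<Rightarrow> real \<times> real) \<Rightarrow> 'v \<times> coord \<Rightarrow> real" where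
  "coordinate p (v, First) = fst (p v)"
| "coordinate p (v, Second) = snd (p v)"

text \<open>The coordinates \<open>b\<close> of the line-vertices are left unconstrained.\<close>

definition generic :: "'v pl_graph \<Rightarrow> ('v \<Rightarrow> real \<times> real) \<Rightarrow> bool" where
  "generic G p \<longleftrightarrow>
     alg_independent_rat (point_verts G \<times> {First, Second} \<union> line_verts G \<times> {First})
       (coordinate p)"

definition other_end :: "'v set \<Rightarrow> 'v \<Rightarrow> 'v" where
  "other_end e w = the_elem (e - {w})"

text \<open>The entry in row \<^term>\<open>e\<close> and column \<open>(w, c)\<close>. The function \<^term>\<open>idx\<close> gives the position
  of a line-vertex in the chosen enumeration of the line-vertices; it only determines which of the
  two ends of an edge between line-vertices receives the entry 1.\<close>

fun rigidity_matrix ::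
  "'v pl_graph \<Rightarrow> ('v \<Rightarrow> nat) \<Rightarrow> ('v \<Rightarrow> real \<times> real) \<Rightarrow> 'v set \<Rightarrow> 'v \<times> coord \<Rightarrow> real" where
  "rigidity_matrix G idx p e (w, c) =
     (if w \<notin> e then 0
      else let z = other_end e w in
        if w \<in> point_verts G then
          (if z \<in> point_verts G
           then (case c of First \<Rightarrow> fst (p w) - fst (p z)
                         | Second \<Rightarrow> snd (p w) - snd (p z))
           else (case c of First \<Rightarrow> 1
                         | Second \<Rightarrow> - fst (p z)))
        else
          (if z \<in> point_verts G
           then (case c of First \<Rightarrow> - fst (p z) * fst (p w) - snd (p z)
                         | Second \<Rightarrow> - 1)
           else (case c of First \<Rightarrow> if idx w < idx z then 1 else - 1
                         | Second \<Rightarrow> 0)))"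

text \<open>Linear independence of the rows as a family indexed by \<^term>\<open>S\<close>, so that two equal rows
  are dependent.\<close>

definition rows_independent :: "('r \<Rightarrow> 'c \<Rightarrow> real) \<Rightarrow> 'c set \<Rightarrow> 'r set \<Rightarrow> bool" where
  "rows_independent M C S \<longleftrightarrow>
     (\<forall>l. (\<forall>c\<in>C. (\<Sum>r\<in>S. l r * M r c) = 0) \<longrightarrow> (\<forall>r\<in>S. l r = 0))"

text \<open>Independence of the rows is the same for all generic realisations, since it amounts to a
  minor, which is a rational polynomial in the coordinates other than the \<open>b\<close>, being nonzero.
  The existential form excludes vacuous satisfaction.\<close>

definition rigidity_matroid :: "'v pl_graph \<Rightarrow> ('v \<Rightarrow> nat) \<Rightarrow> 'v set matroid" where
  "rigidity_matroid G idx =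
     (edges G,
      {S. S \<subseteq> edges G \<and>
          (\<exists>p. generic G p \<and>
               rows_independent (rigidity_matrix G idx p) (verts G \<times> {First, Second}) S)})"

lemma rigidity_matrix_PP:
  assumes "u \<in> point_verts G" "u' \<in> point_verts G" "u \<noteq> u'"
  shows "rigidity_matrix G idx p {u, u'} (u, First) = fst (p u) - fst (p u')"
    and "rigidity_matrix G idx p {u, u'} (u, Second) = snd (p u) - snd (p u')"
    and "rigidity_matrix G idx p {u, u'} (u', First) = fst (p u') - fst (p u)"
    and "rigidity_matrix G idx p {u, u'} (u', Second) = snd (p u') - snd (p u)"
proof -
  have "{u, u'} - {u} = {u'}" "{u, u'} - {u'} = {u}" using assms by auto
  then show "rigidity_matrix G idx p {u, u'} (u, First) = fst (p u) - fst (p u')"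
    and "rigidity_matrix G idx p {u, u'} (u, Second) = snd (p u) - snd (p u')"
    and "rigidity_matrix G idx p {u, u'} (u', First) = fst (p u') - fst (p u)"
    and "rigidity_matrix G idx p {u, u'} (u', Second) = snd (p u') - snd (p u)"
    using assms by (simp_all add: other_end_def)
qed

lemma rigidity_matrix_PL:
  assumes "u \<in> point_verts G" "v \<notin> point_verts G"
  shows "rigidity_matrix G idx p {u, v} (u, First) = 1"
    and "rigidity_matrix G idx p {u, v} (u, Second) = - fst (p v)"
    and "rigidity_matrix G idx p {u, v} (v, First) = - fst (p u) * fst (p v) - snd (p u)"
    and "rigidity_matrix G idx p {u, v} (v, Second) = - 1"
proof -
  have "{u, v} - {u} = {v}" "{u, v} - {v} = {u}" using assms by auto
  then show "rigidity_matrix G idx p {u, v} (u, First) = 1"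
    and "rigidity_matrix G idx p {u, v} (u, Second) = - fst (p v)"
    and "rigidity_matrix G idx p {u, v} (v, First) = - fst (p u) * fst (p v) - snd (p u)"
    and "rigidity_matrix G idx p {u, v} (v, Second) = - 1"
    using assms by (simp_all add: other_end_def)
qed

lemma rigidity_matrix_LL:
  assumes "v \<notin> point_verts G" "v' \<notin> point_verts G" "idx v < idx v'"
  shows "rigidity_matrix G idx p {v, v'} (v, First) = 1"
    and "rigidity_matrix G idx p {v, v'} (v, Second) = 0"
    and "rigidity_matrix G idx p {v, v'} (v', First) = - 1"
    and "rigidity_matrix G idx p {v, v'} (v', Second) = 0"
proof -
  have "{v, v'} - {v} = {v'}" "{v, v'} - {v'} = {v}" using assms by auto
  then show "rigidity_matrix G idx p {v, v'} (v, First) = 1"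
    and "rigidity_matrix G idx p {v, v'} (v, Second) = 0"
    and "rigidity_matrix G idx p {v, v'} (v', First) = - 1"
    and "rigidity_matrix G idx p {v, v'} (v', Second) = 0"
    using assms by (simp_all add: other_end_def)
qed


section \<open>The count matroid\<close>

definition nu_P :: "'v pl_graph \<Rightarrow> 'v set set \<Rightarrow> int" where
  "nu_P G A = int (card {u \<in> point_verts G. \<exists>e\<in>A. u \<in> e})"

definition nu_L :: "'v pl_graph \<Rightarrow> 'v set set \<Rightarrow> int" where
  "nu_L G A = int (card {v \<in> line_verts G. \<exists>e\<in>A. v \<in> e})"

definition rho :: "'v pl_graph \<Rightarrow> 'v set set \<Rightarrow> int" where
  "rho G A = Min ((\<lambda>\<P>. \<Sum>B\<in>\<P>. 2 * nu_P G B + nu_L G B - 2) ` {\<P>. partition_on A \<P>})"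

text \<open>This family is a matroid if \<^term>\<open>f\<close> is nondecreasing, intersecting submodular and
  nonnegative on nonempty sets.\<close>

definition induced_matroid :: "'e set \<Rightarrow> ('e set \<Rightarrow> int) \<Rightarrow> 'e matroid" where
  "induced_matroid E f =
     (E, {I. I \<subseteq> E \<and> (\<forall>J. J \<noteq> {} \<and> J \<subseteq> I \<longrightarrow> int (card J) \<le> f J)})"

definition sharp_matroid :: "'v pl_graph \<Rightarrow> 'v set matroid" where
  "sharp_matroid G = induced_matroid (edges G) (\<lambda>A. rho G A + nu_L G A - 1)"

end

theory Submission
  imports Defs "HOL-Library.Function_Algebras" "HOL-Analysis.Continuum_Not_Denumerable"
begin

text \<open>
  The theorem is obtained from a description of the rows of the rigidity matrix as sections of
  planes by a hyperplane.

  Fix a slope \<open>a v\<close> for every line-vertex \<open>v\<close>. An edge receives a plane in the space of functions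
  on vertices and coordinates: for two points \<open>u, v\<close> it is spanned by the differences of the unit
  vectors of \<open>u\<close> and \<open>v\<close> in either coordinate; for a point \<open>u\<close> and a line \<open>v\<close> by the unit vector of
  \<open>(v, First)\<close> and the incidence vector with entries \<open>1\<close> and \<open>- a v\<close> at \<open>u\<close> and \<open>- 1\<close> at
  \<open>(v, Second)\<close>; for two lines by the unit vectors of their first coordinates. A hyperplane, given
  by a functional \<open>q\<close>, meets this plane in a line. If the point-vertices are placed at the values of
  \<open>q\<close> rotated by a right angle, then column operations that do not depend on the edge, and
  a nonzero factor for each edge, turn a spanning vector of this line into the row of the edge.
  So independence of rows is a matter of cutting planes by a general hyperplane, which lowers the
  dimension of each span by one.

  \<^bold>\<open>Necessity of the count.\<close> The rows of \<open>J\<close> lie in the span of the planes of \<open>J\<close>, and they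
  are killed by the infinitesimal rotation, which does not kill that span. For a partition of \<open>J\<close>,
  the incidence and difference vectors of one part \<open>B\<close> are orthogonal to the two translations of the vertices
  of \<open>B\<close>, so they span at most \<open>2 * nu_P B + nu_L B - 2\<close> dimensions, and the first coordinates of
  the lines add \<open>nu_L J\<close>. This gives \<open>card_le_if_rows_independent\<close>.

  \<^bold>\<open>Sufficiency of the count.\<close> Three facts are combined.

  \<^item> There are slopes for which the planes of every edge set \<open>J\<close> span at least
    \<open>rho J + nu_L J\<close> dimensions (\<open>rho_plus_nu_L_le_edge_rank\<close>). Take slopes at which all ranks
    are locally maximal and call two points coincident if every functional vanishing on the planes
    takes the same values at them. Differentiating a linear dependency of incidence vectors with respect to one
    slope shows that its coefficients may be multiplied by the coordinates of any such functional.
    Hence they may be multiplied by every polynomial in these coordinates, in particular by one that is the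
    indicator function of a coincidence class. So every dependency splits into
    dependencies within the classes, and the rank is at least the sum belonging to the partition of
    \<open>J\<close> into the classes and the single edges between lines.

  \<^item> If the planes of every nonempty \<open>J\<close> span at least \<open>card J + 1\<close> dimensions, then vectors can be
    chosen in the planes that are independent and whose span contains none of the planes
    (\<open>generic_transversal_of_planes\<close>); a functional killing these vectors and no plane is the
    hyperplane sought.

  \<^item> Independence of rows is an open condition and algebraically independent points are dense
    (\<open>alg_independent_rat_dense\<close>), so the special placement may be replaced by a generic one.
\<close>

section \<open>Linear algebra of real-valued functions\<close>

instantiation "fun" :: (type, real_vector) real_vector
begin

definition "scaleR_fun r f = (\<lambda>x. r *\<^sub>R f x)"

instance
  by standard (simp_all add: scaleR_fun_def fun_eq_iff scaleR_add_right scaleR_add_left)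

end

lemma scaleR_fun_apply [simp]: "(r *\<^sub>R f) x = r *\<^sub>R f x"
  by (simp add: scaleR_fun_def)

lemma sum_fun_apply [simp]: "(\<Sum>i\<in>A. f i) x = (\<Sum>i\<in>A. f i x)"
  by (induction A rule: infinite_finite_induct) auto

definition unit_vec :: "'c \<Rightarrow> 'c \<Rightarrow> real" where
  "unit_vec c = (\<lambda>x. if x = c then 1 else 0)"

lemma unit_vec_apply: "unit_vec c x = (if x = c then 1 else 0)"
  by (simp add: unit_vec_def)

lemma unit_vec_expansion:
  fixes v :: "'c \<Rightarrow> real"
  assumes "finite C" "\<And>c. c \<notin> C \<Longrightarrow> v c = 0"
  shows "v = (\<Sum>c\<in>C. v c *\<^sub>R unit_vec c)"
proof
  fix x
  have "(\<Sum>c\<in>C. v c * (if x = c then 1 else 0)) = (\<Sum>c\<in>C. if x = c then v c else 0)"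
    by (rule sum.cong) auto
  then show "v x = (\<Sum>c\<in>C. v c *\<^sub>R unit_vec c) x"
    using assms by (auto simp: unit_vec_apply)
qed

lemma linear_unit_vec_expansion:
  fixes \<phi> :: "('c \<Rightarrow> real) \<Rightarrow> real"
  assumes "linear \<phi>" "finite C" "\<And>c. c \<notin> C \<Longrightarrow> v c = 0"
  shows "\<phi> v = (\<Sum>c\<in>C. v c * \<phi> (unit_vec c))"
proof -
  have "\<phi> v = \<phi> (\<Sum>c\<in>C. v c *\<^sub>R unit_vec c)"
    by (rule arg_cong[of _ _ \<phi>]) (rule unit_vec_expansion[OF assms(2,3)])
  also have "\<dots> = (\<Sum>c\<in>C. v c * \<phi> (unit_vec c))"
    by (simp add: linear_sum[OF assms(1)] linear_scale[OF assms(1)])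
  finally show ?thesis .
qed

text \<open>
  Stated for indexed families, because two edges may have equal rows, which must count as
  dependent.
\<close>

definition family_independent :: "('i \<Rightarrow> 'a::real_vector) \<Rightarrow> 'i set \<Rightarrow> bool" where
  "family_independent f I \<longleftrightarrow>
     (\<forall>l. (\<Sum>i\<in>I. l i *\<^sub>R f i) = 0 \<longrightarrow> (\<forall>i\<in>I. l i = 0))"

lemma family_independentI:
  "(\<And>l i. (\<Sum>i\<in>I. l i *\<^sub>R f i) = 0 \<Longrightarrow> i \<in> I \<Longrightarrow> l i = 0) \<Longrightarrow> family_independent f I"
  by (auto simp: family_independent_def)

lemma family_independentD:
  "family_independent f I \<Longrightarrow> (\<Sum>i\<in>I. l i *\<^sub>R f i) = 0 \<Longrightarrow> i \<in> I \<Longrightarrow> l i = 0"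
  by (auto simp: family_independent_def)

lemma family_independent_iff:
  fixes f :: "'i \<Rightarrow> 'a::real_vector"
  assumes "finite I"
  shows "family_independent f I \<longleftrightarrow> inj_on f I \<and> independent (f ` I)"
proof (intro iffI conjI)
  assume ind: "family_independent f I"
  show inj: "inj_on f I"
  proof (rule inj_onI, rule ccontr)
    fix i j assume ij: "i \<in> I" "j \<in> I" "f i = f j" "i \<noteq> j"
    define l where "l k = (if k = i then 1 else if k = j then -1 else (0::real))" for k
    have "(\<Sum>k\<in>I. l k *\<^sub>R f k) = (\<Sum>k\<in>{i,j}. l k *\<^sub>R f k)"
      by (rule sum.mono_neutral_right) (use ij assms in \<open>auto simp: l_def\<close>)
    also have "\<dots> = 0" using ij by (simp add: l_def)
    finally have "l i = 0" using family_independentD[OF ind] ij by blast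
    then show False by (simp add: l_def)
  qed
  show "independent (f ` I)"
  proof (rule real_vector.independent_if_scalars_zero)
    fix u x assume u: "(\<Sum>x\<in>f ` I. u x *\<^sub>R x) = 0" "x \<in> f ` I"
    then have "(\<Sum>i\<in>I. u (f i) *\<^sub>R f i) = 0"
      using inj by (simp add: sum.reindex)
    then show "u x = 0"
      using family_independentD[OF ind, of "\<lambda>i. u (f i)"] u(2) by auto
  qed (use assms in simp)
next
  assume A: "inj_on f I \<and> independent (f ` I)"
  show "family_independent f I"
  proof (rule family_independentI)
    fix l i assume l: "(\<Sum>i\<in>I. l i *\<^sub>R f i) = 0" "i \<in> I"
    define u where "u x = l (the_inv_into I f x)" for x
    have "(\<Sum>x\<in>f ` I. u x *\<^sub>R x) = (\<Sum>i\<in>I. l i *\<^sub>R f i)"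
      using A by (simp add: sum.reindex u_def the_inv_into_f_f)
    then have "u (f i) = 0"
      using A l assms real_vector.independentD[of "f ` I" "f ` I" u "f i"] by auto
    then show "l i = 0" using A l by (simp add: u_def the_inv_into_f_f)
  qed
qed

lemma card_independent_le_dim:
  fixes X :: "'a::real_vector set"
  assumes "independent A" "A \<subseteq> span X" "finite X"
  shows "finite A" "card A \<le> dim X"
proof -
  obtain B where B: "B \<subseteq> X" "independent B" "X \<subseteq> span B" "card B = dim X"
    using real_vector.basis_exists by blast
  have "A \<subseteq> span B"
    using assms(2) B(3) by (metis real_vector.span_mono real_vector.span_span subset_trans)
  moreover have "finite B" using B(1) assms(3) finite_subset by blast
  ultimately show "finite A" "card A \<le> dim X"
    using real_vector.independent_span_bound[of B A] assms(1) B(4) by auto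
qed

lemma card_family_le_dim:
  fixes X :: "'a::real_vector set"
  assumes "family_independent f I" "finite I" "f ` I \<subseteq> span X" "finite X"
  shows "card I \<le> dim X"
  using card_independent_le_dim(2)[of "f ` I" X] assms family_independent_iff[of I f]
  by (auto simp: card_image)

lemma finite_basis_within:
  fixes X :: "'a::real_vector set"
  assumes "finite X"
  obtains B where "B \<subseteq> X" "finite B" "independent B" "X \<subseteq> span B" "card B = dim X"
proof -
  obtain B where "B \<subseteq> X" "independent B" "X \<subseteq> span B" "card B = dim X"
    using real_vector.basis_exists[of X] by blast
  then show ?thesis using that assms finite_subset by blast
qed

lemma dim_mono_span:
  fixes X Y :: "'a::real_vector set"
  assumes "X \<subseteq> span Y" "finite X" "finite Y"
  shows "dim X \<le> dim Y"
proof -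
  obtain B where B: "B \<subseteq> X" "finite B" "independent B" "X \<subseteq> span B" "card B = dim X"
    by (rule finite_basis_within[OF assms(2)])
  then show ?thesis using card_independent_le_dim(2)[of B Y] assms by (metis subset_trans)
qed

lemma dim_insert_notin_span:
  fixes X :: "'a::real_vector set"
  assumes "x \<notin> span X" "finite X"
  shows "dim X + 1 \<le> dim (insert x X)"
proof -
  obtain B where B: "B \<subseteq> X" "finite B" "independent B" "X \<subseteq> span B" "card B = dim X"
    by (rule finite_basis_within[OF assms(2)])
  have nx: "x \<notin> span B" using B(1) assms(1) real_vector.span_mono by blast
  then have "independent (insert x B)" by (simp add: B(3) real_vector.independent_insertI)
  moreover have "insert x B \<subseteq> span (insert x X)"
    using B(1) by (meson insert_mono real_vector.span_superset subset_trans)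
  moreover have "x \<notin> B" using nx real_vector.span_base by blast
  ultimately show ?thesis
    using card_independent_le_dim(2)[of "insert x B" "insert x X"] assms(2) B by auto
qed

text \<open>
  A basis contained in a finite set of at most that size must be the whole set.
\<close>

lemma independent_if_card_le_dim:
  fixes X :: "'a::real_vector set"
  assumes "finite X" "card X \<le> dim X"
  shows "independent X"
proof -
  obtain B where B: "B \<subseteq> X" "finite B" "independent B" "X \<subseteq> span B" "card B = dim X"
    by (rule finite_basis_within[OF assms(1)])
  then have "B = X" using assms card_seteq[of X B] by simp
  then show ?thesis using B by simp
qed

lemma linear_functional_separates:
  fixes X :: "'a::real_vector set"
  assumes "x \<notin> span X"
  shows "\<exists>\<phi>::'a \<Rightarrow> real. linear \<phi> \<and> (\<forall>y\<in>X. \<phi> y = 0) \<and> \<phi> x = 1"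
proof -
  obtain B where B: "B \<subseteq> X" "independent B" "X \<subseteq> span B"
    using real_vector.basis_exists by metis
  have nx: "x \<notin> span B" using B(1) assms real_vector.span_mono by blast
  then have "independent (insert x B)" by (simp add: B(2) real_vector.independent_insertI)
  then obtain \<phi> :: "'a \<Rightarrow> real" where \<phi>: "linear \<phi>"
    "\<forall>y\<in>insert x B. \<phi> y = (if y = x then 1 else 0)"
    using linear_independent_extend[of "insert x B" "\<lambda>y. if y = x then 1 else 0"] by blast
  have x: "x \<notin> B" using nx real_vector.span_base by blast
  have "\<phi> y = 0" if "y \<in> X" for y
  proof (rule linear_eq_0_on_span[OF \<phi>(1), of B])
    show "y \<in> span B" using that B by auto
    show "\<phi> z = 0" if "z \<in> B" for z using \<phi>(2) that x by auto
  qed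
  then show ?thesis using \<phi> by auto
qed

text \<open>
  One vector after the other: if the functional found so far vanishes at the new vector, add a
  multiple of a functional that does not. Only finitely many multiples destroy what was
  achieved before.
\<close>

lemma linear_functional_separates_finite:
  fixes X Y :: "'a::real_vector set"
  assumes "finite Y" "\<And>y. y \<in> Y \<Longrightarrow> y \<notin> span X"
  shows "\<exists>\<phi>::'a \<Rightarrow> real. linear \<phi> \<and> (\<forall>x\<in>X. \<phi> x = 0) \<and> (\<forall>y\<in>Y. \<phi> y \<noteq> 0)"
  using assms
proof (induction Y)
  case empty
  then show ?case by (intro exI[of _ "\<lambda>_. 0"]) (auto simp: linear_iff)
next
  case (insert y Y)
  then obtain \<phi> :: "'a \<Rightarrow> real" where \<phi>: "linear \<phi>" "\<forall>x\<in>X. \<phi> x = 0" "\<forall>y\<in>Y. \<phi> y \<noteq> 0" by auto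
  obtain \<psi> :: "'a \<Rightarrow> real" where \<psi>: "linear \<psi>" "\<forall>x\<in>X. \<psi> x = 0" "\<psi> y = 1"
    using linear_functional_separates[of y X] insert.prems by auto
  have "infinite (UNIV :: real set)" by (rule infinite_UNIV_char_0)
  then obtain s where s: "s \<notin> insert (- \<phi> y) ((\<lambda>z. - \<phi> z / \<psi> z) ` Y)"
    using insert.hyps ex_new_if_finite by (metis finite_imageI finite_insert)
  let ?\<chi> = "\<lambda>z. \<phi> z + s * \<psi> z"
  have "linear ?\<chi>" using \<phi>(1) \<psi>(1) by (auto simp: linear_iff algebra_simps)
  moreover have "?\<chi> z \<noteq> 0" if "z \<in> insert y Y" for z
  proof
    assume 0: "?\<chi> z = 0"
    show False
    proof (cases "\<psi> z = 0 \<or> z = y")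
      case True
      then show ?thesis using 0 that \<phi>(3) \<psi>(3) s by auto
    next
      case False
      then have "s = - \<phi> z / \<psi> z" using 0 by (simp add: field_simps)
      then show ?thesis using s that False by auto
    qed
  qed
  ultimately show ?case using \<phi>(2) \<psi>(2) by (intro exI[of _ ?\<chi>]) auto
qed

text \<open>
  Functionals dual to the limit vectors, applied to the approximating ones, give a matrix
  close to the identity. Such a matrix is diagonally dominant and therefore has trivial
  kernel.
\<close>

lemma eventually_family_independent:
  fixes v :: "'i \<Rightarrow> 'c \<Rightarrow> real" and w :: "'p \<Rightarrow> 'i \<Rightarrow> 'c \<Rightarrow> real"
  assumes ind: "family_independent v I" and fin: "finite I" "finite C"
    and lim: "\<And>i c. i \<in> I \<Longrightarrow> c \<in> C \<Longrightarrow> ((\<lambda>n. w n i c) \<longlongrightarrow> v i c) F"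
    and supp: "\<And>i c. i \<in> I \<Longrightarrow> c \<notin> C \<Longrightarrow> v i c = 0" "\<And>n i c. i \<in> I \<Longrightarrow> c \<notin> C \<Longrightarrow> w n i c = 0"
  shows "\<forall>\<^sub>F n in F. family_independent (w n) I"
proof (cases "I = {}")
  case True
  then show ?thesis by (simp add: family_independent_def)
next
  case False
  have inj: "inj_on v I" and ind': "independent (v ` I)"
    using ind fin family_independent_iff by blast+
  have "\<exists>\<phi>::('c \<Rightarrow> real) \<Rightarrow> real. linear \<phi> \<and> (\<forall>j\<in>I. \<phi> (v j) = (if j = i then 1 else 0))" if "i \<in> I" for i
  proof -
    obtain \<phi> :: "('c \<Rightarrow> real) \<Rightarrow> real" where \<phi>: "linear \<phi>"
      "\<forall>x\<in>v ` I. \<phi> x = (if x = v i then 1 else 0)"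
      using linear_independent_extend[OF ind', of "\<lambda>x. if x = v i then 1 else 0"] by blast
    moreover have "v j = v i \<longleftrightarrow> j = i" if "j \<in> I" for j
      using inj that \<open>i \<in> I\<close> by (rule inj_on_eq_iff)
    ultimately show ?thesis by (intro exI[of _ \<phi>]) simp
  qed
  then obtain \<phi> :: "'i \<Rightarrow> ('c \<Rightarrow> real) \<Rightarrow> real"
    where \<phi>: "\<And>i. i \<in> I \<Longrightarrow> linear (\<phi> i)"
      "\<And>i j. i \<in> I \<Longrightarrow> j \<in> I \<Longrightarrow> \<phi> i (v j) = (if j = i then 1 else 0)"
    by metis
  define \<epsilon> where "\<epsilon> = 1 / (2 * real (card I))"
  have cI: "card I > 0" using False fin by (simp add: card_gt_0_iff)
  then have \<epsilon>: "\<epsilon> > 0" by (simp add: \<epsilon>_def)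
  have ev: "\<forall>\<^sub>F n in F. \<forall>i\<in>I. \<forall>j\<in>I. \<bar>\<phi> i (w n j) - (if j = i then 1 else 0)\<bar> < \<epsilon>"
  proof (intro eventually_ball_finite[OF fin(1)] ballI)
    fix i j assume ij: "i \<in> I" "j \<in> I"
    have "((\<lambda>n. \<Sum>c\<in>C. w n j c * \<phi> i (unit_vec c)) \<longlongrightarrow> (\<Sum>c\<in>C. v j c * \<phi> i (unit_vec c))) F"
      by (intro tendsto_intros lim ij)
    then have "((\<lambda>n. \<phi> i (w n j)) \<longlongrightarrow> \<phi> i (v j)) F"
      using linear_unit_vec_expansion[OF \<phi>(1)[OF ij(1)] fin(2)] supp ij by simp
    then have "((\<lambda>n. \<phi> i (w n j)) \<longlongrightarrow> (if j = i then 1 else 0)) F" using \<phi>(2) ij by simp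
    from tendstoD[OF this \<epsilon>]
    show "\<forall>\<^sub>F n in F. \<bar>\<phi> i (w n j) - (if j = i then 1 else 0)\<bar> < \<epsilon>"
      unfolding dist_real_def .
  qed
  show ?thesis
  proof (rule eventually_mono[OF ev], rule family_independentI)
    fix n l i
    assume close: "\<forall>i\<in>I. \<forall>j\<in>I. \<bar>\<phi> i (w n j) - (if j = i then 1 else 0)\<bar> < \<epsilon>"
      and rel: "(\<Sum>i\<in>I. l i *\<^sub>R w n i) = 0" and i: "i \<in> I"
    define m where "m = Max ((\<lambda>i. \<bar>l i\<bar>) ` I)"
    have le: "\<bar>l j\<bar> \<le> m" if "j \<in> I" for j using that fin by (simp add: m_def)
    have "m \<in> (\<lambda>i. \<bar>l i\<bar>) ` I" unfolding m_def using False fin by (intro Max_in) auto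
    then obtain k where k: "k \<in> I" "\<bar>l k\<bar> = m" by auto
    have "\<phi> k (\<Sum>j\<in>I. l j *\<^sub>R w n j) = 0"
      using rel linear_0[OF \<phi>(1)[OF k(1)]] by simp
    then have "(\<Sum>j\<in>I. l j * \<phi> k (w n j)) = 0"
      by (simp add: linear_sum[OF \<phi>(1)[OF k(1)]] linear_scale[OF \<phi>(1)[OF k(1)]])
    moreover have "(\<Sum>j\<in>I. l j * (if j = k then 1 else 0)) = l k"
      using k fin by (simp add: sum.delta' if_distrib cong: if_cong)
    ultimately have lk: "(\<Sum>j\<in>I. l j * ((if j = k then 1 else 0) - \<phi> k (w n j))) = l k"
      by (simp only: right_diff_distrib sum_subtractf diff_0_right)
    have "m = \<bar>\<Sum>j\<in>I. l j * ((if j = k then 1 else 0) - \<phi> k (w n j))\<bar>"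
      unfolding lk by (rule k(2)[symmetric])
    also have "\<dots> \<le> (\<Sum>j\<in>I. \<bar>l j * ((if j = k then 1 else 0) - \<phi> k (w n j))\<bar>)"
      by (rule sum_abs)
    also have "\<dots> \<le> (\<Sum>j\<in>I. m * \<epsilon>)"
    proof (intro sum_mono)
      fix j assume j: "j \<in> I"
      have "\<bar>(if j = k then 1 else 0) - \<phi> k (w n j)\<bar> \<le> \<epsilon>"
        using close k(1) j by (simp only: abs_minus_commute less_imp_le)
      then show "\<bar>l j * ((if j = k then 1 else 0) - \<phi> k (w n j))\<bar> \<le> m * \<epsilon>"
        unfolding abs_mult using le[OF j] by (intro mult_mono) auto
    qed
    also have "\<dots> = m / 2" using cI by (simp add: \<epsilon>_def)
    finally have "m \<le> 0" by simp
    then show "l i = 0" using le[OF i] by simp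
  qed
qed

section \<open>Transversals of families of planes\<close>

text \<open>
  An affine line with two points in a subspace lies in it together with its direction.
\<close>

lemma finite_line_parameters_in_subspace:
  fixes b c :: "'a::real_vector"
  assumes "subspace W" "\<not> (b \<in> W \<and> c \<in> W)"
  shows "finite {x. b + x *\<^sub>R c \<in> W}"
proof -
  have "x = y" if xy: "b + x *\<^sub>R c \<in> W" "b + y *\<^sub>R c \<in> W" for x y
  proof (rule ccontr)
    assume ne: "x \<noteq> y"
    have "(b + x *\<^sub>R c) - (b + y *\<^sub>R c) \<in> W"
      using assms(1) xy by (rule real_vector.subspace_diff)
    moreover have "(b + x *\<^sub>R c) - (b + y *\<^sub>R c) = (x - y) *\<^sub>R c" by (simp add: scaleR_diff_left)
    ultimately have "(1 / (x - y)) *\<^sub>R ((x - y) *\<^sub>R c) \<in> W"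
      using assms(1) by (metis real_vector.subspace_scale)
    then have c: "c \<in> W" using ne by simp
    have "(b + x *\<^sub>R c) - x *\<^sub>R c \<in> W"
      using assms(1) xy(1) c by (intro real_vector.subspace_diff real_vector.subspace_scale)
    then show False using c assms(2) by simp
  qed
  then have "{x. b + x *\<^sub>R c \<in> W} \<subseteq> {SOME x. b + x *\<^sub>R c \<in> W}"
    by (metis (mono_tags, lifting) mem_Collect_eq singletonI someI subsetI)
  then show ?thesis using finite_subset by blast
qed

text \<open>
  The hypothesis is the condition of Rado's transversal theorem, strengthened by one. For
  vectors chosen generically in the planes this theorem has a direct proof: each choice has to
  avoid finitely many proper subspaces. The strengthening by one is what allows a hyperplane
  to contain all the chosen vectors but none of the planes.
\<close>

lemma generic_transversal_of_planes:
  fixes b c :: "'e \<Rightarrow> 'a::real_vector"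
  assumes fin: "finite I"
    and rank: "\<And>J. J \<subseteq> I \<Longrightarrow> J \<noteq> {} \<Longrightarrow> card J + 1 \<le> dim (b ` J \<union> c ` J)"
  shows "\<exists>t::'e \<Rightarrow> real. (\<forall>e\<in>I. t e \<noteq> 0) \<and> family_independent (\<lambda>e. b e + t e *\<^sub>R c e) I \<and>
           (\<forall>f\<in>I. c f \<notin> span ((\<lambda>e. b e + t e *\<^sub>R c e) ` I))"
proof -
  define G where "G S t e = (if e \<in> S then {b e + t e *\<^sub>R c e} else {b e, c e})"
    for S and t :: "'e \<Rightarrow> real" and e
  have finG: "finite (\<Union>e\<in>J. G S t e)" if "J \<subseteq> I" for J S t
    using finite_subset[OF that fin] by (intro finite_UN_I) (simp_all add: G_def)
  \<comment> \<open>The planes in \<open>S\<close> have already been replaced by vectors.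
      Restoring any one plane of \<open>J\<close> must leave one dimension to spare.\<close>
  have "\<exists>t. (\<forall>e\<in>S. t e \<noteq> 0) \<and>
          (\<forall>J\<subseteq>I. \<forall>f\<in>J. card J + 1 \<le> dim ((\<Union>e\<in>J. G S t e) \<union> {b f, c f}))"
    if "finite S" "S \<subseteq> I" for S
    using that
  proof (induction S)
    case empty
    have "card J + 1 \<le> dim ((\<Union>e\<in>J. G {} (\<lambda>_. 0) e) \<union> {b f, c f})"
      if "J \<subseteq> I" "f \<in> J" for J f
    proof -
      have "(\<Union>e\<in>J. G {} (\<lambda>_. 0) e) \<union> {b f, c f} = b ` J \<union> c ` J"
        using that(2) by (auto simp: G_def)
      then show ?thesis using rank[OF that(1)] that(2) by auto
    qed
    then show ?case by (intro exI[of _ "\<lambda>_. 0"]) simp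
  next
    case (insert e0 S)
    then obtain t where t: "\<forall>e\<in>S. t e \<noteq> 0"
      and IH: "\<And>J f. J \<subseteq> I \<Longrightarrow> f \<in> J \<Longrightarrow> card J + 1 \<le> dim ((\<Union>e\<in>J. G S t e) \<union> {b f, c f})"
      by auto
    define X where "X J f = (\<Union>e\<in>J. G S t e) \<union> {b f, c f}" for J f
    have finX: "finite (X J f)" if "J \<subseteq> I" for J f
      using finG[OF that] by (simp add: X_def)
    define bad where "bad = (\<lambda>(J, f). if b e0 \<in> span (X J f) \<and> c e0 \<in> span (X J f) then {}
        else {x. b e0 + x *\<^sub>R c e0 \<in> span (X J f)})"
    have "finite (\<Union>(bad ` (Pow I \<times> I)))"
    proof (intro finite_UN_I)
      show "finite (Pow I \<times> I)" using fin by simp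
      show "finite (bad Jf)" if "Jf \<in> Pow I \<times> I" for Jf
        using finite_line_parameters_in_subspace[OF real_vector.subspace_span]
        by (auto simp: bad_def split: prod.split)
    qed
    moreover have "infinite (UNIV :: real set)" by (rule infinite_UNIV_char_0)
    ultimately obtain x where x: "x \<notin> insert 0 (\<Union>(bad ` (Pow I \<times> I)))"
      using ex_new_if_finite finite_insert by metis
    define t' where "t' = t(e0 := x)"
    have G': "G (insert e0 S) t' e = (if e = e0 then {b e0 + x *\<^sub>R c e0} else G S t e)" for e
      by (auto simp: G_def t'_def)
    have "card J + 1 \<le> dim ((\<Union>e\<in>J. G (insert e0 S) t' e) \<union> {b f, c f})"
      if J: "J \<subseteq> I" "f \<in> J" for J f
    proof (cases "e0 \<in> J")
      case False
      then have "(\<Union>e\<in>J. G (insert e0 S) t' e) = (\<Union>e\<in>J. G S t e)" using G' by auto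
      then show ?thesis using IH[OF J] by simp
    next
      case True
      define J' where "J' = J - {e0}"
      have J': "J = insert e0 J'" "e0 \<notin> J'" "J' \<subseteq> I" using True J by (auto simp: J'_def)
      have cJ: "card J = card J' + 1" using J' fin finite_subset by fastforce
      let ?v = "b e0 + x *\<^sub>R c e0"
      have new: "(\<Union>e\<in>J. G (insert e0 S) t' e) \<union> {b f, c f} = insert ?v (X J' f)"
        using J' G' by (auto simp: X_def)
      have "e0 \<notin> S" by (rule insert.hyps)
      then have old: "(\<Union>e\<in>J. G S t e) \<union> {b f, c f} = insert (b e0) (insert (c e0) (X J' f))"
        using J' by (auto simp: X_def G_def)
      note fX = finX[OF J'(3), of f]
      show ?thesis
      proof (cases "b e0 \<in> span (X J' f) \<and> c e0 \<in> span (X J' f)")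
        case True
        have "card J + 1 \<le> dim (insert (b e0) (insert (c e0) (X J' f)))"
          using IH[OF J] unfolding old .
        also have "\<dots> \<le> dim (insert ?v (X J' f))"
        proof (rule dim_mono_span)
          have "span (X J' f) \<subseteq> span (insert ?v (X J' f))" by (rule real_vector.span_mono) auto
          then show "insert (b e0) (insert (c e0) (X J' f)) \<subseteq> span (insert ?v (X J' f))"
            using True real_vector.span_superset by blast
        qed (use fX in auto)
        finally show ?thesis unfolding new .
      next
        case False
        have "f \<noteq> e0" using False real_vector.span_base[of _ "X J' f"] by (auto simp: X_def)
        then have f: "f \<in> J'" "f \<in> I" using J J' by auto
        have "x \<notin> bad (J', f)" using x J' f by auto
        then have "?v \<notin> span (X J' f)" using False by (auto simp: bad_def)
        then have "dim (X J' f) + 1 \<le> dim (insert ?v (X J' f))"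
          using fX by (rule dim_insert_notin_span)
        moreover have "card J' + 1 \<le> dim (X J' f)" using IH[OF J'(3) f(1)] unfolding X_def .
        ultimately show ?thesis unfolding new cJ by simp
      qed
    qed
    moreover have "\<forall>e\<in>insert e0 S. t' e \<noteq> 0" using t x by (auto simp: t'_def)
    ultimately show ?case by (intro exI[of _ t']) blast
  qed
  from this[OF fin] obtain t where t: "\<forall>e\<in>I. t e \<noteq> 0"
    and rk: "\<And>f. f \<in> I \<Longrightarrow> card I + 1 \<le> dim ((\<Union>e\<in>I. G I t e) \<union> {b f, c f})"
    by blast
  let ?v = "\<lambda>e. b e + t e *\<^sub>R c e"
  have ind: "independent (insert (c f) (?v ` I)) \<and> card (insert (c f) (?v ` I)) = card I + 1"
    if "f \<in> I" for f
  proof -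
    have "(\<Union>e\<in>I. G I t e) = ?v ` I" by (auto simp: G_def)
    then have "card I + 1 \<le> dim (?v ` I \<union> {b f, c f})" using rk[OF that] by simp
    also have "\<dots> \<le> dim (insert (c f) (?v ` I))"
    proof (rule dim_mono_span)
      let ?S = "span (insert (c f) (?v ` I))"
      have "?v f \<in> ?S" "c f \<in> ?S" using that by (auto intro: real_vector.span_base)
      then have "?v f - t f *\<^sub>R c f \<in> ?S"
        by (intro real_vector.span_diff real_vector.span_scale)
      then have "b f \<in> ?S" by simp
      then show "?v ` I \<union> {b f, c f} \<subseteq> ?S"
        by (auto intro: real_vector.span_base)
    qed (use fin in auto)
    finally have "card I + 1 \<le> dim (insert (c f) (?v ` I))" .
    moreover have "card (insert (c f) (?v ` I)) \<le> card I + 1"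
      using fin card_image_le[OF fin, of ?v] card_insert_le_m1 by (auto simp: card_insert_if)
    ultimately show ?thesis
      using independent_if_card_le_dim[of "insert (c f) (?v ` I)"]
        dim_eq_card_independent[of "insert (c f) (?v ` I)"] fin by fastforce
  qed
  have notin: "c f \<notin> span (?v ` I)" if "f \<in> I" for f
  proof -
    have "card (?v ` I) \<le> card I" by (rule card_image_le[OF fin])
    then have "c f \<notin> ?v ` I" using ind[OF that] fin by (auto simp: insert_absorb)
    then show ?thesis using ind[OF that] real_vector.independent_insert by metis
  qed
  have "family_independent ?v I"
  proof (cases "I = {}")
    case False
    then obtain f where f: "f \<in> I" by auto
    have "card (?v ` I) = card I"
      using ind[OF f] notin[OF f] fin real_vector.span_base[of "c f" "?v ` I"]
      by (auto simp: card_insert_if split: if_splits)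
    moreover have "independent (?v ` I)"
      using ind[OF f] real_vector.independent_mono by (metis subset_insertI)
    ultimately show ?thesis using family_independent_iff[OF fin] eq_card_imp_inj_on[OF fin] by blast
  qed (simp add: family_independent_def)
  then show ?thesis using t notin by blast
qed

section \<open>Density of algebraically independent points\<close>

lemma ratpoly_eval_cong:
  assumes "\<And>i. i \<in> ratpoly_vars P \<Longrightarrow> t i = t' i"
  shows "ratpoly_eval t P = ratpoly_eval t' P"
  unfolding ratpoly_eval_def
proof (intro sum.cong refl arg_cong2[of _ _ _ _ "(*)"] prod.cong)
  fix m i assume "m \<in> Poly_Mapping.keys P" "i \<in> Poly_Mapping.keys m"
  then show "t i ^ Poly_Mapping.lookup m i = t' i ^ Poly_Mapping.lookup m i"
    using assms[of i] unfolding ratpoly_vars_def by (metis UN_I)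
qed

lemma alg_independent_rat_cong:
  assumes "\<And>i. i \<in> I \<Longrightarrow> t i = t' i"
  shows "alg_independent_rat I t \<longleftrightarrow> alg_independent_rat I t'"
proof -
  have "ratpoly_eval t P = ratpoly_eval t' P" if "ratpoly_vars P \<subseteq> I" for P
    using that assms by (intro ratpoly_eval_cong) auto
  then show ?thesis unfolding alg_independent_rat_def by metis
qed

lemma alg_independent_rat_distinct:
  assumes "alg_independent_rat I t" "i \<in> I" "j \<in> I" "i \<noteq> j"
  shows "t i \<noteq> t j"
proof
  assume eq: "t i = t j"
  define X :: "'a \<Rightarrow> 'a ratpoly" where "X k = Poly_Mapping.single (Poly_Mapping.single k 1) 1" for k
  let ?P = "X i - X j"
  have ne: "Poly_Mapping.single i (1::nat) \<noteq> Poly_Mapping.single j 1"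
    using assms(4) by (metis lookup_single_eq lookup_single_not_eq zero_neq_one)
  have lk: "Poly_Mapping.lookup ?P m = (if m = Poly_Mapping.single i 1 then 1
      else if m = Poly_Mapping.single j 1 then -1 else 0)" for m
    using ne by (auto simp: X_def lookup_minus lookup_single when_def)
  have keys: "Poly_Mapping.keys ?P = {Poly_Mapping.single i 1, Poly_Mapping.single j 1}"
    by (auto simp: in_keys_iff lk split: if_splits)
  have "ratpoly_vars ?P \<subseteq> I" using assms by (auto simp: ratpoly_vars_def keys)
  moreover have "ratpoly_eval t ?P = 0"
    using ne eq by (simp add: ratpoly_eval_def keys lk)
  ultimately have "?P = 0" using assms(1) by (auto simp: alg_independent_rat_def)
  then show False using keys by simp
qed

text \<open>
  The coefficient of the \<open>n\<close>-th power of the variable \<open>i\<close>, as a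
  polynomial in the other variables.
\<close>

definition ratpoly_slice :: "'i \<Rightarrow> nat \<Rightarrow> 'i ratpoly \<Rightarrow> 'i ratpoly" where
  "ratpoly_slice i n P = Poly_Mapping.Abs_poly_mapping
     (\<lambda>m. if i \<in> Poly_Mapping.keys m then 0 else Poly_Mapping.lookup P (m + Poly_Mapping.single i n))"

lemma lookup_ratpoly_slice:
  "Poly_Mapping.lookup (ratpoly_slice i n P) m =
     (if i \<in> Poly_Mapping.keys m then 0 else Poly_Mapping.lookup P (m + Poly_Mapping.single i n))"
proof -
  have "finite ((\<lambda>m. m + Poly_Mapping.single i n) -` Poly_Mapping.keys P)"
    by (intro finite_vimageI injI) auto
  then have "finite {m. (if i \<in> Poly_Mapping.keys m then 0
      else Poly_Mapping.lookup P (m + Poly_Mapping.single i n)) \<noteq> 0}"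
    by (rule finite_subset[rotated]) (auto simp: in_keys_iff)
  then show ?thesis by (simp add: ratpoly_slice_def Abs_poly_mapping_inverse)
qed

lemma bij_betw_keys_ratpoly_slice:
  "bij_betw (\<lambda>m. m + Poly_Mapping.single i n) (Poly_Mapping.keys (ratpoly_slice i n P))
     {m \<in> Poly_Mapping.keys P. Poly_Mapping.lookup m i = n}"
proof (rule bij_betwI[where g = "\<lambda>m. m - Poly_Mapping.single i n"])
  show "(\<lambda>m. m + Poly_Mapping.single i n) \<in> Poly_Mapping.keys (ratpoly_slice i n P) \<rightarrow>
     {m \<in> Poly_Mapping.keys P. Poly_Mapping.lookup m i = n}"
    by (auto simp: in_keys_iff lookup_ratpoly_slice lookup_add split: if_splits)
  have eq: "m - Poly_Mapping.single i n + Poly_Mapping.single i n = m"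
    if "Poly_Mapping.lookup m i = n" for m :: "'a \<Rightarrow>\<^sub>0 nat"
    by (rule poly_mapping_eqI) (use that in \<open>auto simp: lookup_add lookup_minus lookup_single when_def\<close>)
  show "(\<lambda>m. m - Poly_Mapping.single i n) \<in> {m \<in> Poly_Mapping.keys P. Poly_Mapping.lookup m i = n} \<rightarrow>
     Poly_Mapping.keys (ratpoly_slice i n P)"
    using eq by (auto simp: in_keys_iff lookup_ratpoly_slice lookup_minus)
  show "m + Poly_Mapping.single i n - Poly_Mapping.single i n = m" for m :: "'a \<Rightarrow>\<^sub>0 nat"
    by simp
  show "m - Poly_Mapping.single i n + Poly_Mapping.single i n = m"
    if "m \<in> {m \<in> Poly_Mapping.keys P. Poly_Mapping.lookup m i = n}" for m
    using eq that by simp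
qed

lemma ratpoly_vars_slice:
  assumes "ratpoly_vars P \<subseteq> insert i I"
  shows "ratpoly_vars (ratpoly_slice i n P) \<subseteq> I"
proof
  fix j assume "j \<in> ratpoly_vars (ratpoly_slice i n P)"
  then obtain m where m: "m \<in> Poly_Mapping.keys (ratpoly_slice i n P)" "j \<in> Poly_Mapping.keys m"
    by (auto simp: ratpoly_vars_def)
  then have i: "i \<notin> Poly_Mapping.keys m" and "m + Poly_Mapping.single i n \<in> Poly_Mapping.keys P"
    by (auto simp: in_keys_iff lookup_ratpoly_slice split: if_splits)
  moreover have "j \<in> Poly_Mapping.keys (m + Poly_Mapping.single i n)"
    using m(2) by (simp add: in_keys_iff lookup_add)
  ultimately have "j \<in> insert i I" using assms by (auto simp: ratpoly_vars_def)
  then show "j \<in> I" using i m(2) by auto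
qed

lemma ratpoly_eval_slices:
  assumes N: "\<And>m. m \<in> Poly_Mapping.keys P \<Longrightarrow> Poly_Mapping.lookup m i \<le> N"
  shows "ratpoly_eval (t(i := x)) P = (\<Sum>n\<le>N. ratpoly_eval t (ratpoly_slice i n P) * x ^ n)"
proof -
  let ?val = "\<lambda>t m. of_rat (Poly_Mapping.lookup P m) *
    (\<Prod>j\<in>Poly_Mapping.keys m. t j ^ Poly_Mapping.lookup m j) :: real"
  let ?K = "\<lambda>n. {m \<in> Poly_Mapping.keys P. Poly_Mapping.lookup m i = n}"
  have slice: "(\<Sum>m\<in>?K n. ?val (t(i := x)) m) = ratpoly_eval t (ratpoly_slice i n P) * x ^ n" for n
  proof -
    have "(\<Sum>m\<in>?K n. ?val (t(i := x)) m) =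
        (\<Sum>m\<in>Poly_Mapping.keys (ratpoly_slice i n P). ?val (t(i := x)) (m + Poly_Mapping.single i n))"
      by (rule sum.reindex_bij_betw[OF bij_betw_keys_ratpoly_slice, symmetric])
    also have "\<dots> = (\<Sum>m\<in>Poly_Mapping.keys (ratpoly_slice i n P).
        of_rat (Poly_Mapping.lookup (ratpoly_slice i n P) m) *
        (\<Prod>j\<in>Poly_Mapping.keys m. t j ^ Poly_Mapping.lookup m j) * x ^ n)"
    proof (rule sum.cong[OF refl])
      fix m assume "m \<in> Poly_Mapping.keys (ratpoly_slice i n P)"
      then have i: "i \<notin> Poly_Mapping.keys m"
        by (auto simp: in_keys_iff lookup_ratpoly_slice split: if_splits)
      let ?m = "m + Poly_Mapping.single i n"
      have "(\<Prod>j\<in>Poly_Mapping.keys ?m. (t(i := x)) j ^ Poly_Mapping.lookup ?m j) =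
          (\<Prod>j\<in>insert i (Poly_Mapping.keys m). (t(i := x)) j ^ Poly_Mapping.lookup ?m j)"
        by (rule prod.mono_neutral_left)
          (auto simp: in_keys_iff lookup_add lookup_single when_def split: if_splits)
      also have "\<dots> = x ^ n * (\<Prod>j\<in>Poly_Mapping.keys m. (t(i := x)) j ^ Poly_Mapping.lookup ?m j)"
        using i by (simp add: lookup_add in_keys_iff)
      also have "(\<Prod>j\<in>Poly_Mapping.keys m. (t(i := x)) j ^ Poly_Mapping.lookup ?m j) =
          (\<Prod>j\<in>Poly_Mapping.keys m. t j ^ Poly_Mapping.lookup m j)"
        using i by (intro prod.cong) (auto simp: lookup_add lookup_single when_def)
      finally show "?val (t(i := x)) ?m = of_rat (Poly_Mapping.lookup (ratpoly_slice i n P) m) *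
        (\<Prod>j\<in>Poly_Mapping.keys m. t j ^ Poly_Mapping.lookup m j) * x ^ n"
        using i by (simp add: lookup_ratpoly_slice)
    qed
    finally show ?thesis by (simp add: ratpoly_eval_def sum_distrib_right)
  qed
  have "(\<Sum>n\<le>N. \<Sum>m\<in>?K n. ?val (t(i := x)) m) = (\<Sum>m\<in>Poly_Mapping.keys P. ?val (t(i := x)) m)"
    using N by (intro sum.group) auto
  then show ?thesis unfolding slice by (simp add: ratpoly_eval_def)
qed

text \<open>
  Some slice of a nonzero polynomial is nonzero, and by independence it does not vanish at
  \<open>t\<close>. So the polynomial, seen as a polynomial in the new variable alone, is
  nonzero and has finitely many roots.
\<close>

lemma finite_zeros_new_variable:
  assumes indep: "alg_independent_rat I t" and P: "ratpoly_vars P \<subseteq> insert i I" "P \<noteq> 0"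
  shows "finite {x. ratpoly_eval (t(i := x)) P = 0}"
proof -
  define N where "N = Max ((\<lambda>m. Poly_Mapping.lookup m i) ` Poly_Mapping.keys P)"
  have N: "Poly_Mapping.lookup m i \<le> N" if "m \<in> Poly_Mapping.keys P" for m
    using that by (simp add: N_def)
  obtain m where m: "m \<in> Poly_Mapping.keys P" using P(2) by fastforce
  define n where "n = Poly_Mapping.lookup m i"
  have "Poly_Mapping.keys (ratpoly_slice i n P) \<noteq> {}"
    using bij_betw_keys_ratpoly_slice[of i n P] m by (auto simp: n_def bij_betw_def)
  then have "ratpoly_slice i n P \<noteq> 0" by auto
  then have "ratpoly_eval t (ratpoly_slice i n P) \<noteq> 0"
    using indep ratpoly_vars_slice[OF P(1)] by (auto simp: alg_independent_rat_def)
  moreover have "n \<le> N" using N m by (simp add: n_def)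
  moreover have "ratpoly_eval (t(i := x)) P = (\<Sum>n\<le>N. ratpoly_eval t (ratpoly_slice i n P) * x ^ n)" for x
    by (rule ratpoly_eval_slices) (rule N)
  ultimately show ?thesis
    using polyfun_finite_roots[of "\<lambda>n. ratpoly_eval t (ratpoly_slice i n P)" N] by auto
qed

text \<open>
  A finitely supported map is determined by the finite part of its graph over its support.
\<close>

lemma countable_poly_mappings:
  assumes "countable A"
  shows "countable {m :: 'i \<Rightarrow>\<^sub>0 'b :: {zero, countable}. Poly_Mapping.keys m \<subseteq> A}"
proof -
  define graph where "graph m = (\<lambda>k. (k, Poly_Mapping.lookup m k)) ` Poly_Mapping.keys m"
    for m :: "'i \<Rightarrow>\<^sub>0 'b"
  have gr: "(k, q) \<in> graph m \<longleftrightarrow> Poly_Mapping.lookup m k = q \<and> q \<noteq> 0" for m k q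
    by (auto simp: graph_def in_keys_iff)
  have "inj_on graph {m. Poly_Mapping.keys m \<subseteq> A}"
  proof (rule inj_onI, rule poly_mapping_eqI)
    fix m m' k assume "graph m = graph m'"
    then show "Poly_Mapping.lookup m k = Poly_Mapping.lookup m' k" using gr by metis
  qed
  moreover have "countable {B. finite B \<and> B \<subseteq> A \<times> (UNIV :: 'b set)}"
    using assms by (intro countable_Collect_finite_subset) auto
  moreover have "graph ` {m. Poly_Mapping.keys m \<subseteq> A} \<subseteq> {B. finite B \<and> B \<subseteq> A \<times> (UNIV :: 'b set)}"
    by (auto simp: graph_def)
  ultimately show ?thesis
    by (meson countable_image_inj_on countable_subset)
qed

lemma countable_ratpolys:
  assumes "countable I"
  shows "countable {P :: 'i ratpoly. ratpoly_vars P \<subseteq> I}"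
proof -
  have "{P :: 'i ratpoly. ratpoly_vars P \<subseteq> I} =
      {P. Poly_Mapping.keys P \<subseteq> {m. Poly_Mapping.keys m \<subseteq> I}}"
    by (auto simp: ratpoly_vars_def)
  then show ?thesis
    using countable_poly_mappings[OF countable_poly_mappings[OF assms]] by simp
qed

lemma alg_independent_rat_empty: "alg_independent_rat {} t"
  unfolding alg_independent_rat_def
proof (intro allI impI)
  fix P :: "'a ratpoly" assume P: "ratpoly_vars P \<subseteq> {} \<and> ratpoly_eval t P = 0"
  then have keys: "Poly_Mapping.keys P \<subseteq> {0}" by (auto simp: ratpoly_vars_def)
  show "P = 0"
  proof (rule ccontr)
    assume "P \<noteq> 0"
    then have "Poly_Mapping.keys P \<noteq> {}" by simp
    then have "Poly_Mapping.keys P = {0}" using keys by blast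
    then show False using P by (auto simp: ratpoly_eval_def in_keys_iff)
  qed
qed

text \<open>
  The coordinates are chosen one by one. Each time only the roots of countably many nonzero
  polynomials are forbidden, while every open interval is uncountable.
\<close>

lemma alg_independent_rat_dense:
  fixes t0 :: "'i \<Rightarrow> real"
  assumes "finite I" "\<epsilon> > 0"
  shows "\<exists>t. alg_independent_rat I t \<and> (\<forall>i\<in>I. \<bar>t i - t0 i\<bar> < \<epsilon>)"
  using assms(1)
proof (induction I)
  case empty
  then show ?case by (simp add: alg_independent_rat_empty)
next
  case (insert i I)
  then obtain t where t: "alg_independent_rat I t" "\<forall>i\<in>I. \<bar>t i - t0 i\<bar> < \<epsilon>" by auto
  let ?polys = "{P :: 'i ratpoly. ratpoly_vars P \<subseteq> insert i I \<and> P \<noteq> 0}"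
  let ?bad = "\<Union>P\<in>?polys. {x. ratpoly_eval (t(i := x)) P = 0}"
  have "countable ?polys"
    using countable_ratpolys[of "insert i I"] insert.hyps(1)
    by (rule_tac countable_subset[rotated]) (auto intro: countable_finite)
  then have "countable ?bad"
    using finite_zeros_new_variable[OF t(1)] by (intro countable_UN) (auto intro: countable_finite)
  moreover have "uncountable {t0 i - \<epsilon><..<t0 i + \<epsilon>}"
    using assms(2) by (simp add: uncountable_open_interval)
  ultimately have "\<not> {t0 i - \<epsilon><..<t0 i + \<epsilon>} \<subseteq> ?bad"
    by (meson countable_subset)
  then obtain x where x: "x \<in> {t0 i - \<epsilon><..<t0 i + \<epsilon>}" "x \<notin> ?bad" by blast
  have "alg_independent_rat (insert i I) (t(i := x))"
    unfolding alg_independent_rat_def using x(2) by auto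
  moreover have "\<forall>j\<in>insert i I. \<bar>(t(i := x)) j - t0 j\<bar> < \<epsilon>"
    using t(2) x(1) by auto
  ultimately show ?case by blast
qed

section \<open>The planes of the edges and slopes of maximal rank\<close>

lemma UNIV_coord: "(UNIV :: coord set) = {First, Second}"
  using coord.exhaust by auto

instance coord :: finite
  by standard (simp add: UNIV_coord)

definition incidence_vec :: "('v \<Rightarrow> real) \<Rightarrow> 'v \<Rightarrow> 'v \<Rightarrow> 'v \<times> coord \<Rightarrow> real" where
  "incidence_vec a u v =
     unit_vec (u, First) - a v *\<^sub>R unit_vec (u, Second) - unit_vec (v, Second)"

text \<open>
  For an edge with a point-vertex this end is a point-vertex; otherwise the choice is
  arbitrary.
\<close>

definition fst_end :: "'v pl_graph \<Rightarrow> 'v set \<Rightarrow> 'v" where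
  "fst_end G e = (SOME u. u \<in> e \<and> (e \<inter> point_verts G \<noteq> {} \<longrightarrow> u \<in> point_verts G))"

definition snd_end :: "'v pl_graph \<Rightarrow> 'v set \<Rightarrow> 'v" where
  "snd_end G e = other_end e (fst_end G e)"

text \<open>
  The two vectors spanning the plane of an edge. Only the first one of a point-line edge
  depends on the slopes, and it does so affinely.
\<close>

fun edge_gen :: "'v pl_graph \<Rightarrow> ('v \<Rightarrow> real) \<Rightarrow> 'v set \<times> coord \<Rightarrow> 'v \<times> coord \<Rightarrow> real" where
  "edge_gen G a (e, First) =
     (if fst_end G e \<in> point_verts G
      then if snd_end G e \<in> point_verts G
        then unit_vec (fst_end G e, First) - unit_vec (snd_end G e, First)
        else incidence_vec a (fst_end G e) (snd_end G e)
      else unit_vec (fst_end G e, First))"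
| "edge_gen G a (e, Second) =
     (if fst_end G e \<in> point_verts G \<and> snd_end G e \<in> point_verts G
      then unit_vec (fst_end G e, Second) - unit_vec (snd_end G e, Second)
      else unit_vec (snd_end G e, First))"

definition edge_rank :: "'v pl_graph \<Rightarrow> ('v \<Rightarrow> real) \<Rightarrow> 'v set set \<Rightarrow> nat" where
  "edge_rank G a J = dim (edge_gen G a ` (J \<times> UNIV))"

definition edge_span :: "'v pl_graph \<Rightarrow> ('v \<Rightarrow> real) \<Rightarrow> 'v set set \<Rightarrow> ('v \<times> coord \<Rightarrow> real) set" where
  "edge_span G a J = span (edge_gen G a ` (J \<times> UNIV))"

lemma edge_gen_in_span: "e \<in> J \<Longrightarrow> edge_gen G a (e, c) \<in> edge_span G a J"
  unfolding edge_span_def by (rule real_vector.span_base) auto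

text \<open>
  A basis of the image of a family, lifted to a set of indices.
\<close>

lemma independent_subfamily:
  fixes f :: "'i \<Rightarrow> 'a::real_vector"
  assumes "finite X"
  obtains T where "T \<subseteq> X" "family_independent f T" "card T = dim (f ` X)" "f ` X \<subseteq> span (f ` T)"
proof -
  obtain B where B: "B \<subseteq> f ` X" "finite B" "independent B" "f ` X \<subseteq> span B" "card B = dim (f ` X)"
    using finite_imageI[OF assms, of f] by (rule finite_basis_within)
  then obtain T where T: "T \<subseteq> X" "inj_on f T" "B = f ` T" using subset_image_inj[of B f X] by blast
  have "family_independent f T"
    using T B finite_subset[OF T(1) assms] family_independent_iff by blast
  moreover have "card T = dim (f ` X)" using T B card_image by metis
  ultimately show ?thesis using that T B by blast
qed

locale point_line =
  fixes G :: "'v pl_graph"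
  assumes plg: "point_line_graph G"
begin

abbreviation "P \<equiv> point_verts G"
abbreviation "L \<equiv> line_verts G"

text \<open>
  The edges of the complete graph on the vertices. All of them are considered, because edges
  between coincident points will be added to a given edge set.
\<close>

definition pairs :: "'v set set" where
  "pairs = {e. e \<subseteq> P \<union> L \<and> card e = 2}"

lemma finite_P: "finite P" and finite_L: "finite L" and PL_disjoint: "P \<inter> L = {}"
  using plg by (auto simp: point_line_graph_def)

lemma edges_subset_pairs: "edges G \<subseteq> pairs"
  using plg by (auto simp: point_line_graph_def pairs_def)

lemma finite_pairs: "finite pairs"
  unfolding pairs_def using finite_P finite_L
  by (rule_tac finite_subset[of _ "Pow (P \<union> L)"]) auto

lemma ends:
  assumes "e \<in> pairs"
  shows "e = {fst_end G e, snd_end G e}" "fst_end G e \<noteq> snd_end G e"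
    "snd_end G e \<in> P \<Longrightarrow> fst_end G e \<in> P"
proof -
  let ?Q = "\<lambda>u. u \<in> e \<and> (e \<inter> P \<noteq> {} \<longrightarrow> u \<in> P)"
  have c: "card e = 2" using assms by (simp add: pairs_def)
  then obtain x y where xy: "e = {x, y}" "x \<noteq> y" by (auto simp: card_2_iff)
  have "\<exists>u. ?Q u" using xy by auto
  then have Q: "?Q (fst_end G e)" unfolding fst_end_def by (rule someI_ex)
  have "e - {fst_end G e} = {if fst_end G e = x then y else x}" using Q xy by auto
  then have s: "snd_end G e = (if fst_end G e = x then y else x)"
    by (simp add: snd_end_def other_end_def)
  then show "e = {fst_end G e, snd_end G e}" "fst_end G e \<noteq> snd_end G e"
    "snd_end G e \<in> P \<Longrightarrow> fst_end G e \<in> P"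
    using Q xy by auto
qed

lemma pair_cases [consumes 1, case_names PP PL LL]:
  assumes "e \<in> pairs"
  obtains u v where "e = {u, v}" "u \<noteq> v" "u \<in> P" "v \<in> P"
      "\<And>a c. edge_gen G a (e, c) = unit_vec (u, c) - unit_vec (v, c)"
  | u v where "e = {u, v}" "u \<in> P" "v \<in> L" "\<And>a. edge_gen G a (e, First) = incidence_vec a u v"
      "\<And>a. edge_gen G a (e, Second) = unit_vec (v, First)"
  | u v where "e = {u, v}" "u \<noteq> v" "u \<in> L" "v \<in> L"
      "\<And>a. edge_gen G a (e, First) = unit_vec (u, First)"
      "\<And>a. edge_gen G a (e, Second) = unit_vec (v, First)"
proof -
  let ?u = "fst_end G e" and ?v = "snd_end G e"
  note en = ends[OF assms]
  have "e \<subseteq> P \<union> L" using assms by (simp add: pairs_def)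
  then have V: "?u \<in> P \<union> L" "?v \<in> P \<union> L" using en(1) by blast+
  consider "?u \<in> P" "?v \<in> P" | "?u \<in> P" "?v \<notin> P" | "?u \<notin> P" "?v \<notin> P" using en(3) by blast
  then show thesis
  proof cases
    case 1
    have "edge_gen G a (e, c) = unit_vec (?u, c) - unit_vec (?v, c)" for a c
      using 1 by (cases c) simp_all
    then show thesis using that(1)[of ?u ?v] 1 en by blast
  next
    case 2
    then show thesis using that(2)[of ?u ?v] V en by simp
  next
    case 3
    then show thesis using that(3)[of ?u ?v] V en by simp
  qed
qed

declare edge_gen.simps [simp del]

lemma edge_gen_PP:
  assumes "u \<in> P" "v \<in> P" "u \<noteq> v"
  shows "edge_gen G a ({u, v}, c) = unit_vec (u, c) - unit_vec (v, c) \<or>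
         edge_gen G a ({u, v}, c) = unit_vec (v, c) - unit_vec (u, c)"
proof -
  have "{u, v} \<in> pairs" using assms by (auto simp: pairs_def)
  then show ?thesis
  proof (cases rule: pair_cases)
    case (PP u' v')
    then show ?thesis by (auto simp: doubleton_eq_iff)
  qed (use assms PL_disjoint in \<open>auto simp: doubleton_eq_iff\<close>)
qed

lemma edge_gen_PL:
  assumes "u \<in> P" "v \<in> L"
  shows "edge_gen G a ({u, v}, First) = incidence_vec a u v"
    "edge_gen G a ({u, v}, Second) = unit_vec (v, First)"
proof -
  have "u \<noteq> v" using assms PL_disjoint by auto
  then have e: "{u, v} \<in> pairs" using assms by (auto simp: pairs_def)
  have "edge_gen G a ({u, v}, First) = incidence_vec a u v \<and>
    edge_gen G a ({u, v}, Second) = unit_vec (v, First)"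
    using e
  proof (cases rule: pair_cases)
    case (PL u' v')
    then have "u' = u" "v' = v" using assms PL_disjoint by (auto simp: doubleton_eq_iff)
    then show ?thesis using PL by simp
  qed (use assms PL_disjoint in \<open>auto simp: doubleton_eq_iff\<close>)
  then show "edge_gen G a ({u, v}, First) = incidence_vec a u v"
    "edge_gen G a ({u, v}, Second) = unit_vec (v, First)" by auto
qed

lemma unit_vec_line_in_edge_span:
  assumes "J \<subseteq> pairs" "e \<in> J" "v \<in> e" "v \<in> L"
  shows "unit_vec (v, First) \<in> edge_span G a J"
proof -
  have "e \<in> pairs" using assms by auto
  then show ?thesis
    using edge_gen_in_span[OF assms(2), of G a First] edge_gen_in_span[OF assms(2), of G a Second]
      assms(3,4) PL_disjoint
    by (cases rule: pair_cases) auto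
qed

lemma edge_gen_support:
  assumes "e \<in> pairs" "c \<notin> (P \<union> L) \<times> UNIV"
  shows "edge_gen G a (e, i) c = 0"
  using assms
  by (cases rule: pair_cases; cases i) (auto simp: unit_vec_apply incidence_vec_def)

lemma tendsto_edge_gen:
  assumes "\<And>v. ((\<lambda>n. A n v) \<longlongrightarrow> a v) F"
  shows "((\<lambda>n. edge_gen G (A n) (e, i) c) \<longlongrightarrow> edge_gen G a (e, i) c) F"
proof (cases i)
  case First
  show ?thesis unfolding First by (auto simp: edge_gen.simps incidence_vec_def intro!: tendsto_intros assms)
next
  case Second
  show ?thesis unfolding Second by (simp add: edge_gen.simps)
qed

text \<open>
  Rank is lower semicontinuous: a basis at the limit slopes stays independent nearby.
\<close>

lemma eventually_edge_rank_ge: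
  assumes J: "J \<subseteq> pairs" and lim: "\<And>v. ((\<lambda>n. A n v) \<longlongrightarrow> a v) F"
  shows "\<forall>\<^sub>F n in F. edge_rank G a J \<le> edge_rank G (A n) J"
proof -
  have finJ: "finite (J \<times> (UNIV :: coord set))"
    using finite_subset[OF J finite_pairs] by simp
  then obtain T where T: "T \<subseteq> J \<times> UNIV" "family_independent (edge_gen G a) T"
    "card T = edge_rank G a J"
    unfolding edge_rank_def by (rule independent_subfamily)
  have finT: "finite T" using T(1) finJ finite_subset by blast
  have "\<forall>\<^sub>F n in F. family_independent (edge_gen G (A n)) T"
  proof (rule eventually_family_independent[OF T(2) finT, of "(P \<union> L) \<times> UNIV"])
    show "finite ((P \<union> L) \<times> (UNIV :: coord set))" using finite_P finite_L by simp
    show "((\<lambda>n. edge_gen G (A n) i c) \<longlongrightarrow> edge_gen G a i c) F" for i c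
      using tendsto_edge_gen[OF lim] by (cases i) simp
    have "edge_gen G a' i c = 0" if "i \<in> T" "c \<notin> (P \<union> L) \<times> UNIV" for a' i c
    proof (cases i)
      case (Pair e d)
      then have "e \<in> pairs" using that(1) T(1) J by auto
      then show ?thesis using Pair edge_gen_support that(2) by blast
    qed
    then show "i \<in> T \<Longrightarrow> c \<notin> (P \<union> L) \<times> UNIV \<Longrightarrow> edge_gen G a i c = 0"
      "i \<in> T \<Longrightarrow> c \<notin> (P \<union> L) \<times> UNIV \<Longrightarrow> edge_gen G (A n) i c = 0" for n i c
      by blast+
  qed
  then show ?thesis
  proof (rule eventually_mono)
    fix n assume ind: "family_independent (edge_gen G (A n)) T"
    have "edge_gen G (A n) ` T \<subseteq> span (edge_gen G (A n) ` (J \<times> UNIV))"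
      using T(1) real_vector.span_superset by blast
    then show "edge_rank G a J \<le> edge_rank G (A n) J"
      using card_family_le_dim[OF ind finT] finJ T(3) by (simp add: edge_rank_def)
  qed
qed

text \<open>
  By semicontinuity, a maximum of the sum is a local maximum of each single rank.
\<close>

definition maximal_slopes :: "('v \<Rightarrow> real) \<Rightarrow> bool" where
  "maximal_slopes a \<longleftrightarrow>
     (\<forall>a'. (\<Sum>J\<in>Pow pairs. edge_rank G a' J) \<le> (\<Sum>J\<in>Pow pairs. edge_rank G a J))"

lemma ex_maximal_slopes: "\<exists>a. maximal_slopes a"
proof -
  let ?f = "\<lambda>a. \<Sum>J\<in>Pow pairs. edge_rank G a J"
  have bound: "?f a \<le> (\<Sum>J\<in>Pow pairs. card (J \<times> (UNIV :: coord set)))" for a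
  proof (rule sum_mono)
    fix J assume "J \<in> Pow pairs"
    then have "finite J" using finite_pairs finite_subset by blast
    then have fin: "finite (J \<times> (UNIV :: coord set))" by simp
    then show "edge_rank G a J \<le> card (J \<times> (UNIV :: coord set))"
      using real_vector.dim_le_card[OF real_vector.span_superset, of "edge_gen G a ` (J \<times> UNIV)"]
        card_image_le[OF fin, of "edge_gen G a"] unfolding edge_rank_def by force
  qed
  then have "\<exists>a. True \<and> (\<forall>a'. True \<longrightarrow> ?f a' \<le> ?f a)"
    by (intro ex_has_greatest_nat[of "\<lambda>_. True" _ _ "(\<Sum>J\<in>Pow pairs. card (J \<times> (UNIV :: coord set))) + 1"])
      (auto simp: less_Suc_eq_le)
  then show ?thesis by (auto simp: maximal_slopes_def)
qed

text \<open>
  If \<open>x\<close> were outside the span at \<open>a\<close>, then a basis at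
  \<open>a\<close> together with \<open>x\<close> would stay independent for small
  \<open>t\<close>. For \<open>t \<noteq> 0\<close> all these vectors lie in the span
  belonging to the perturbed slopes, so one rank would grow while the others do not drop.
\<close>

lemma in_edge_span_if_in_perturbed_spans:
  assumes max: "maximal_slopes a" and J: "J \<subseteq> pairs"
    and supp: "\<And>c. c \<notin> (P \<union> L) \<times> UNIV \<Longrightarrow> x c = 0"
    and pert: "\<And>t. t \<noteq> 0 \<Longrightarrow> x \<in> edge_span G (a(k := a k + t)) J"
  shows "x \<in> edge_span G a J"
proof (rule ccontr)
  assume notin: "x \<notin> edge_span G a J"
  let ?A = "\<lambda>t. a(k := a k + t)"
  let ?F = "at (0::real)"
  have lim: "((\<lambda>t. ?A t v) \<longlongrightarrow> a v) ?F" for v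
    by (cases "v = k") (auto intro!: tendsto_eq_intros)
  have finJ: "finite (J \<times> (UNIV :: coord set))"
    using finite_subset[OF J finite_pairs] by simp
  obtain T where T: "T \<subseteq> J \<times> UNIV" "family_independent (edge_gen G a) T"
    "card T = edge_rank G a J"
    using finJ unfolding edge_rank_def by (rule independent_subfamily)
  have finT: "finite T" using T(1) finJ finite_subset by blast
  \<comment> \<open>The index \<open>None\<close> stands for the additional vector
      \<open>x\<close>.\<close>
  define w where "w t i = (case i of None \<Rightarrow> x | Some i \<Rightarrow> edge_gen G (?A t) i)" for t i
  let ?T = "insert None (Some ` T)"
  have w0: "w 0 (Some i) = edge_gen G a i" "w t None = x" for i t
    by (simp_all add: w_def)
  have ind0: "family_independent (w 0) ?T"
  proof -
    have indT: "inj_on (edge_gen G a) T" "independent (edge_gen G a ` T)"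
      using T(2) finT family_independent_iff by blast+
    have "edge_gen G a ` T \<subseteq> edge_gen G a ` (J \<times> UNIV)" using T(1) by blast
    then have nx: "x \<notin> span (edge_gen G a ` T)"
      using notin real_vector.span_mono unfolding edge_span_def by blast
    have img: "w 0 ` Some ` T = edge_gen G a ` T" by (simp add: image_image w0)
    have "inj_on (w 0) ?T"
      unfolding inj_on_insert
    proof
      show "inj_on (w 0) (Some ` T)" using indT(1) by (auto simp: inj_on_def w0)
      show "w 0 None \<notin> w 0 ` (Some ` T - {None})"
        using nx real_vector.span_base[of x] img w0(2) by auto
    qed
    moreover have "independent (w 0 ` ?T)"
      using nx indT(2) by (simp add: img w0 real_vector.independent_insertI)
    ultimately show ?thesis using finT family_independent_iff[of ?T] by blast
  qed
  have evw: "\<forall>\<^sub>F t in ?F. family_independent (w t) ?T"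
  proof (rule eventually_family_independent[OF ind0, of "(P \<union> L) \<times> UNIV"])
    show "finite ((P \<union> L) \<times> (UNIV :: coord set))" using finite_P finite_L by simp
    show "((\<lambda>t. w t i c) \<longlongrightarrow> w 0 i c) ?F" for i c
    proof (cases i)
      case (Some j)
      obtain e d where j: "j = (e, d)" by (cases j)
      have "((\<lambda>t. edge_gen G (?A t) (e, d) c) \<longlongrightarrow> edge_gen G a (e, d) c) ?F"
        by (rule tendsto_edge_gen) (rule lim)
      then show ?thesis unfolding w_def Some j by simp
    qed (simp add: w_def)
    have "w t i c = 0" if "i \<in> ?T" "c \<notin> (P \<union> L) \<times> UNIV" for t i c
    proof (cases i)
      case (Some j)
      obtain e d where j: "j = (e, d)" by (cases j)
      have "j \<in> T" using that(1) Some by auto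
      then have "e \<in> pairs" using T(1) J j by auto
      then show ?thesis using j Some edge_gen_support that(2) by (simp add: w_def)
    qed (use supp that in \<open>simp add: w_def\<close>)
    then show "i \<in> ?T \<Longrightarrow> c \<notin> (P \<union> L) \<times> UNIV \<Longrightarrow> w 0 i c = 0"
      "i \<in> ?T \<Longrightarrow> c \<notin> (P \<union> L) \<times> UNIV \<Longrightarrow> w t i c = 0" for t i c
      by blast+
  qed (use finT in simp)
  have "\<forall>\<^sub>F t in ?F. \<forall>J'\<in>Pow pairs. edge_rank G a J' \<le> edge_rank G (?A t) J'"
  proof (intro eventually_ball_finite ballI)
    show "\<forall>\<^sub>F t in ?F. edge_rank G a J' \<le> edge_rank G (?A t) J'" if "J' \<in> Pow pairs" for J'
      using that by (intro eventually_edge_rank_ge lim) simp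
  qed (use finite_pairs in simp)
  with evw have ev: "\<forall>\<^sub>F t in ?F. family_independent (w t) ?T \<and> t \<noteq> 0 \<and>
      (\<forall>J'\<in>Pow pairs. edge_rank G a J' \<le> edge_rank G (?A t) J')"
    by (intro eventually_conj) (auto simp: eventually_at_filter)
  obtain t where t: "family_independent (w t) ?T" "t \<noteq> 0"
    "\<And>J'. J' \<in> Pow pairs \<Longrightarrow> edge_rank G a J' \<le> edge_rank G (?A t) J'"
    using eventually_happens'[OF at_neq_bot ev] by blast
  have "w t ` ?T \<subseteq> edge_span G (?A t) J"
    using pert[OF t(2)] T(1) edge_gen_in_span[of _ J G "?A t"] by (auto simp: w_def)
  then have "card ?T \<le> edge_rank G (?A t) J"
    using card_family_le_dim[OF t(1)] finT finJ by (simp add: edge_rank_def edge_span_def)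
  moreover have "card ?T = edge_rank G a J + 1"
    using finT T(3) by (simp add: card_image)
  ultimately have "edge_rank G a J < edge_rank G (?A t) J" by simp
  then have "(\<Sum>J\<in>Pow pairs. edge_rank G a J) < (\<Sum>J\<in>Pow pairs. edge_rank G (?A t) J)"
    using t(3) J finite_pairs by (intro sum_strict_mono_ex1) auto
  then show False using max by (simp add: maximal_slopes_def not_less[symmetric])
qed

end

lemma rho_le_partition:
  assumes "finite A" "partition_on A \<P>"
  shows "rho G A \<le> (\<Sum>B\<in>\<P>. 2 * nu_P G B + nu_L G B - 2)"
  unfolding rho_def using assms finitely_many_partition_on[OF assms(1)]
  by (intro Min_le) auto

lemma rho_attained:
  assumes "finite A"
  obtains \<P> where "partition_on A \<P>" "rho G A = (\<Sum>B\<in>\<P>. 2 * nu_P G B + nu_L G B - 2)"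
proof -
  have "{\<P>. partition_on A \<P>} \<noteq> {}"
    using partition_on_space[of A] partition_on_empty by (cases "A = {}") auto
  then have "rho G A \<in> (\<lambda>\<P>. \<Sum>B\<in>\<P>. 2 * nu_P G B + nu_L G B - 2) ` {\<P>. partition_on A \<P>}"
    unfolding rho_def using finitely_many_partition_on[OF assms] by (intro Min_in) auto
  then show ?thesis using that by auto
qed

section \<open>Stresses at slopes of maximal rank\<close>

locale maximal_placement = point_line +
  fixes a :: "'a \<Rightarrow> real" and J :: "'a set set"
  assumes max: "maximal_slopes a" and J: "J \<subseteq> pairs"
begin

definition PJ :: "'a set" where "PJ = {u \<in> P. \<exists>e\<in>J. u \<in> e}"

abbreviation "W \<equiv> edge_span G a J"

lemma PJ_subset: "PJ \<subseteq> P" and finite_PJ: "finite PJ"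
  using finite_P by (auto simp: PJ_def)

lemma finite_J: "finite J"
  using J finite_pairs finite_subset by blast

lemma subspace_W: "subspace W"
  by (simp add: edge_span_def)

text \<open>
  Equivalently, all functionals that vanish on the planes of \<open>J\<close> take the same
  values at the two points.
\<close>

definition coincident :: "'a \<Rightarrow> 'a \<Rightarrow> bool" where
  "coincident j j' \<longleftrightarrow> (\<forall>c. unit_vec (j, c) - unit_vec (j', c) \<in> W)"

lemma coincident_refl: "coincident j j"
  using real_vector.subspace_0[OF subspace_W] by (simp add: coincident_def)

lemma coincident_sym: "coincident j j' \<Longrightarrow> coincident j' j"
  unfolding coincident_def using real_vector.subspace_neg[OF subspace_W]
  by (metis minus_diff_eq)

lemma coincident_trans: "coincident j j' \<Longrightarrow> coincident j' j'' \<Longrightarrow> coincident j j''"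
  unfolding coincident_def
proof
  fix c
  assume "\<forall>c. unit_vec (j, c) - unit_vec (j', c) \<in> W" "\<forall>c. unit_vec (j', c) - unit_vec (j'', c) \<in> W"
  then have "(unit_vec (j, c) - unit_vec (j', c)) + (unit_vec (j', c) - unit_vec (j'', c)) \<in> W"
    using real_vector.subspace_add[OF subspace_W] by blast
  then show "unit_vec (j, c) - unit_vec (j'', c) \<in> W" by simp
qed

definition rep :: "'a \<Rightarrow> 'a" where
  "rep j = (SOME j'. j' \<in> PJ \<and> coincident j j')"

lemma rep_props:
  assumes "j \<in> PJ"
  shows "rep j \<in> PJ" "coincident j (rep j)"
proof -
  have "\<exists>j'. j' \<in> PJ \<and> coincident j j'" using assms coincident_refl by blast
  then have "rep j \<in> PJ \<and> coincident j (rep j)" unfolding rep_def by (rule someI_ex)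
  then show "rep j \<in> PJ" "coincident j (rep j)" by auto
qed

lemma rep_eq_if_coincident:
  assumes "coincident j j'"
  shows "rep j = rep j'"
proof -
  have "(\<lambda>x. x \<in> PJ \<and> coincident j x) = (\<lambda>x. x \<in> PJ \<and> coincident j' x)"
    using assms coincident_sym coincident_trans by blast
  then show ?thesis by (simp add: rep_def)
qed

lemma rep_rep: "j \<in> PJ \<Longrightarrow> rep (rep j) = rep j"
  using rep_props(2) rep_eq_if_coincident by metis

lemma rep_of_rep: "q \<in> rep ` PJ \<Longrightarrow> rep q = q" "q \<in> rep ` PJ \<Longrightarrow> q \<in> PJ"
  using rep_rep rep_props(1) by auto

text \<open>
  Adding edges inside the coincidence classes does not change the span at \<open>a\<close>. At
  perturbed slopes it makes the differences within a class available, so that local maximality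
  can be applied to dependencies that use them.
\<close>

definition braced :: "'a set set" where
  "braced = J \<union> (\<lambda>j. {j, rep j}) ` {j \<in> PJ. rep j \<noteq> j}"

lemma braced_subset_pairs: "braced \<subseteq> pairs"
proof -
  have "{j, rep j} \<in> pairs" if "j \<in> PJ" "rep j \<noteq> j" for j
    using that rep_props(1)[OF that(1)] PJ_subset by (auto simp: pairs_def)
  then show ?thesis using J by (auto simp: braced_def)
qed

lemma rep_difference_in_braced_span:
  assumes "j \<in> PJ"
  shows "unit_vec (j, c) - unit_vec (rep j, c) \<in> edge_span G a' braced"
proof (cases "rep j = j")
  case True
  then show ?thesis using real_vector.span_zero by (simp add: edge_span_def)
next
  case False
  then have "{j, rep j} \<in> braced" using assms by (auto simp: braced_def)
  then have g: "edge_gen G a' ({j, rep j}, c) \<in> edge_span G a' braced" by (rule edge_gen_in_span)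
  have "j \<in> P" "rep j \<in> P" using assms rep_props(1) PJ_subset by auto
  then consider "edge_gen G a' ({j, rep j}, c) = unit_vec (j, c) - unit_vec (rep j, c)"
    | "edge_gen G a' ({j, rep j}, c) = unit_vec (rep j, c) - unit_vec (j, c)"
    using edge_gen_PP False by metis
  then show ?thesis
  proof cases
    case 2
    then have "- (unit_vec (rep j, c) - unit_vec (j, c)) \<in> edge_span G a' braced"
      using g unfolding edge_span_def by (metis real_vector.span_neg)
    then show ?thesis by simp
  qed (use g in simp)
qed

lemma braced_span: "edge_span G a braced = W"
proof
  have "edge_gen G a (e, c) \<in> W" if "e \<in> braced" for e c
  proof (cases "e \<in> J")
    case False
    then obtain j where j: "j \<in> PJ" "rep j \<noteq> j" "e = {j, rep j}" using \<open>e \<in> braced\<close> by (auto simp: braced_def)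
    have P: "j \<in> P" "rep j \<in> P" using j rep_props(1) PJ_subset by auto
    have c: "coincident j (rep j)" "coincident (rep j) j"
      using rep_props(2)[OF j(1)] coincident_sym by blast+
    show ?thesis
      using edge_gen_PP[OF P, of a c] j(2,3) c by (auto simp: coincident_def)
  qed (rule edge_gen_in_span)
  then have "edge_gen G a ` (braced \<times> UNIV) \<subseteq> W" by auto
  then show "edge_span G a braced \<subseteq> W"
    unfolding edge_span_def[of G a braced] using subspace_W by (rule real_vector.span_minimal)
  show "W \<subseteq> edge_span G a braced"
    unfolding edge_span_def by (rule real_vector.span_mono) (auto simp: braced_def)
qed

text \<open>
  The coefficients of the incidence vectors in a linear dependency between these and the
  difference vectors inside the coincidence classes. The first condition on sums is the
  balance in the second column of every line, the other two are the balance in both columns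
  summed over a class.
\<close>

definition stress :: "('a \<Rightarrow> 'a \<Rightarrow> real) \<Rightarrow> bool" where
  "stress \<omega> \<longleftrightarrow>
     (\<forall>j k. \<omega> j k \<noteq> 0 \<longrightarrow> j \<in> PJ \<and> k \<in> L \<and> {j, k} \<in> J) \<and>
     (\<forall>k\<in>L. (\<Sum>j\<in>PJ. \<omega> j k) = 0) \<and>
     (\<forall>q\<in>rep ` PJ. (\<Sum>j\<in>{j \<in> PJ. rep j = q}. \<Sum>k\<in>L. \<omega> j k) = 0 \<and>
                   (\<Sum>j\<in>{j \<in> PJ. rep j = q}. \<Sum>k\<in>L. \<omega> j k * a k) = 0)"

lemma stressD:
  assumes "stress \<omega>"
  shows "\<omega> j k \<noteq> 0 \<Longrightarrow> j \<in> PJ \<and> k \<in> L \<and> {j, k} \<in> J"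
    "k \<in> L \<Longrightarrow> (\<Sum>j\<in>PJ. \<omega> j k) = 0"
    "q \<in> rep ` PJ \<Longrightarrow> (\<Sum>j\<in>{j \<in> PJ. rep j = q}. \<Sum>k\<in>L. \<omega> j k) = 0"
    "q \<in> rep ` PJ \<Longrightarrow> (\<Sum>j\<in>{j \<in> PJ. rep j = q}. \<Sum>k\<in>L. \<omega> j k * a k) = 0"
  using assms by (auto simp: stress_def)

text \<open>
  Moving all the mass of a class to its representative costs difference vectors only, and
  there it cancels.
\<close>

lemma class_balanced_in_braced_span:
  assumes "\<And>q. q \<in> rep ` PJ \<Longrightarrow> (\<Sum>j\<in>{j \<in> PJ. rep j = q}. d j) = 0"
  shows "(\<Sum>j\<in>PJ. d j *\<^sub>R unit_vec (j, c)) \<in> edge_span G a' braced"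
proof -
  have "(\<Sum>j\<in>PJ. d j *\<^sub>R unit_vec (rep j, c)) =
      (\<Sum>q\<in>rep ` PJ. \<Sum>j\<in>{j \<in> PJ. rep j = q}. d j *\<^sub>R unit_vec (rep j, c))"
    by (rule sum.image_gen[OF finite_PJ])
  also have "\<dots> = (\<Sum>q\<in>rep ` PJ. (\<Sum>j\<in>{j \<in> PJ. rep j = q}. d j) *\<^sub>R unit_vec (q, c))"
    unfolding scaleR_sum_left by (intro sum.cong refl) auto
  also have "\<dots> = 0" using assms by (intro sum.neutral) auto
  finally have "(\<Sum>j\<in>PJ. d j *\<^sub>R unit_vec (j, c)) =
      (\<Sum>j\<in>PJ. d j *\<^sub>R (unit_vec (j, c) - unit_vec (rep j, c)))"
    by (simp add: scaleR_diff_right sum_subtractf)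
  also have "\<dots> \<in> edge_span G a' braced"
    using rep_difference_in_braced_span[of _ c a'] unfolding edge_span_def
    by (intro real_vector.span_sum real_vector.span_scale)
  finally show ?thesis .
qed

text \<open>
  The vector is, up to sign, the derivative with respect to the slope of \<open>k0\<close> of
  the combination of incidence vectors with coefficients \<open>\<omega>\<close>. That
  combination lies in the span of the difference vectors at \<open>a\<close>, and it is affine
  in the slope. Therefore its change under a perturbation, a multiple of the derivative, lies
  in the span of the perturbed planes, and maximality of the rank puts it into the span at
  \<open>a\<close>.
\<close>

lemma stress_derivative_in_span:
  assumes st: "stress \<omega>" and k0: "k0 \<in> L"
  shows "(\<Sum>j\<in>PJ. \<omega> j k0 *\<^sub>R unit_vec (j, Second)) \<in> W"
proof -
  let ?\<mu> = "\<Sum>j\<in>PJ. \<omega> j k0 *\<^sub>R unit_vec (j, Second)"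
  have "?\<mu> \<in> edge_span G a braced"
  proof (rule in_edge_span_if_in_perturbed_spans[OF max braced_subset_pairs])
    show "?\<mu> c = 0" if "c \<notin> (P \<union> L) \<times> UNIV" for c
      using that PJ_subset by (auto simp: unit_vec_apply intro!: sum.neutral)
    fix t :: real assume t: "t \<noteq> 0"
    let ?a = "a(k0 := a k0 + t)"
    let ?S = "edge_span G ?a braced"
    have sub: "subspace ?S" by (simp add: edge_span_def)
    \<comment> \<open>The incidence vectors at the perturbed slopes, combined by the stress:
        up to vectors of the braced span this is \<open>- t\<close> times the sum in
        question.\<close>
    define X where "X = (\<Sum>j\<in>PJ. \<Sum>k\<in>L. \<omega> j k *\<^sub>R incidence_vec ?a j k)"
    have X: "X \<in> ?S" unfolding X_def
    proof (intro real_vector.subspace_sum[OF sub])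
      fix j k assume "j \<in> PJ" "k \<in> L"
      show "\<omega> j k *\<^sub>R incidence_vec ?a j k \<in> ?S"
      proof (cases "\<omega> j k = 0")
        case True
        then show ?thesis using real_vector.subspace_0[OF sub] by simp
      next
        case False
        then have "{j, k} \<in> braced" using stressD(1)[OF st] by (auto simp: braced_def)
        then have "edge_gen G ?a ({j, k}, First) \<in> ?S" by (rule edge_gen_in_span)
        then show ?thesis
          using edge_gen_PL(1)[of j k ?a] \<open>j \<in> PJ\<close> \<open>k \<in> L\<close> PJ_subset
            real_vector.subspace_scale[OF sub] by auto
      qed
    qed
    define D1 where "D1 = (\<Sum>j\<in>PJ. (\<Sum>k\<in>L. \<omega> j k) *\<^sub>R unit_vec (j, First))"
    define D2 where "D2 = (\<Sum>j\<in>PJ. (\<Sum>k\<in>L. \<omega> j k * a k) *\<^sub>R unit_vec (j, Second))"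
    have D12: "D1 \<in> ?S" "D2 \<in> ?S"
      unfolding D1_def D2_def using stressD(3,4)[OF st]
      by (intro class_balanced_in_braced_span; simp)+
    have "X = (\<Sum>j\<in>PJ. \<Sum>k\<in>L. \<omega> j k *\<^sub>R unit_vec (j, First) - (\<omega> j k * a k) *\<^sub>R unit_vec (j, Second)
        - \<omega> j k *\<^sub>R unit_vec (k, Second) - (if k = k0 then t *\<^sub>R \<omega> j k0 *\<^sub>R unit_vec (j, Second) else 0))"
      unfolding X_def
      by (intro sum.cong refl) (auto simp: incidence_vec_def algebra_simps)
    also have "\<dots> = D1 - D2 - (\<Sum>j\<in>PJ. \<Sum>k\<in>L. \<omega> j k *\<^sub>R unit_vec (k, Second)) - t *\<^sub>R ?\<mu>"
      using finite_L k0
      by (simp add: sum_subtractf D1_def D2_def scaleR_sum_left scaleR_sum_right)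
    also have "(\<Sum>j\<in>PJ. \<Sum>k\<in>L. \<omega> j k *\<^sub>R unit_vec (k, Second)) =
        (\<Sum>k\<in>L. (\<Sum>j\<in>PJ. \<omega> j k) *\<^sub>R unit_vec (k, Second))"
      unfolding scaleR_sum_left by (rule sum.swap)
    also have "\<dots> = 0" using stressD(2)[OF st] by (intro sum.neutral) simp
    finally have "X = D1 - D2 - 0 - t *\<^sub>R ?\<mu>" .
    moreover have "y = A - x" if "x = A - 0 - y" for x y A :: "'a \<times> coord \<Rightarrow> real"
      unfolding that by (rule ext) simp
    ultimately have "t *\<^sub>R ?\<mu> = D1 - D2 - X" by blast
    moreover have "D1 - D2 - X \<in> ?S"
      using D12 X by (intro real_vector.subspace_diff[OF sub])
    ultimately have "t *\<^sub>R ?\<mu> \<in> ?S" by (simp only:)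
    then have "(1 / t) *\<^sub>R t *\<^sub>R ?\<mu> \<in> ?S" by (rule real_vector.subspace_scale[OF sub])
    then show "?\<mu> \<in> ?S" using t by simp
  qed
  then show ?thesis by (simp only: braced_span)
qed

text \<open>
  Multipliers form an algebra of functions on the points that are constant on coincidence
  classes. It will be large enough to contain the indicator function of each class.
\<close>

definition multiplier :: "('a \<Rightarrow> real) \<Rightarrow> bool" where
  "multiplier \<psi> \<longleftrightarrow> (\<forall>j\<in>PJ. \<psi> (rep j) = \<psi> j) \<and>
     (\<forall>\<omega>. stress \<omega> \<longrightarrow> stress (\<lambda>j k. \<psi> j * \<omega> j k))"

lemma stress_times:
  assumes st: "stress \<omega>" and cl: "\<And>j. j \<in> PJ \<Longrightarrow> \<psi> (rep j) = \<psi> j"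
    and bal: "\<And>k. k \<in> L \<Longrightarrow> (\<Sum>j\<in>PJ. \<psi> j * \<omega> j k) = 0"
  shows "stress (\<lambda>j k. \<psi> j * \<omega> j k)"
  unfolding stress_def
proof (intro conjI allI impI ballI)
  fix j k assume "\<psi> j * \<omega> j k \<noteq> 0"
  then show "j \<in> PJ" "k \<in> L" "{j, k} \<in> J" using stressD(1)[OF st, of j k] by auto
next
  fix k assume "k \<in> L" then show "(\<Sum>j\<in>PJ. \<psi> j * \<omega> j k) = 0" by (rule bal)
next
  fix q assume q: "q \<in> rep ` PJ"
  have \<psi>: "\<psi> j = \<psi> q" if "j \<in> {j \<in> PJ. rep j = q}" for j using cl that by auto
  have "(\<Sum>j\<in>{j \<in> PJ. rep j = q}. \<Sum>k\<in>L. \<psi> j * \<omega> j k) =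
      (\<Sum>j\<in>{j \<in> PJ. rep j = q}. \<psi> q * (\<Sum>k\<in>L. \<omega> j k))"
    using \<psi> by (intro sum.cong refl) (simp add: sum_distrib_left)
  also have "\<dots> = 0" using stressD(3)[OF st q] by (simp add: sum_distrib_left[symmetric])
  finally show "(\<Sum>j\<in>{j \<in> PJ. rep j = q}. \<Sum>k\<in>L. \<psi> j * \<omega> j k) = 0" .
  have "(\<Sum>j\<in>{j \<in> PJ. rep j = q}. \<Sum>k\<in>L. \<psi> j * \<omega> j k * a k) =
      (\<Sum>j\<in>{j \<in> PJ. rep j = q}. \<psi> q * (\<Sum>k\<in>L. \<omega> j k * a k))"
    using \<psi> by (intro sum.cong refl) (simp add: sum_distrib_left mult.assoc)
  also have "\<dots> = 0" using stressD(4)[OF st q] by (simp add: sum_distrib_left[symmetric])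
  finally show "(\<Sum>j\<in>{j \<in> PJ. rep j = q}. \<Sum>k\<in>L. \<psi> j * \<omega> j k * a k) = 0" .
qed

text \<open>
  For the second coordinate this is the derivative condition. The first coordinate is reduced
  to the second one, since on the points of a line \<open>k\<close> a functional vanishing on
  the incidence vectors satisfies the equation of a line of slope \<open>a k\<close>.
\<close>

lemma multiplier_motion:
  assumes lin: "linear \<phi>" and W: "\<And>x. x \<in> W \<Longrightarrow> \<phi> x = 0"
  shows "multiplier (\<lambda>j. \<phi> (unit_vec (j, c)))"
  unfolding multiplier_def
proof (intro conjI ballI allI impI)
  show cl: "\<phi> (unit_vec (rep j, c)) = \<phi> (unit_vec (j, c))" if "j \<in> PJ" for j
  proof -
    have "\<phi> (unit_vec (j, c) - unit_vec (rep j, c)) = 0"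
      using rep_props(2)[OF that] by (intro W) (simp add: coincident_def)
    then show ?thesis by (simp add: linear_diff[OF lin])
  qed
  fix \<omega> assume st: "stress \<omega>"
  have second: "(\<Sum>j\<in>PJ. \<phi> (unit_vec (j, Second)) * \<omega> j k) = 0" if "k \<in> L" for k
  proof -
    have "\<phi> (\<Sum>j\<in>PJ. \<omega> j k *\<^sub>R unit_vec (j, Second)) = 0"
      by (rule W) (rule stress_derivative_in_span[OF st that])
    then show ?thesis
      by (simp add: linear_sum[OF lin] linear_scale[OF lin] mult.commute)
  qed
  have first: "(\<Sum>j\<in>PJ. \<phi> (unit_vec (j, First)) * \<omega> j k) = 0" if k: "k \<in> L" for k
  proof -
    have "\<phi> (unit_vec (j, First)) * \<omega> j k =
        a k * (\<phi> (unit_vec (j, Second)) * \<omega> j k) + \<phi> (unit_vec (k, Second)) * \<omega> j k"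
      if "j \<in> PJ" for j
    proof (cases "\<omega> j k = 0")
      case False
      then have "{j, k} \<in> J" using stressD(1)[OF st] by blast
      then have "\<phi> (edge_gen G a ({j, k}, First)) = 0" by (intro W edge_gen_in_span)
      then have "\<phi> (incidence_vec a j k) = 0" using edge_gen_PL(1)[of j k a] k that PJ_subset by auto
      then have "\<phi> (unit_vec (j, First)) = a k * \<phi> (unit_vec (j, Second)) + \<phi> (unit_vec (k, Second))"
        by (simp add: incidence_vec_def linear_diff[OF lin] linear_scale[OF lin])
      then show ?thesis by (simp add: algebra_simps)
    qed simp
    then have "(\<Sum>j\<in>PJ. \<phi> (unit_vec (j, First)) * \<omega> j k) =
        a k * (\<Sum>j\<in>PJ. \<phi> (unit_vec (j, Second)) * \<omega> j k) + \<phi> (unit_vec (k, Second)) * (\<Sum>j\<in>PJ. \<omega> j k)"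
      by (simp add: sum.distrib sum_distrib_left)
    then show ?thesis using second[OF k] stressD(2)[OF st k] by simp
  qed
  show "stress (\<lambda>j k. \<phi> (unit_vec (j, c)) * \<omega> j k)"
  proof (rule stress_times[where \<psi> = "\<lambda>j. \<phi> (unit_vec (j, c))", OF st])
    show "(\<Sum>j\<in>PJ. \<phi> (unit_vec (j, c)) * \<omega> j k) = 0" if "k \<in> L" for k
      using first[OF that] second[OF that] by (cases c) simp_all
  qed (rule cl)
qed

lemma multiplier_affine:
  assumes "multiplier \<psi>"
  shows "multiplier (\<lambda>j. (\<psi> j - s) / r)"
  unfolding multiplier_def
proof (intro conjI ballI allI impI)
  show cl: "(\<psi> (rep j) - s) / r = (\<psi> j - s) / r" if "j \<in> PJ" for j
    using assms that by (simp add: multiplier_def)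
  fix \<omega> assume st: "stress \<omega>"
  then have st': "stress (\<lambda>j k. \<psi> j * \<omega> j k)" using assms by (simp add: multiplier_def)
  show "stress (\<lambda>j k. (\<psi> j - s) / r * \<omega> j k)"
  proof (rule stress_times[where \<psi> = "\<lambda>j. (\<psi> j - s) / r", OF st])
    fix k assume k: "k \<in> L"
    have "(\<Sum>j\<in>PJ. (\<psi> j - s) / r * \<omega> j k) = (\<Sum>j\<in>PJ. (\<psi> j * \<omega> j k) / r - (s / r) * \<omega> j k)"
      by (intro sum.cong refl) (simp add: diff_divide_distrib left_diff_distrib)
    also have "\<dots> = (\<Sum>j\<in>PJ. \<psi> j * \<omega> j k) / r - (s / r) * (\<Sum>j\<in>PJ. \<omega> j k)"
      by (simp add: sum_subtractf sum_distrib_left sum_divide_distrib)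
    finally show "(\<Sum>j\<in>PJ. (\<psi> j - s) / r * \<omega> j k) = 0"
      using stressD(2)[OF st k] stressD(2)[OF st' k] by simp
  qed (rule cl)
qed

lemma multiplier_prod:
  assumes "finite A" "\<And>i. i \<in> A \<Longrightarrow> multiplier (\<psi> i)"
  shows "multiplier (\<lambda>j. \<Prod>i\<in>A. \<psi> i j)"
  using assms
proof (induction A)
  case empty
  then show ?case by (simp add: multiplier_def)
next
  case (insert i A)
  then have m: "multiplier (\<psi> i)" "multiplier (\<lambda>j. \<Prod>i\<in>A. \<psi> i j)" by auto
  show ?case
    unfolding multiplier_def
  proof (intro conjI ballI allI impI)
    show "(\<Prod>i\<in>insert i A. \<psi> i (rep j)) = (\<Prod>i\<in>insert i A. \<psi> i j)" if "j \<in> PJ" for j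
      using m that insert.hyps by (simp add: multiplier_def)
    fix \<omega> assume "stress \<omega>"
    then have "stress (\<lambda>j k. (\<Prod>i\<in>A. \<psi> i j) * \<omega> j k)" using m(2) by (simp add: multiplier_def)
    then have "stress (\<lambda>j k. \<psi> i j * ((\<Prod>i\<in>A. \<psi> i j) * \<omega> j k))"
      using m(1) unfolding multiplier_def by blast
    then show "stress (\<lambda>j k. (\<Prod>i\<in>insert i A. \<psi> i j) * \<omega> j k)"
      using insert.hyps by (simp add: mult.assoc)
  qed
qed

lemma multiplier_separating:
  assumes q: "q \<in> rep ` PJ" "q' \<in> rep ` PJ" "q \<noteq> q'"
  shows "\<exists>\<psi>. multiplier \<psi> \<and> \<psi> q = 1 \<and> \<psi> q' = 0"
proof -
  have "\<not> coincident q q'" using q rep_eq_if_coincident rep_of_rep(1) by metis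
  then obtain c where "unit_vec (q, c) - unit_vec (q', c) \<notin> W" by (auto simp: coincident_def)
  then obtain \<phi> :: "('a \<times> coord \<Rightarrow> real) \<Rightarrow> real" where \<phi>: "linear \<phi>"
    "\<forall>y\<in>edge_gen G a ` (J \<times> UNIV). \<phi> y = 0" "\<phi> (unit_vec (q, c) - unit_vec (q', c)) = 1"
    unfolding edge_span_def using linear_functional_separates by blast
  have "\<phi> x = 0" if "x \<in> W" for x
    using that unfolding edge_span_def
    by (rule linear_eq_0_on_span[OF \<phi>(1), rotated]) (use \<phi>(2) in blast)
  then have "multiplier (\<lambda>j. \<phi> (unit_vec (j, c)))" by (rule multiplier_motion[OF \<phi>(1)])
  then have "multiplier (\<lambda>j. (\<phi> (unit_vec (j, c)) - \<phi> (unit_vec (q', c))) / 1)"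
    by (rule multiplier_affine)
  moreover have "\<phi> (unit_vec (q, c)) - \<phi> (unit_vec (q', c)) = 1"
    using \<phi>(3) by (simp add: linear_diff[OF \<phi>(1)])
  ultimately show ?thesis
    by (intro exI[of _ "\<lambda>j. (\<phi> (unit_vec (j, c)) - \<phi> (unit_vec (q', c))) / 1"]) simp
qed

text \<open>
  The product of the multipliers that separate \<open>q\<close> from the other representatives
  is the indicator function of the class of \<open>q\<close>, as in Lagrange interpolation.
  Multiplying the stress by it leaves the balance of the class alone.
\<close>

lemma stress_balanced_in_classes:
  assumes st: "stress \<omega>" and q: "q \<in> rep ` PJ" and k: "k \<in> L"
  shows "(\<Sum>j\<in>{j \<in> PJ. rep j = q}. \<omega> j k) = 0"
proof -
  let ?A = "rep ` PJ - {q}"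
  have "\<forall>q'\<in>?A. \<exists>\<psi>. multiplier \<psi> \<and> \<psi> q = 1 \<and> \<psi> q' = 0"
    using multiplier_separating[OF q] by blast
  then obtain \<psi> where \<psi>: "\<And>q'. q' \<in> ?A \<Longrightarrow> multiplier (\<psi> q')"
    "\<And>q'. q' \<in> ?A \<Longrightarrow> \<psi> q' q = 1" "\<And>q'. q' \<in> ?A \<Longrightarrow> \<psi> q' q' = 0"
    by (auto dest!: bchoice)
  define \<Psi> where "\<Psi> j = (\<Prod>q'\<in>?A. \<psi> q' j)" for j
  have finA: "finite ?A" using finite_PJ by simp
  have mult: "multiplier \<Psi>"
    unfolding \<Psi>_def[abs_def] using finA \<psi>(1) by (rule multiplier_prod)
  have val: "\<Psi> j = (if rep j = q then 1 else 0)" if j: "j \<in> PJ" for j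
  proof -
    have "\<Psi> j = \<Psi> (rep j)" using mult j by (simp add: multiplier_def)
    also have "\<dots> = (if rep j = q then 1 else 0)"
    proof (cases "rep j = q")
      case True
      then show ?thesis using \<psi>(2) by (simp add: \<Psi>_def)
    next
      case False
      then have "rep j \<in> ?A" using j by auto
      then have "\<Psi> (rep j) = 0" unfolding \<Psi>_def using finA \<psi>(3) by (intro prod_zero) auto
      then show ?thesis using False by simp
    qed
    finally show ?thesis .
  qed
  have "stress (\<lambda>j k. \<Psi> j * \<omega> j k)" using mult st by (simp add: multiplier_def)
  then have "(\<Sum>j\<in>PJ. \<Psi> j * \<omega> j k) = 0" using k by (rule stressD(2))
  moreover have "(\<Sum>j\<in>PJ. \<Psi> j * \<omega> j k) = (\<Sum>j\<in>PJ. if rep j = q then \<omega> j k else 0)"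
    using val by (intro sum.cong) auto
  ultimately show ?thesis using finite_PJ by (simp add: sum.inter_filter)
qed

section \<open>The rank of a set of planes\<close>

definition LJ :: "'a set" where "LJ = {k \<in> L. \<exists>e\<in>J. k \<in> e}"

definition incidences :: "('a \<times> 'a) set" where
  "incidences = {(j, k). j \<in> PJ \<and> k \<in> L \<and> {j, k} \<in> J}"

definition class_incidences :: "('a \<times> 'a) set" where
  "class_incidences = (\<lambda>(j, k). (rep j, k)) ` incidences"

lemma finite_incidences: "finite incidences"
  by (rule finite_subset[of _ "PJ \<times> L"]) (auto simp: incidences_def finite_PJ finite_L)

lemma finite_LJ: "finite LJ"
  using finite_L by (simp add: LJ_def)

lemma not_point_line: "j \<in> PJ \<Longrightarrow> k \<in> L \<Longrightarrow> j \<noteq> k" "j \<in> PJ \<Longrightarrow> k \<in> L \<Longrightarrow> k \<noteq> j"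
  using PJ_subset PL_disjoint by auto

text \<open>
  The vectors used are the first coordinates of the lines, the differences of the points to
  their representatives, and one incidence vector for each class and each line meeting it. A
  dependency between them has a stress as its coefficients on the incidence vectors. By the
  balance within classes, this stress vanishes, because it uses only one point of each class
  for each line.
\<close>

lemma edge_rank_ge_classes:
  "card LJ + (2 * card {j \<in> PJ. rep j \<noteq> j} + card class_incidences) \<le> edge_rank G a J"
proof -
  \<comment> \<open>One point for each pair of a class and a line meeting it.\<close>
  obtain Q where Q: "Q \<subseteq> incidences" "inj_on (\<lambda>(j, k). (rep j, k)) Q"
    "class_incidences = (\<lambda>(j, k). (rep j, k)) ` Q"
  proof -
    have "class_incidences \<subseteq> (\<lambda>(j, k). (rep j, k)) ` incidences" by (simp add: class_incidences_def)
    from this[unfolded subset_image_inj] show ?thesis using that by (elim exE conjE)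
  qed
  define N where "N = {j \<in> PJ. rep j \<noteq> j} \<times> (UNIV :: coord set)"
  define f where "f = case_sum (\<lambda>k. unit_vec (k, First))
    (case_sum (\<lambda>(j, c). unit_vec (j, c) - unit_vec (rep j, c)) (\<lambda>(j, k). incidence_vec a j k))"
  let ?T = "LJ <+> (N <+> Q)"
  have finQ: "finite Q" using Q(1) finite_incidences finite_subset by blast
  have finN: "finite N" using finite_PJ by (simp add: N_def)
  have Qin: "j \<in> PJ" "k \<in> L" "{j, k} \<in> J" if "(j, k) \<in> Q" for j k
    using that Q(1) by (auto simp: incidences_def)
  have Nin: "j \<in> PJ" "rep j \<noteq> j" "rep j \<in> PJ" if "(j, c) \<in> N" for j c
    using that rep_props(1) by (auto simp: N_def)
  have ind: "family_independent f ?T"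
  proof (rule family_independentI)
    fix l i assume rel0: "(\<Sum>i\<in>?T. l i *\<^sub>R f i) = 0" and i: "i \<in> ?T"
    define \<alpha> where "\<alpha> k = l (Inl k)" for k
    define \<beta> where "\<beta> p = l (Inr (Inl p))" for p
    define \<gamma> where "\<gamma> p = l (Inr (Inr p))" for p
    have rel: "(\<Sum>k\<in>LJ. \<alpha> k * unit_vec (k, First) x) +
        ((\<Sum>(j, c)\<in>N. \<beta> (j, c) * (unit_vec (j, c) x - unit_vec (rep j, c) x)) +
         (\<Sum>(j, k)\<in>Q. \<gamma> (j, k) * incidence_vec a j k x)) = 0" for x
    proof -
      have "(\<Sum>i\<in>?T. l i * f i x) = 0"
        using fun_cong[OF rel0, of x] by simp
      then show ?thesis
        using finite_LJ finN finQ
        by (simp add: sum.Plus finite_Plus f_def \<alpha>_def \<beta>_def \<gamma>_def case_prod_unfold)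
    qed
    have \<alpha>0: "\<alpha> k0 = 0" if k0: "k0 \<in> LJ" for k0
    proof -
      have k0L: "k0 \<in> L" using k0 by (simp add: LJ_def)
      have "(\<Sum>k\<in>LJ. \<alpha> k * unit_vec (k, First) (k0, First)) = (\<Sum>k\<in>LJ. if k = k0 then \<alpha> k else 0)"
        by (intro sum.cong refl) (auto simp: unit_vec_apply)
      also have "\<dots> = \<alpha> k0" using k0 finite_LJ by simp
      finally have 1: "(\<Sum>k\<in>LJ. \<alpha> k * unit_vec (k, First) (k0, First)) = \<alpha> k0" .
      have 2: "(\<Sum>(j, c)\<in>N. \<beta> (j, c) * (unit_vec (j, c) (k0, First) - unit_vec (rep j, c) (k0, First))) = 0"
        using Nin not_point_line k0L by (intro sum.neutral) (auto simp: unit_vec_apply)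
      have 3: "(\<Sum>(j, k)\<in>Q. \<gamma> (j, k) * incidence_vec a j k (k0, First)) = 0"
        using Qin not_point_line k0L
        by (intro sum.neutral) (auto simp: unit_vec_apply incidence_vec_def)
      show ?thesis using rel[of "(k0, First)"] unfolding 1 2 3 by simp
    qed
    define \<omega> where "\<omega> j k = (if (j, k) \<in> Q then \<gamma> (j, k) else 0)" for j k
    have transfer: "(\<Sum>j\<in>PJ. \<Sum>k\<in>L. \<omega> j k * g j k) = (\<Sum>(j, k)\<in>Q. \<gamma> (j, k) * g j k)" for g
    proof -
      have "(\<Sum>j\<in>PJ. \<Sum>k\<in>L. \<omega> j k * g j k) = (\<Sum>(j, k)\<in>PJ \<times> L. \<omega> j k * g j k)"
        by (rule sum.cartesian_product)
      also have "\<dots> = (\<Sum>(j, k)\<in>Q. \<omega> j k * g j k)"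
        using Qin finite_PJ finite_L by (intro sum.mono_neutral_right) (auto simp: \<omega>_def)
      also have "\<dots> = (\<Sum>(j, k)\<in>Q. \<gamma> (j, k) * g j k)"
        by (intro sum.cong) (auto simp: \<omega>_def)
      finally show ?thesis .
    qed
    have line: "(\<Sum>j\<in>PJ. \<omega> j k0) = 0" if k0: "k0 \<in> L" for k0
    proof -
      have 1: "(\<Sum>k\<in>LJ. \<alpha> k * unit_vec (k, First) (k0, Second)) = 0"
        by (intro sum.neutral) (auto simp: unit_vec_apply)
      have 2: "(\<Sum>(j, c)\<in>N. \<beta> (j, c) * (unit_vec (j, c) (k0, Second) - unit_vec (rep j, c) (k0, Second))) = 0"
        using Nin not_point_line k0 by (intro sum.neutral) (auto simp: unit_vec_apply)
      have 3: "(\<Sum>(j, k)\<in>Q. \<gamma> (j, k) * incidence_vec a j k (k0, Second)) =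
          (\<Sum>(j, k)\<in>Q. \<gamma> (j, k) * (if k = k0 then - 1 else 0))"
        using Qin not_point_line k0
        by (intro sum.cong refl) (auto simp: unit_vec_apply incidence_vec_def)
      have "(\<Sum>j\<in>PJ. \<Sum>k\<in>L. \<omega> j k * (if k = k0 then - 1 else 0)) = 0"
        using rel[of "(k0, Second)"] unfolding 1 2 3 transfer by simp
      also have "(\<Sum>j\<in>PJ. \<Sum>k\<in>L. \<omega> j k * (if k = k0 then - 1 else 0)) =
          (\<Sum>j\<in>PJ. \<Sum>k\<in>L. if k = k0 then - \<omega> j k else 0)"
        by (intro sum.cong refl) auto
      also have "\<dots> = - (\<Sum>j\<in>PJ. \<omega> j k0)" using k0 finite_L by (simp add: sum_negf)
      finally show ?thesis by simp
    qed
    \<comment> \<open>Summed over a class, the columns of a difference vector within a class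
        cancel.\<close>
    have class_sum: "(\<Sum>j\<in>{j \<in> PJ. rep j = q}. \<Sum>k\<in>L. \<omega> j k * (if c = First then 1 else - a k)) = 0"
      if q: "q \<in> rep ` PJ" for q c
    proof -
      let ?C = "{j \<in> PJ. rep j = q}"
      have finC: "finite ?C" using finite_PJ by simp
      have unit: "(\<Sum>j0\<in>?C. unit_vec (j, c') (j0, c)) = (if c' = c \<and> j \<in> ?C then 1 else 0)" for j c'
      proof -
        have "(\<Sum>j0\<in>?C. unit_vec (j, c') (j0, c)) = (\<Sum>j0\<in>?C. if j0 = j then (if c' = c then 1 else 0) else 0)"
          by (intro sum.cong refl) (auto simp: unit_vec_apply)
        then show ?thesis using finC by simp
      qed
      have "0 = (\<Sum>j0\<in>?C. (\<Sum>k\<in>LJ. \<alpha> k * unit_vec (k, First) (j0, c)) +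
        ((\<Sum>(j, c')\<in>N. \<beta> (j, c') * (unit_vec (j, c') (j0, c) - unit_vec (rep j, c') (j0, c))) +
         (\<Sum>(j, k)\<in>Q. \<gamma> (j, k) * incidence_vec a j k (j0, c))))"
        by (simp only: rel sum.neutral_const)
      also have "\<dots> = (\<Sum>j0\<in>?C. \<Sum>k\<in>LJ. \<alpha> k * unit_vec (k, First) (j0, c)) +
        ((\<Sum>j0\<in>?C. \<Sum>(j, c')\<in>N. \<beta> (j, c') * (unit_vec (j, c') (j0, c) - unit_vec (rep j, c') (j0, c))) +
         (\<Sum>j0\<in>?C. \<Sum>(j, k)\<in>Q. \<gamma> (j, k) * incidence_vec a j k (j0, c)))"
        by (simp only: sum.distrib)
      also have "(\<Sum>j0\<in>?C. \<Sum>k\<in>LJ. \<alpha> k * unit_vec (k, First) (j0, c)) = 0"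
        using \<alpha>0 by (intro sum.neutral ballI) auto
      also have "(\<Sum>j0\<in>?C. \<Sum>(j, c')\<in>N. \<beta> (j, c') * (unit_vec (j, c') (j0, c) - unit_vec (rep j, c') (j0, c))) =
          (\<Sum>(j, c')\<in>N. \<beta> (j, c') * ((\<Sum>j0\<in>?C. unit_vec (j, c') (j0, c)) - (\<Sum>j0\<in>?C. unit_vec (rep j, c') (j0, c))))"
        by (subst sum.swap)
            (simp add: case_prod_unfold sum_distrib_left sum_subtractf right_diff_distrib)
      also have "\<dots> = 0"
        unfolding unit using Nin rep_rep by (intro sum.neutral) auto
      also have "(\<Sum>j0\<in>?C. \<Sum>(j, k)\<in>Q. \<gamma> (j, k) * incidence_vec a j k (j0, c)) =
          (\<Sum>(j, k)\<in>Q. \<gamma> (j, k) * (\<Sum>j0\<in>?C. incidence_vec a j k (j0, c)))"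
        by (subst sum.swap) (simp add: case_prod_unfold sum_distrib_left)
      also have "\<dots> = (\<Sum>(j, k)\<in>Q. \<gamma> (j, k) * (if rep j = q then if c = First then 1 else - a k else 0))"
      proof (intro sum.cong refl, clarify)
        fix j k assume jk: "(j, k) \<in> Q"
        have "(\<Sum>j0\<in>?C. incidence_vec a j k (j0, c)) =
            (\<Sum>j0\<in>?C. unit_vec (j, First) (j0, c)) - a k * (\<Sum>j0\<in>?C. unit_vec (j, Second) (j0, c)) -
            (\<Sum>j0\<in>?C. unit_vec (k, Second) (j0, c))"
          by (simp add: incidence_vec_def sum_subtractf sum_distrib_left)
        also have "\<dots> = (if rep j = q then if c = First then 1 else - a k else 0)"
          unfolding unit using Qin[OF jk] not_point_line by (cases c) auto
        finally show "\<gamma> (j, k) * (\<Sum>j0\<in>?C. incidence_vec a j k (j0, c)) =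
            \<gamma> (j, k) * (if rep j = q then if c = First then 1 else - a k else 0)" by simp
      qed
      also have "\<dots> = (\<Sum>j\<in>PJ. \<Sum>k\<in>L. \<omega> j k * (if rep j = q then if c = First then 1 else - a k else 0))"
        by (rule transfer[symmetric])
      also have "\<dots> = (\<Sum>j\<in>PJ. if rep j = q then \<Sum>k\<in>L. \<omega> j k * (if c = First then 1 else - a k) else 0)"
        by (intro sum.cong refl) auto
      also have "\<dots> = (\<Sum>j\<in>?C. \<Sum>k\<in>L. \<omega> j k * (if c = First then 1 else - a k))"
        using finite_PJ by (simp add: sum.inter_filter)
      finally show ?thesis by simp
    qed
    have "stress \<omega>"
      unfolding stress_def
    proof (intro conjI allI impI ballI)
      fix j k assume "\<omega> j k \<noteq> 0"
      then show "j \<in> PJ" "k \<in> L" "{j, k} \<in> J" using Qin by (auto simp: \<omega>_def split: if_splits)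
    next
      fix q assume q: "q \<in> rep ` PJ"
      show "(\<Sum>j\<in>{j \<in> PJ. rep j = q}. \<Sum>k\<in>L. \<omega> j k) = 0"
        using class_sum[OF q, of First] by simp
      show "(\<Sum>j\<in>{j \<in> PJ. rep j = q}. \<Sum>k\<in>L. \<omega> j k * a k) = 0"
        using class_sum[OF q, of Second] by (simp add: sum_negf)
    qed (rule line)
    have \<gamma>0: "\<gamma> (j0, k0) = 0" if jk: "(j0, k0) \<in> Q" for j0 k0
    proof -
      have "(\<Sum>j\<in>{j \<in> PJ. rep j = rep j0}. \<omega> j k0) = 0"
        using \<open>stress \<omega>\<close> Qin[OF jk] by (intro stress_balanced_in_classes) auto
      moreover have "\<omega> j k0 = 0" if "rep j = rep j0" "j \<noteq> j0" for j
        using inj_onD[OF Q(2), of "(j, k0)" "(j0, k0)"] that jk by (auto simp: \<omega>_def)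
      then have "(\<Sum>j\<in>{j \<in> PJ. rep j = rep j0}. \<omega> j k0) = (\<Sum>j\<in>{j0}. \<omega> j k0)"
        using finite_PJ Qin[OF jk] by (intro sum.mono_neutral_right) auto
      ultimately show ?thesis using jk by (simp add: \<omega>_def)
    qed
    have \<beta>0: "\<beta> (j0, c0) = 0" if jc: "(j0, c0) \<in> N" for j0 c0
    proof -
      have 1: "(\<Sum>k\<in>LJ. \<alpha> k * unit_vec (k, First) (j0, c0)) = 0"
        using \<alpha>0 by (intro sum.neutral) simp
      have 3: "(\<Sum>(j, k)\<in>Q. \<gamma> (j, k) * incidence_vec a j k (j0, c0)) = 0"
        using \<gamma>0 by (intro sum.neutral) auto
      have nr: "rep j \<noteq> j0" if "(j, c) \<in> N" for j c
        using Nin[OF that] Nin[OF jc] rep_rep by metis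
      have "(\<Sum>(j, c)\<in>N. \<beta> (j, c) * (unit_vec (j, c) (j0, c0) - unit_vec (rep j, c) (j0, c0))) =
          (\<Sum>p\<in>N. if p = (j0, c0) then \<beta> p else 0)"
      proof (intro sum.cong refl, clarify)
        fix j c assume "(j, c) \<in> N"
        then show "\<beta> (j, c) * (unit_vec (j, c) (j0, c0) - unit_vec (rep j, c) (j0, c0)) =
            (if (j, c) = (j0, c0) then \<beta> (j, c) else 0)"
          using nr[of j c] by (cases "j = j0"; cases "c = c0") (simp_all add: unit_vec_apply)
      qed
      also have "\<dots> = \<beta> (j0, c0)" using finN jc by simp
      finally show ?thesis using rel[of "(j0, c0)"] unfolding 1 3 by simp
    qed
    show "l i = 0" using i \<alpha>0 \<beta>0 \<gamma>0 by (auto simp: \<alpha>_def \<beta>_def \<gamma>_def)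
  qed
  have "f ` ?T \<subseteq> W"
  proof -
    have "unit_vec (k, First) \<in> W" if "k \<in> LJ" for k
      using that unit_vec_line_in_edge_span[OF J] by (auto simp: LJ_def)
    moreover have "unit_vec (j, c) - unit_vec (rep j, c) \<in> W" if "(j, c) \<in> N" for j c
      using Nin[OF that] rep_props(2) by (auto simp: coincident_def)
    moreover have "incidence_vec a j k \<in> W" if "(j, k) \<in> Q" for j k
      using edge_gen_in_span[OF Qin(3)[OF that], of G a First] edge_gen_PL(1)[of j k a]
        Qin[OF that] PJ_subset by auto
    ultimately show ?thesis by (auto simp: f_def)
  qed
  then have "card ?T \<le> edge_rank G a J"
    using card_family_le_dim[OF ind] finite_LJ finN finQ finite_J
    by (simp add: edge_rank_def edge_span_def)
  moreover have "card ?T = card LJ + (card N + card Q)"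
    using finite_LJ finN finQ by (simp add: card_Plus)
  moreover have "card N = 2 * card {j \<in> PJ. rep j \<noteq> j}"
    by (simp add: N_def card_cartesian_product UNIV_coord)
  moreover have "card Q = card class_incidences"
    using Q by (simp add: card_image)
  ultimately show ?thesis by simp
qed

lemma rep_eq_on_edge:
  assumes "e \<in> J" "j \<in> e" "j \<in> P" "j' \<in> e" "j' \<in> P"
  shows "rep j = rep j'"
proof (cases "j = j'")
  case False
  have "card e = 2" using assms(1) J by (auto simp: pairs_def)
  then have e: "e = {j, j'}" using assms False by (auto simp: card_2_iff)
  have "unit_vec (j, c) - unit_vec (j', c) \<in> W" for c
  proof -
    have "edge_gen G a (e, c) \<in> W" using assms(1) by (rule edge_gen_in_span)
    then have "unit_vec (j, c) - unit_vec (j', c) \<in> W \<or> unit_vec (j', c) - unit_vec (j, c) \<in> W"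
      using edge_gen_PP[OF assms(3,5) False, of a c] e by auto
    then show ?thesis using real_vector.subspace_neg[OF subspace_W] by (metis minus_diff_eq)
  qed
  then show ?thesis by (intro rep_eq_if_coincident) (simp add: coincident_def)
qed simp

definition class_edges :: "'a \<Rightarrow> 'a set set" where
  "class_edges q = {e \<in> J. \<exists>j\<in>e \<inter> PJ. rep j = q}"

definition line_edges :: "'a set set" where
  "line_edges = {e \<in> J. e \<inter> P = {}}"

lemma point_in_PJ: "e \<in> J \<Longrightarrow> j \<in> e \<Longrightarrow> j \<in> P \<Longrightarrow> j \<in> PJ"
  by (auto simp: PJ_def)

text \<open>
  An edge between two points joins coincident points, because the differences spanning its
  plane lie in the span. So every edge with a point belongs to exactly one class.
\<close>

lemma partition_on_classes:
  "partition_on J (class_edges ` rep ` PJ \<union> (\<lambda>e. {e}) ` line_edges)"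
proof (rule partition_onI)
  show "\<Union>(class_edges ` rep ` PJ \<union> (\<lambda>e. {e}) ` line_edges) = J"
  proof
    show "J \<subseteq> \<Union>(class_edges ` rep ` PJ \<union> (\<lambda>e. {e}) ` line_edges)"
    proof
      fix e assume e: "e \<in> J"
      show "e \<in> \<Union>(class_edges ` rep ` PJ \<union> (\<lambda>e. {e}) ` line_edges)"
      proof (cases "e \<inter> P = {}")
        case False
        then obtain j where "j \<in> e" "j \<in> PJ" using point_in_PJ[OF e] by auto
        then show ?thesis using e by (auto simp: class_edges_def)
      qed (use e in \<open>auto simp: line_edges_def\<close>)
    qed
  qed (auto simp: class_edges_def line_edges_def)
  have cl: "class_edges q \<inter> class_edges q' = {}" if "q \<noteq> q'" for q q'
    using that rep_eq_on_edge PJ_subset by (auto simp: class_edges_def)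
  have ln: "class_edges q \<inter> {e} = {}" if "e \<in> line_edges" for q e
    using that PJ_subset by (auto simp: class_edges_def line_edges_def)
  show "disjnt p p'"
    if "p \<in> class_edges ` rep ` PJ \<union> (\<lambda>e. {e}) ` line_edges"
      "p' \<in> class_edges ` rep ` PJ \<union> (\<lambda>e. {e}) ` line_edges" "p \<noteq> p'" for p p'
    using that cl ln unfolding disjnt_def by (elim UnE imageE) (simp_all add: Int_commute, metis)
  show "{} \<notin> class_edges ` rep ` PJ \<union> (\<lambda>e. {e}) ` line_edges"
  proof -
    have "class_edges (rep j) \<noteq> {}" if "j \<in> PJ" for j
    proof -
      obtain e where "e \<in> J" "j \<in> e" using \<open>j \<in> PJ\<close> unfolding PJ_def by blast
      then show ?thesis using \<open>j \<in> PJ\<close> by (auto simp: class_edges_def)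
    qed
    then show ?thesis by force
  qed
qed

lemma class_edges_points:
  assumes "q \<in> rep ` PJ"
  shows "{u \<in> P. \<exists>e\<in>class_edges q. u \<in> e} = {j \<in> PJ. rep j = q}"
proof (intro set_eqI iffI)
  fix u assume "u \<in> {u \<in> P. \<exists>e\<in>class_edges q. u \<in> e}"
  then obtain e j where e: "u \<in> P" "u \<in> e" "e \<in> J" "j \<in> e" "j \<in> PJ" "rep j = q"
    by (auto simp: class_edges_def)
  then show "u \<in> {j \<in> PJ. rep j = q}"
    using rep_eq_on_edge[of e u j] point_in_PJ PJ_subset by auto
next
  fix u assume u: "u \<in> {j \<in> PJ. rep j = q}"
  then obtain e where "e \<in> J" "u \<in> e" "u \<in> P" unfolding PJ_def by blast
  then show "u \<in> {u \<in> P. \<exists>e\<in>class_edges q. u \<in> e}" using u by (auto simp: class_edges_def)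
qed

lemma class_incidences_Sigma:
  "class_incidences = Sigma (rep ` PJ) (\<lambda>q. {k \<in> L. \<exists>e\<in>class_edges q. k \<in> e})"
proof (intro set_eqI iffI)
  fix x assume "x \<in> class_incidences"
  then obtain j k where "x = (rep j, k)" "j \<in> PJ" "k \<in> L" "{j, k} \<in> J"
    by (auto simp: class_incidences_def incidences_def)
  then show "x \<in> Sigma (rep ` PJ) (\<lambda>q. {k \<in> L. \<exists>e\<in>class_edges q. k \<in> e})"
    by (auto simp: class_edges_def)
next
  fix x assume "x \<in> Sigma (rep ` PJ) (\<lambda>q. {k \<in> L. \<exists>e\<in>class_edges q. k \<in> e})"
  then obtain q k e where x: "x = (q, k)" "k \<in> L" "e \<in> class_edges q" "k \<in> e" by auto
  then obtain j where "e \<in> J" "j \<in> e" "j \<in> PJ" "rep j = q" unfolding class_edges_def by blast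
  then have x: "x = (rep j, k)" "k \<in> L" "e \<in> J" "k \<in> e" "j \<in> e" "j \<in> PJ" using x by auto
  have "card e = 2" using x(3) J by (auto simp: pairs_def)
  then have "e = {j, k}" using x not_point_line by (auto simp: card_2_iff)
  then show "x \<in> class_incidences" using x by (force simp: class_incidences_def incidences_def)
qed

text \<open>
  The part of a class contributes twice its number of points plus its number of lines minus 2;
  an edge between two lines contributes nothing.
\<close>

lemma rho_le_classes:
  "rho G J \<le> 2 * int (card {j \<in> PJ. rep j \<noteq> j}) + int (card class_incidences)"
proof -
  let ?w = "\<lambda>B. 2 * nu_P G B + nu_L G B - 2"
  let ?R = "rep ` PJ"
  let ?N = "\<lambda>q. {k \<in> L. \<exists>e\<in>class_edges q. k \<in> e}"
  have finR: "finite ?R" using finite_PJ by simp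
  have finLE: "finite line_edges" using finite_J by (simp add: line_edges_def)
  have inj: "inj_on class_edges ?R"
  proof (rule inj_onI)
    fix q q' assume q: "q \<in> ?R" "q' \<in> ?R" "class_edges q = class_edges q'"
    have "{j \<in> PJ. rep j = q} = {j \<in> PJ. rep j = q'}"
      using class_edges_points[OF q(1)] class_edges_points[OF q(2)] q(3) by simp
    moreover have "q \<in> {j \<in> PJ. rep j = q}" using rep_of_rep[OF q(1)] by simp
    ultimately have "q \<in> {j \<in> PJ. rep j = q'}" by simp
    then show "q = q'" using rep_of_rep(1)[OF q(1)] by simp
  qed
  have "rho G J \<le> (\<Sum>B\<in>class_edges ` ?R \<union> (\<lambda>e. {e}) ` line_edges. ?w B)"
    by (rule rho_le_partition[OF finite_J partition_on_classes])
  also have "\<dots> = (\<Sum>B\<in>class_edges ` ?R. ?w B) + (\<Sum>B\<in>(\<lambda>e. {e}) ` line_edges. ?w B)"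
  proof (rule sum.union_disjoint)
    have "class_edges q \<noteq> {e}" if "e \<in> line_edges" for q e
    proof
      assume "class_edges q = {e}"
      then have "e \<in> class_edges q" by simp
      then show False using that PJ_subset by (auto simp: class_edges_def line_edges_def)
    qed
    then show "class_edges ` ?R \<inter> (\<lambda>e. {e}) ` line_edges = {}" by blast
  qed (use finR finLE in auto)
  also have "(\<Sum>B\<in>(\<lambda>e. {e}) ` line_edges. ?w B) = 0"
  proof (intro sum.neutral ballI)
    fix B assume "B \<in> (\<lambda>e. {e}) ` line_edges"
    then obtain e where B: "B = {e}" and e: "e \<in> line_edges" by blast
    have e2: "card e = 2" "e \<subseteq> P \<union> L" "e \<inter> P = {}"
      using e J by (auto simp: line_edges_def pairs_def)
    have lines: "{v \<in> L. \<exists>e'\<in>B. v \<in> e'} = e" using e2 B by auto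
    have points: "{u \<in> P. \<exists>e'\<in>B. u \<in> e'} = {}" using e2 B by auto
    show "?w B = 0" unfolding nu_P_def nu_L_def lines points using e2(1) by simp
  qed
  also have "(\<Sum>B\<in>class_edges ` ?R. ?w B) = (\<Sum>q\<in>?R. ?w (class_edges q))"
    using inj by (simp add: sum.reindex)
  also have "\<dots> = (\<Sum>q\<in>?R. 2 * int (card {j \<in> PJ. rep j = q}) + int (card (?N q)) - 2)"
    using class_edges_points by (intro sum.cong refl) (simp add: nu_P_def nu_L_def)
  also have "\<dots> = 2 * int (\<Sum>q\<in>?R. card {j \<in> PJ. rep j = q}) + int (\<Sum>q\<in>?R. card (?N q)) - 2 * int (card ?R)"
    by (simp add: sum.distrib sum_subtractf sum_distrib_left)
  also have "(\<Sum>q\<in>?R. card {j \<in> PJ. rep j = q}) = card PJ"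
    using sum.image_gen[OF finite_PJ, of "\<lambda>_. 1::nat" rep] by simp
  also have "(\<Sum>q\<in>?R. card (?N q)) = card class_incidences"
    unfolding class_incidences_Sigma using finR finite_L by (simp add: card_SigmaI)
  finally have 1: "rho G J \<le> 2 * int (card PJ) + int (card class_incidences) - 2 * int (card ?R)"
    by simp
  have "?R \<subseteq> {j \<in> PJ. rep j = j}" using rep_of_rep by blast
  moreover have "{j \<in> PJ. rep j = j} \<subseteq> ?R" by (metis (mono_tags, lifting) image_eqI mem_Collect_eq subsetI)
  ultimately have "PJ = {j \<in> PJ. rep j \<noteq> j} \<union> ?R" "{j \<in> PJ. rep j \<noteq> j} \<inter> ?R = {}"
    by blast+
  then have "card PJ = card {j \<in> PJ. rep j \<noteq> j} + card ?R"
    using card_Un_disjoint[of "{j \<in> PJ. rep j \<noteq> j}" ?R] finite_PJ finR by simp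
  then show ?thesis using 1 by simp
qed

lemma rho_plus_nu_L_le_edge_rank: "rho G J + nu_L G J \<le> int (edge_rank G a J)"
proof -
  have "nu_L G J = int (card LJ)" by (simp add: nu_L_def LJ_def)
  then show ?thesis using rho_le_classes edge_rank_ge_classes by linarith
qed

end

section \<open>Independent rows satisfy the count\<close>

text \<open>
  The two constraints can be solved for the entries at \<open>c\<^sub>1\<close> and
  \<open>c\<^sub>2\<close>, so the solutions are parametrised by the other entries.
\<close>

lemma span_of_two_constraints:
  fixes \<tau>\<^sub>1 \<tau>\<^sub>2 :: "'c \<Rightarrow> real"
  assumes fin: "finite C" and c: "c\<^sub>1 \<in> C" "c\<^sub>2 \<in> C" "c\<^sub>1 \<noteq> c\<^sub>2"
    and det: "\<tau>\<^sub>1 c\<^sub>1 * \<tau>\<^sub>2 c\<^sub>2 - \<tau>\<^sub>1 c\<^sub>2 * \<tau>\<^sub>2 c\<^sub>1 \<noteq> 0"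
  shows "\<exists>E. finite E \<and> card E + 2 \<le> card C \<and>
    (\<forall>v. (\<forall>c. c \<notin> C \<longrightarrow> v c = 0) \<longrightarrow> (\<Sum>c\<in>C. \<tau>\<^sub>1 c * v c) = 0 \<longrightarrow>
         (\<Sum>c\<in>C. \<tau>\<^sub>2 c * v c) = 0 \<longrightarrow> v \<in> span E)"
proof -
  define d where "d = \<tau>\<^sub>1 c\<^sub>1 * \<tau>\<^sub>2 c\<^sub>2 - \<tau>\<^sub>1 c\<^sub>2 * \<tau>\<^sub>2 c\<^sub>1"
  define \<kappa> where "\<kappa> c = (\<tau>\<^sub>1 c * \<tau>\<^sub>2 c\<^sub>2 - \<tau>\<^sub>1 c\<^sub>2 * \<tau>\<^sub>2 c) / d" for c
  define \<mu> where "\<mu> c = (\<tau>\<^sub>1 c\<^sub>1 * \<tau>\<^sub>2 c - \<tau>\<^sub>1 c * \<tau>\<^sub>2 c\<^sub>1) / d" for c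
  define \<epsilon> where "\<epsilon> c = unit_vec c - \<kappa> c *\<^sub>R unit_vec c\<^sub>1 - \<mu> c *\<^sub>R unit_vec c\<^sub>2" for c
  define C' where "C' = C - {c\<^sub>1, c\<^sub>2}"
  have finC': "finite C'" using fin by (simp add: C'_def)
  have d0: "d \<noteq> 0" using det by (simp add: d_def)
  have C: "C = insert c\<^sub>1 (insert c\<^sub>2 C')" "c\<^sub>1 \<notin> insert c\<^sub>2 C'" "c\<^sub>2 \<notin> C'"
    using c by (auto simp: C'_def)
  have "card (\<epsilon> ` C') \<le> card C'" by (rule card_image_le[OF finC'])
  moreover have "card C = card C' + 2" using C finC' by simp
  ultimately have card: "card (\<epsilon> ` C') + 2 \<le> card C" by simp
  have "v \<in> span (\<epsilon> ` C')"
    if supp: "\<And>c. c \<notin> C \<Longrightarrow> v c = 0"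
      and \<tau>1: "(\<Sum>c\<in>C. \<tau>\<^sub>1 c * v c) = 0" and \<tau>2: "(\<Sum>c\<in>C. \<tau>\<^sub>2 c * v c) = 0" for v
  proof -
    have sum_split: "(\<Sum>c\<in>C. \<tau> c * v c) = \<tau> c\<^sub>1 * v c\<^sub>1 + (\<tau> c\<^sub>2 * v c\<^sub>2 + (\<Sum>c\<in>C'. \<tau> c * v c))"
      for \<tau> :: "'c \<Rightarrow> real"
      using C finC' by simp
    have "d * (v c * \<kappa> c) = \<tau>\<^sub>2 c\<^sub>2 * (\<tau>\<^sub>1 c * v c) - \<tau>\<^sub>1 c\<^sub>2 * (\<tau>\<^sub>2 c * v c)" for c
    proof -
      have "d * (v c * \<kappa> c) = v c * (d * \<kappa> c)" by simp
      also have "\<dots> = v c * (\<tau>\<^sub>1 c * \<tau>\<^sub>2 c\<^sub>2 - \<tau>\<^sub>1 c\<^sub>2 * \<tau>\<^sub>2 c)" using d0 by (simp add: \<kappa>_def)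
      finally show ?thesis by (simp add: algebra_simps)
    qed
    then have "d * (\<Sum>c\<in>C'. v c * \<kappa> c) = \<tau>\<^sub>2 c\<^sub>2 * (\<Sum>c\<in>C'. \<tau>\<^sub>1 c * v c) - \<tau>\<^sub>1 c\<^sub>2 * (\<Sum>c\<in>C'. \<tau>\<^sub>2 c * v c)"
      by (simp only: sum_distrib_left sum_subtractf)
    moreover have s1: "(\<Sum>c\<in>C'. \<tau>\<^sub>1 c * v c) = - \<tau>\<^sub>1 c\<^sub>1 * v c\<^sub>1 - \<tau>\<^sub>1 c\<^sub>2 * v c\<^sub>2"
      using \<tau>1 sum_split[of \<tau>\<^sub>1] by simp
    moreover have s2: "(\<Sum>c\<in>C'. \<tau>\<^sub>2 c * v c) = - \<tau>\<^sub>2 c\<^sub>1 * v c\<^sub>1 - \<tau>\<^sub>2 c\<^sub>2 * v c\<^sub>2"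
      using \<tau>2 sum_split[of \<tau>\<^sub>2] by simp
    ultimately have "d * (\<Sum>c\<in>C'. v c * \<kappa> c) = d * (- v c\<^sub>1)"
      by (simp add: d_def algebra_simps)
    then have v1: "v c\<^sub>1 = - (\<Sum>c\<in>C'. v c * \<kappa> c)"
      using d0 unfolding mult_cancel_left by simp
    have "d * (v c * \<mu> c) = \<tau>\<^sub>1 c\<^sub>1 * (\<tau>\<^sub>2 c * v c) - \<tau>\<^sub>2 c\<^sub>1 * (\<tau>\<^sub>1 c * v c)" for c
    proof -
      have "d * (v c * \<mu> c) = v c * (d * \<mu> c)" by simp
      also have "\<dots> = v c * (\<tau>\<^sub>1 c\<^sub>1 * \<tau>\<^sub>2 c - \<tau>\<^sub>1 c * \<tau>\<^sub>2 c\<^sub>1)" using d0 by (simp add: \<mu>_def)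
      finally show ?thesis by (simp add: algebra_simps)
    qed
    then have "d * (\<Sum>c\<in>C'. v c * \<mu> c) = \<tau>\<^sub>1 c\<^sub>1 * (\<Sum>c\<in>C'. \<tau>\<^sub>2 c * v c) - \<tau>\<^sub>2 c\<^sub>1 * (\<Sum>c\<in>C'. \<tau>\<^sub>1 c * v c)"
      by (simp only: sum_distrib_left sum_subtractf)
    then have "d * (\<Sum>c\<in>C'. v c * \<mu> c) = d * (- v c\<^sub>2)"
      unfolding s1 s2 by (simp add: d_def algebra_simps)
    then have v2: "v c\<^sub>2 = - (\<Sum>c\<in>C'. v c * \<mu> c)"
      using d0 unfolding mult_cancel_left by simp
    have "v = (\<Sum>c\<in>C'. v c *\<^sub>R \<epsilon> c)"
    proof
      fix x
      have "(\<Sum>c\<in>C'. v c *\<^sub>R \<epsilon> c) x = (\<Sum>c\<in>C'. v c * unit_vec c x) -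
          (\<Sum>c\<in>C'. v c * \<kappa> c) * unit_vec c\<^sub>1 x - (\<Sum>c\<in>C'. v c * \<mu> c) * unit_vec c\<^sub>2 x"
        by (simp add: \<epsilon>_def right_diff_distrib sum_subtractf sum_distrib_right mult.assoc)
      also have "(\<Sum>c\<in>C'. v c * unit_vec c x) = (\<Sum>c\<in>C'. if x = c then v c else 0)"
        by (intro sum.cong refl) (simp add: unit_vec_apply)
      also have "\<dots> = (if x \<in> C' then v x else 0)" using finC' by simp
      also have "(if x \<in> C' then v x else 0) - (\<Sum>c\<in>C'. v c * \<kappa> c) * unit_vec c\<^sub>1 x -
          (\<Sum>c\<in>C'. v c * \<mu> c) * unit_vec c\<^sub>2 x = v x"
      proof -
        consider "x = c\<^sub>1" | "x = c\<^sub>2" | "x \<in> C'" | "x \<notin> C" using C by blast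
        then show ?thesis
          using v1 v2 C supp c(3) by cases (auto simp: unit_vec_apply)
      qed
      finally show "v x = (\<Sum>c\<in>C'. v c *\<^sub>R \<epsilon> c) x" by simp
    qed
    moreover have "(\<Sum>c\<in>C'. v c *\<^sub>R \<epsilon> c) \<in> span (\<epsilon> ` C')"
      by (intro real_vector.span_sum real_vector.span_scale real_vector.span_base) auto
    ultimately show ?thesis by simp
  qed
  then show ?thesis using finC' card by (intro exI[of _ "\<epsilon> ` C'"]) blast
qed

context point_line
begin

abbreviation row :: "('v \<Rightarrow> nat) \<Rightarrow> ('v \<Rightarrow> real \<times> real) \<Rightarrow> 'v set \<Rightarrow> 'v \<times> coord \<Rightarrow> real" where
  "row \<equiv> rigidity_matrix G"

lemma row_support: "w \<notin> e \<Longrightarrow> row idx p e (w, c) = 0"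
  by simp

lemma row_PP:
  assumes "u \<in> P" "v \<in> P" "u \<noteq> v"
  shows "row idx p {u, v} =
    (fst (p u) - fst (p v)) *\<^sub>R (unit_vec (u, First) - unit_vec (v, First)) +
    (snd (p u) - snd (p v)) *\<^sub>R (unit_vec (u, Second) - unit_vec (v, Second))"
proof
  fix x :: "'v \<times> coord"
  obtain w c where x: "x = (w, c)" by (cases x)
  consider "w = u" | "w = v" | "w \<notin> {u, v}" by blast
  then show "row idx p {u, v} x =
    ((fst (p u) - fst (p v)) *\<^sub>R (unit_vec (u, First) - unit_vec (v, First)) +
    (snd (p u) - snd (p v)) *\<^sub>R (unit_vec (u, Second) - unit_vec (v, Second))) x"
  proof cases
    case 1
    then show ?thesis
      using rigidity_matrix_PP[OF assms, of idx p] assms(3) unfolding x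
      by (cases c) (simp_all add: unit_vec_apply del: rigidity_matrix.simps)
  next
    case 2
    then show ?thesis
      using rigidity_matrix_PP[OF assms, of idx p] assms(3) unfolding x
      by (cases c) (simp_all add: unit_vec_apply del: rigidity_matrix.simps)
  next
    case 3
    then show ?thesis unfolding x by (simp add: unit_vec_apply)
  qed
qed

lemma row_PL:
  assumes "u \<in> P" "v \<in> L"
  shows "row idx p {u, v} = incidence_vec (\<lambda>k. fst (p k)) u v +
    (- fst (p u) * fst (p v) - snd (p u)) *\<^sub>R unit_vec (v, First)"
proof
  fix x :: "'v \<times> coord"
  obtain w c where x: "x = (w, c)" by (cases x)
  have uv: "u \<noteq> v" "v \<notin> P" using assms PL_disjoint by auto
  consider "w = u" | "w = v" | "w \<notin> {u, v}" by blast
  then show "row idx p {u, v} x = (incidence_vec (\<lambda>k. fst (p k)) u v +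
    (- fst (p u) * fst (p v) - snd (p u)) *\<^sub>R unit_vec (v, First)) x"
  proof cases
    case 1
    then show ?thesis
      using rigidity_matrix_PL[OF assms(1) uv(2), of idx p] uv unfolding x incidence_vec_def
      by (cases c) (simp_all add: unit_vec_apply del: rigidity_matrix.simps)
  next
    case 2
    then show ?thesis
      using rigidity_matrix_PL[OF assms(1) uv(2), of idx p] uv unfolding x incidence_vec_def
      by (cases c) (simp_all add: unit_vec_apply del: rigidity_matrix.simps)
  next
    case 3
    then show ?thesis unfolding x incidence_vec_def by (simp add: unit_vec_apply)
  qed
qed

text \<open>
  The sign is fixed by the enumeration of the lines. Two lines with equal positions would both
  receive the entry \<open>- 1\<close>, hence the injectivity.
\<close>

lemma row_LL:
  assumes "u \<in> L" "v \<in> L" "u \<noteq> v" "inj_on idx L"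
  obtains s where "s = 1 \<or> s = -1"
    "\<And>p. row idx p {u, v} = s *\<^sub>R (unit_vec (u, First) - unit_vec (v, First))"
proof -
  have main: "row idx p {u, v} = unit_vec (u, First) - unit_vec (v, First)"
    if "u \<in> L" "v \<in> L" "idx u < idx v" for u v p
  proof
    fix x :: "'v \<times> coord"
    obtain w c where x: "x = (w, c)" by (cases x)
    have uv: "u \<noteq> v" "u \<notin> P" "v \<notin> P" using that PL_disjoint by auto
    consider "w = u" | "w = v" | "w \<notin> {u, v}" by blast
    then show "row idx p {u, v} x = (unit_vec (u, First) - unit_vec (v, First)) x"
    proof cases
      case 1
      then show ?thesis
        using rigidity_matrix_LL[where G = G and p = p, OF uv(2,3) that(3)] uv unfolding x
        by (cases c) (simp_all add: unit_vec_apply del: rigidity_matrix.simps)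
    next
      case 2
      then show ?thesis
        using rigidity_matrix_LL[where G = G and p = p, OF uv(2,3) that(3)] uv unfolding x
        by (cases c) (simp_all add: unit_vec_apply del: rigidity_matrix.simps)
    next
      case 3
      then show ?thesis unfolding x by (simp add: unit_vec_apply)
    qed
  qed
  have "idx u \<noteq> idx v" using assms by (auto dest: inj_onD)
  then consider "idx u < idx v" | "idx v < idx u" by linarith
  then show thesis
  proof cases
    case 1
    then show thesis using that[of 1] main[OF assms(1,2)] by simp
  next
    case 2
    have "{u, v} = {v, u}" by auto
    then have "row idx p {u, v} = -1 *\<^sub>R (unit_vec (u, First) - unit_vec (v, First))" for p
      using main[OF assms(2,1) 2, of p] by simp
    then show thesis using that[of "-1"] by blast
  qed
qed

lemma rows_independent_iff_family:
  assumes "S \<subseteq> edges G"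
  shows "rows_independent (row idx p) (verts G \<times> {First, Second}) S \<longleftrightarrow> family_independent (row idx p) S"
proof -
  have "(\<forall>c\<in>verts G \<times> {First, Second}. (\<Sum>r\<in>S. l r * row idx p r c) = 0) \<longleftrightarrow>
      (\<Sum>r\<in>S. l r *\<^sub>R row idx p r) = 0" for l
  proof
    assume L: "\<forall>c\<in>verts G \<times> {First, Second}. (\<Sum>r\<in>S. l r * row idx p r c) = 0"
    show "(\<Sum>r\<in>S. l r *\<^sub>R row idx p r) = 0"
    proof
      fix x :: "'v \<times> coord"
      obtain w c where x: "x = (w, c)" by (cases x)
      have "(\<Sum>r\<in>S. l r * row idx p r (w, c)) = 0"
      proof (cases "w \<in> verts G")
        case True
        then show ?thesis using L by (cases c) blast+
      next
        case False
        then have "w \<notin> r" if "r \<in> S" for r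
          using that assms plg by (auto simp: point_line_graph_def)
        then show ?thesis by (intro sum.neutral) simp
      qed
      then show "(\<Sum>r\<in>S. l r *\<^sub>R row idx p r) x = 0 x" by (simp add: x)
    qed
  next
    assume R: "(\<Sum>r\<in>S. l r *\<^sub>R row idx p r) = 0"
    show "\<forall>c\<in>verts G \<times> {First, Second}. (\<Sum>r\<in>S. l r * row idx p r c) = 0"
      using fun_cong[OF R] by (simp del: rigidity_matrix.simps)
  qed
  then show ?thesis by (simp only: rows_independent_def family_independent_def)
qed

lemma generic_distinct:
  assumes "generic G p"
  shows "u \<in> P \<Longrightarrow> v \<in> P \<Longrightarrow> u \<noteq> v \<Longrightarrow> snd (p u) \<noteq> snd (p v)"
    "u \<in> L \<Longrightarrow> v \<in> L \<Longrightarrow> u \<noteq> v \<Longrightarrow> fst (p u) \<noteq> fst (p v)"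
proof -
  note gen = assms[unfolded generic_def]
  show "snd (p u) \<noteq> snd (p v)" if "u \<in> P" "v \<in> P" "u \<noteq> v"
    using alg_independent_rat_distinct[OF gen, of "(u, Second)" "(v, Second)"] that by simp
  show "fst (p u) \<noteq> fst (p v)" if "u \<in> L" "v \<in> L" "u \<noteq> v"
    using alg_independent_rat_distinct[OF gen, of "(u, First)" "(v, First)"] that by simp
qed

text \<open>
  Difference and incidence vectors are orthogonal to the two translations. These are linearly
  independent on the vertices of \<open>B\<close>, as \<open>B\<close> meets a point or two
  lines with different slopes.
\<close>

lemma picture_span:
  assumes gen: "generic G p" and B: "B \<subseteq> edges G" "B \<noteq> {}"
  shows "\<exists>E. finite E \<and> int (card E) \<le> 2 * nu_P G B + nu_L G B - 2 \<and>
    (\<forall>u v c. {u, v} \<in> B \<longrightarrow> u \<in> P \<longrightarrow> v \<in> P \<longrightarrow> unit_vec (u, c) - unit_vec (v, c) \<in> span E) \<and>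
    (\<forall>u v. {u, v} \<in> B \<longrightarrow> u \<in> P \<longrightarrow> v \<in> L \<longrightarrow> incidence_vec (\<lambda>k. fst (p k)) u v \<in> span E)"
proof -
  let ?PB = "{u \<in> P. \<exists>e\<in>B. u \<in> e}" and ?LB = "{v \<in> L. \<exists>e\<in>B. v \<in> e}"
  define C where "C = ?PB \<times> (UNIV :: coord set) \<union> ?LB \<times> {Second}"
  have finC: "finite C" using finite_P finite_L by (simp add: C_def)
  have cardC: "int (card C) = 2 * nu_P G B + nu_L G B"
  proof -
    have "card C = card (?PB \<times> (UNIV :: coord set)) + card (?LB \<times> {Second})"
      unfolding C_def using finite_P finite_L PL_disjoint by (intro card_Un_disjoint) auto
    then show ?thesis by (simp add: nu_P_def nu_L_def card_cartesian_product UNIV_coord)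
  qed
  \<comment> \<open>The two translations; a line of slope \<open>a\<close> moves by
      \<open>1\<close> and \<open>- a\<close>.\<close>
  define \<tau>\<^sub>1 where "\<tau>\<^sub>1 = (\<lambda>(w, c). if w \<in> P then (if c = First then 1 else 0) else 1 :: real)"
  define \<tau>\<^sub>2 where "\<tau>\<^sub>2 = (\<lambda>(w, c). if w \<in> P then (if c = First then 0 else 1) else - fst (p w))"
  obtain c\<^sub>1 c\<^sub>2 where cc: "c\<^sub>1 \<in> C" "c\<^sub>2 \<in> C" "c\<^sub>1 \<noteq> c\<^sub>2"
    "\<tau>\<^sub>1 c\<^sub>1 * \<tau>\<^sub>2 c\<^sub>2 - \<tau>\<^sub>1 c\<^sub>2 * \<tau>\<^sub>2 c\<^sub>1 \<noteq> 0"
  proof (cases "?PB = {}")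
    case False
    then obtain u where "u \<in> ?PB" by blast
    then show thesis
      using that[of "(u, First)" "(u, Second)"] by (auto simp: C_def \<tau>\<^sub>1_def \<tau>\<^sub>2_def)
  next
    case True
    obtain e where e: "e \<in> B" using B(2) by blast
    have ep: "e \<in> pairs" using e B(1) edges_subset_pairs by blast
    have "e \<subseteq> P \<union> L" "card e = 2" "e \<inter> P = {}" using ep True e by (auto simp: pairs_def)
    then obtain u v where uv: "e = {u, v}" "u \<noteq> v" "u \<in> L" "v \<in> L" by (auto simp: card_2_iff)
    have "fst (p u) \<noteq> fst (p v)" using generic_distinct(2)[OF gen] uv by blast
    moreover have "u \<notin> P" "v \<notin> P" using uv PL_disjoint by auto
    ultimately show thesis
      using that[of "(u, Second)" "(v, Second)"] uv e by (auto simp: C_def \<tau>\<^sub>1_def \<tau>\<^sub>2_def)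
  qed
  obtain E where E: "finite E" "card E + 2 \<le> card C"
    "\<forall>v. (\<forall>c. c \<notin> C \<longrightarrow> v c = 0) \<longrightarrow> (\<Sum>c\<in>C. \<tau>\<^sub>1 c * v c) = 0 \<longrightarrow>
      (\<Sum>c\<in>C. \<tau>\<^sub>2 c * v c) = 0 \<longrightarrow> v \<in> span E"
    using span_of_two_constraints[OF finC cc] by (elim exE conjE)
  have unit: "(\<Sum>c\<in>C. \<tau> c * unit_vec c0 c) = \<tau> c0" if "c0 \<in> C" for \<tau> :: "'v \<times> coord \<Rightarrow> real" and c0
  proof -
    have "(\<Sum>c\<in>C. \<tau> c * unit_vec c0 c) = (\<Sum>c\<in>C. if c = c0 then \<tau> c else 0)"
      by (intro sum.cong refl) (simp add: unit_vec_apply)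
    then show ?thesis using that finC by simp
  qed
  show ?thesis
  proof (intro exI[of _ E] conjI allI impI)
    show "finite E" by (rule E(1))
    show "int (card E) \<le> 2 * nu_P G B + nu_L G B - 2" using E(2) cardC by linarith
    show "unit_vec (u, c) - unit_vec (v, c) \<in> span E" if uv: "{u, v} \<in> B" "u \<in> P" "v \<in> P" for u v c
    proof (rule E(3)[rule_format])
      have C: "(u, c) \<in> C" "(v, c) \<in> C" using uv by (auto simp: C_def)
      show "(unit_vec (u, c) - unit_vec (v, c)) x = 0" if "x \<notin> C" for x
        using that C by (auto simp: unit_vec_apply)
      show "(\<Sum>x\<in>C. \<tau>\<^sub>1 x * (unit_vec (u, c) - unit_vec (v, c)) x) = 0"
        "(\<Sum>x\<in>C. \<tau>\<^sub>2 x * (unit_vec (u, c) - unit_vec (v, c)) x) = 0"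
        using uv by (simp_all add: right_diff_distrib sum_subtractf unit[OF C(1)] unit[OF C(2)] \<tau>\<^sub>1_def \<tau>\<^sub>2_def)
    qed
    show "incidence_vec (\<lambda>k. fst (p k)) u v \<in> span E" if uv: "{u, v} \<in> B" "u \<in> P" "v \<in> L" for u v
    proof (rule E(3)[rule_format])
      have C: "(u, First) \<in> C" "(u, Second) \<in> C" "(v, Second) \<in> C" using uv by (auto simp: C_def)
      have v: "v \<notin> P" using uv PL_disjoint by auto
      show "incidence_vec (\<lambda>k. fst (p k)) u v x = 0" if "x \<notin> C" for x
        using that C by (auto simp: unit_vec_apply incidence_vec_def)
      have "(\<Sum>x\<in>C. \<tau> x * incidence_vec (\<lambda>k. fst (p k)) u v x) =
          \<tau> (u, First) - fst (p v) * \<tau> (u, Second) - \<tau> (v, Second)" for \<tau> :: "'v \<times> coord \<Rightarrow> real"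
      proof -
        have "(\<Sum>x\<in>C. \<tau> x * incidence_vec (\<lambda>k. fst (p k)) u v x) =
            (\<Sum>x\<in>C. \<tau> x * unit_vec (u, First) x) - fst (p v) * (\<Sum>x\<in>C. \<tau> x * unit_vec (u, Second) x) -
            (\<Sum>x\<in>C. \<tau> x * unit_vec (v, Second) x)"
          unfolding incidence_vec_def
          by (simp add: right_diff_distrib sum_subtractf sum_distrib_left mult.left_commute)
        then show ?thesis by (simp add: unit[OF C(1)] unit[OF C(2)] unit[OF C(3)])
      qed
      then show "(\<Sum>x\<in>C. \<tau>\<^sub>1 x * incidence_vec (\<lambda>k. fst (p k)) u v x) = 0"
        "(\<Sum>x\<in>C. \<tau>\<^sub>2 x * incidence_vec (\<lambda>k. fst (p k)) u v x) = 0"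
        using uv v by (simp_all add: \<tau>\<^sub>1_def \<tau>\<^sub>2_def)
    qed
  qed
qed

text \<open>
  An optimal partition of \<open>J\<close> gives a set spanning the rows; the infinitesimal
  rotation vanishes on the rows but not on the whole span, which saves one dimension.
\<close>

lemma card_le_if_rows_independent:
  assumes gen: "generic G p" and idx: "inj_on idx L"
    and J: "J \<subseteq> edges G" "J \<noteq> {}" and ind: "family_independent (row idx p) J"
  shows "int (card J) \<le> rho G J + nu_L G J - 1"
proof -
  have finJ: "finite J"
    by (rule finite_subset[OF subset_trans[OF J(1) edges_subset_pairs] finite_pairs])
  have Jp: "e \<in> pairs" if "e \<in> J" for e using that J(1) edges_subset_pairs by blast
  obtain \<P> where \<P>: "partition_on J \<P>" "rho G J = (\<Sum>B\<in>\<P>. 2 * nu_P G B + nu_L G B - 2)"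
    by (rule rho_attained[OF finJ])
  have un: "\<Union>\<P> = J" using \<P>(1) by (simp add: partition_on_def)
  have fin\<P>: "finite \<P>" by (rule finite_UnionD) (simp only: un finJ)
  define picture where "picture B E \<longleftrightarrow> finite E \<and> int (card E) \<le> 2 * nu_P G B + nu_L G B - 2 \<and>
    (\<forall>u v c. {u, v} \<in> B \<longrightarrow> u \<in> P \<longrightarrow> v \<in> P \<longrightarrow> unit_vec (u, c) - unit_vec (v, c) \<in> span E) \<and>
    (\<forall>u v. {u, v} \<in> B \<longrightarrow> u \<in> P \<longrightarrow> v \<in> L \<longrightarrow> incidence_vec (\<lambda>k. fst (p k)) u v \<in> span E)" for B E
  have "\<forall>B\<in>\<P>. \<exists>E. picture B E"
  proof
    fix B assume "B \<in> \<P>"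
    then have "B \<subseteq> edges G" "B \<noteq> {}" using un J(1) \<P>(1) by (auto simp: partition_on_def)
    then show "\<exists>E. picture B E" unfolding picture_def by (rule picture_span[OF gen])
  qed
  from bchoice[OF this] obtain E where "\<forall>B\<in>\<P>. picture B (E B)" by blast
  then have E: "\<And>B. B \<in> \<P> \<Longrightarrow> finite (E B)"
    "\<And>B. B \<in> \<P> \<Longrightarrow> int (card (E B)) \<le> 2 * nu_P G B + nu_L G B - 2"
    "\<And>B u v c. B \<in> \<P> \<Longrightarrow> {u, v} \<in> B \<Longrightarrow> u \<in> P \<Longrightarrow> v \<in> P \<Longrightarrow> unit_vec (u, c) - unit_vec (v, c) \<in> span (E B)"
    "\<And>B u v. B \<in> \<P> \<Longrightarrow> {u, v} \<in> B \<Longrightarrow> u \<in> P \<Longrightarrow> v \<in> L \<Longrightarrow> incidence_vec (\<lambda>k. fst (p k)) u v \<in> span (E B)"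
    by (simp_all add: picture_def)
  let ?LJ = "{v \<in> L. \<exists>e\<in>J. v \<in> e}"
  define Y where "Y = (\<lambda>k. unit_vec (k, First)) ` ?LJ"
  define Z where "Z = (\<Union>B\<in>\<P>. E B) \<union> Y"
  have finY: "finite Y" using finite_L by (simp add: Y_def)
  have finZ: "finite Z" using fin\<P> E(1) finY by (simp add: Z_def)
  have "card Z \<le> card (\<Union>B\<in>\<P>. E B) + card Y" unfolding Z_def by (rule card_Un_le)
  also have "\<dots> \<le> (\<Sum>B\<in>\<P>. card (E B)) + card ?LJ"
    unfolding Y_def using card_UN_le[OF fin\<P>, of E] finite_L by (intro add_mono card_image_le) auto
  finally have "int (card Z) \<le> int ((\<Sum>B\<in>\<P>. card (E B)) + card ?LJ)"
    by (simp only: of_nat_le_iff)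
  also have "\<dots> = (\<Sum>B\<in>\<P>. int (card (E B))) + nu_L G J" by (simp add: nu_L_def)
  also have "\<dots> \<le> rho G J + nu_L G J" unfolding \<P>(2) using E(2) by (intro add_right_mono sum_mono)
  finally have cardZ: "int (card Z) \<le> rho G J + nu_L G J" .
  have sub: "span (E B) \<subseteq> span Z" if "B \<in> \<P>" for B
    using that by (intro real_vector.span_mono) (auto simp: Z_def)
  have part: "\<exists>B\<in>\<P>. e \<in> B" if "e \<in> J" for e using that un by blast
  have PPZ: "unit_vec (u, c) - unit_vec (v, c) \<in> span Z" if uv: "{u, v} \<in> J" "u \<in> P" "v \<in> P" for u v c
    using part[OF uv(1)] E(3)[OF _ _ uv(2,3)] sub by blast
  have PLZ: "incidence_vec (\<lambda>k. fst (p k)) u v \<in> span Z" if uv: "{u, v} \<in> J" "u \<in> P" "v \<in> L" for u v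
    using part[OF uv(1)] E(4)[OF _ _ uv(2,3)] sub by blast
  have LZ: "unit_vec (v, First) \<in> span Z" if "e \<in> J" "v \<in> e" "v \<in> L" for e v
    using that by (intro real_vector.span_base) (auto simp: Z_def Y_def)
  have rowZ: "row idx p e \<in> span Z" if e: "e \<in> J" for e
    using Jp[OF e]
  proof (cases rule: pair_cases)
    case (PP u v)
    show ?thesis
      unfolding PP(1) row_PP[OF PP(3,4,2)] using PPZ[of u v] e PP
      by (intro real_vector.span_add real_vector.span_scale) auto
  next
    case (PL u v)
    show ?thesis
      unfolding PL(1) row_PL[OF PL(2,3)] using PLZ[of u v] LZ[of e v] e PL
      by (intro real_vector.span_add real_vector.span_scale) auto
  next
    case (LL u v)
    obtain s where "row idx p {u, v} = s *\<^sub>R (unit_vec (u, First) - unit_vec (v, First))"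
      using row_LL[OF LL(3,4,2) idx] by metis
    then show ?thesis
      using LZ[of e u] LZ[of e v] e LL
      by (simp add: real_vector.span_scale real_vector.span_diff del: rigidity_matrix.simps)
  qed
  \<comment> \<open>The infinitesimal rotation about the origin; it turns every line at unit
      rate.\<close>
  define \<eta> where "\<eta> = (\<lambda>(w, c). if w \<in> P then (if c = First then snd (p w) else - fst (p w))
    else (if c = First then 1 else 0))"
  define h where "h v = (\<Sum>x\<in>(P \<union> L) \<times> (UNIV :: coord set). \<eta> x * v x)" for v
  have lin: "linear h"
    unfolding linear_iff h_def by (simp add: distrib_left sum.distrib sum_distrib_left mult.left_commute)
  have h: "h (unit_vec x) = \<eta> x" if "x \<in> (P \<union> L) \<times> UNIV" for x
  proof -
    have "h (unit_vec x) = (\<Sum>y\<in>(P \<union> L) \<times> UNIV. if y = x then \<eta> y else 0)"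
      unfolding h_def by (intro sum.cong refl) (simp add: unit_vec_apply)
    then show ?thesis using that finite_P finite_L by simp
  qed
  note hlin = linear_add[OF lin] linear_diff[OF lin] linear_scale[OF lin]
  have rowh: "h (row idx p e) = 0" if e: "e \<in> J" for e
    using Jp[OF e]
  proof (cases rule: pair_cases)
    case (PP u v)
    show ?thesis
      unfolding PP(1) row_PP[OF PP(3,4,2)] using PP by (simp add: hlin h \<eta>_def algebra_simps)
  next
    case (PL u v)
    then have "v \<notin> P" using PL_disjoint by auto
    then show ?thesis
      unfolding PL(1) row_PL[OF PL(2,3)] incidence_vec_def using PL by (simp add: hlin h \<eta>_def algebra_simps)
  next
    case (LL u v)
    then have "u \<notin> P" "v \<notin> P" using PL_disjoint by auto
    obtain s where s: "row idx p {u, v} = s *\<^sub>R (unit_vec (u, First) - unit_vec (v, First))"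
      using row_LL[OF LL(3,4,2) idx] by metis
    show ?thesis
      unfolding LL(1) s using LL \<open>u \<notin> P\<close> \<open>v \<notin> P\<close> by (simp add: hlin h \<eta>_def)
  qed
  obtain z where z: "z \<in> span Z" "h z \<noteq> 0"
  proof -
    obtain e where e: "e \<in> J" using J(2) by blast
    show thesis
      using Jp[OF e]
    proof (cases rule: pair_cases)
      case (PP u v)
      have "h (unit_vec (u, First) - unit_vec (v, First)) \<noteq> 0"
        using PP generic_distinct(1)[OF gen PP(3,4,2)] by (simp add: hlin h \<eta>_def)
      then show thesis using that PPZ[of u v First] e PP by blast
    next
      case (PL u v)
      then have "v \<notin> P" using PL_disjoint by auto
      then have "h (unit_vec (v, First)) \<noteq> 0" using PL by (simp add: h \<eta>_def)
      then show thesis using that LZ[OF e, of v] PL by blast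
    next
      case (LL u v)
      then have "v \<notin> P" using PL_disjoint by auto
      then have "h (unit_vec (v, First)) \<noteq> 0" using LL by (simp add: h \<eta>_def)
      then show thesis using that LZ[OF e, of v] LL by blast
    qed
  qed
  let ?R = "row idx p ` J"
  have indR: "inj_on (row idx p) J" "independent ?R" using ind family_independent_iff[OF finJ] by blast+
  have "z \<notin> span ?R"
  proof
    assume "z \<in> span ?R"
    then have "h z = 0" by (rule linear_eq_0_on_span[OF lin, rotated]) (use rowh in blast)
    then show False using z by simp
  qed
  then have "independent (insert z ?R)" "z \<notin> ?R"
    using indR(2) real_vector.independent_insertI real_vector.span_base by blast+
  moreover have "insert z ?R \<subseteq> span Z" using z(1) rowZ by blast
  ultimately have "card (insert z ?R) \<le> card Z"
    using real_vector.independent_span_bound[OF finZ] by blast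
  moreover have "card (insert z ?R) = card J + 1"
    using \<open>z \<notin> ?R\<close> finJ indR(1) by (simp add: card_image)
  ultimately show ?thesis using cardZ by linarith
qed

section \<open>Sets satisfying the count have independent rows\<close>

text \<open>
  Column operations that do not depend on the edge: the first column of each line is scaled,
  and a multiple of the second one is added to it. They are invertible at the lines
  \<open>w\<close> with \<open>q (w, First) \<noteq> 0\<close>.
\<close>

definition rescale_columns :: "('v \<times> coord \<Rightarrow> real) \<Rightarrow> ('v \<times> coord \<Rightarrow> real) \<Rightarrow> 'v \<times> coord \<Rightarrow> real" where
  "rescale_columns q v = (\<lambda>(w, c). if w \<in> L \<and> c = First
     then q (w, First) * v (w, First) + q (w, Second) * v (w, Second) else v (w, c))"

text \<open>
  The points are the values of the functional turned by a right angle, because the row of an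
  edge between two points has to be orthogonal to the difference of these values. The
  \<open>0\<close> is a default value.
\<close>

definition placement :: "('v \<Rightarrow> real) \<Rightarrow> ('v \<times> coord \<Rightarrow> real) \<Rightarrow> 'v \<Rightarrow> real \<times> real" where
  "placement a q w = (if w \<in> P then (- q (w, Second), q (w, First)) else (a w, 0))"

text \<open>
  The hypothesis on \<open>\<phi>\<close> says that the plane of \<open>e\<close> meets the
  kernel of \<open>\<phi>\<close> in the line spanned by \<open>v\<close>. As \<open>t
  \<noteq> 0\<close>, also the first spanning vector of the plane is not in the kernel; this
  makes the column factors of both ends of an edge between lines nonzero.
\<close>

lemma row_eq_rescaled_transversal:
  assumes e: "e \<in> pairs" and idx: "inj_on idx L" and t: "t \<noteq> 0"
    and lin: "linear \<phi>"
    and kill: "\<phi> (edge_gen G a (e, First) + t *\<^sub>R edge_gen G a (e, Second)) = 0"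
    and nz: "\<phi> (edge_gen G a (e, Second)) \<noteq> 0"
  defines "q \<equiv> \<lambda>c. \<phi> (unit_vec c)"
    and "v \<equiv> edge_gen G a (e, First) + t *\<^sub>R edge_gen G a (e, Second)"
  shows "\<exists>s. s \<noteq> 0 \<and> row idx (placement a q) e = s *\<^sub>R rescale_columns q v"
    and "\<And>k. k \<in> e \<Longrightarrow> k \<in> L \<Longrightarrow> q (k, First) \<noteq> 0"
    and "\<And>w c. w \<notin> e \<Longrightarrow> v (w, c) = 0"
proof -
  note hlin = linear_add[OF lin] linear_diff[OF lin] linear_scale[OF lin]
  have "(\<exists>s. s \<noteq> 0 \<and> row idx (placement a q) e = s *\<^sub>R rescale_columns q v) \<and>
    (\<forall>k. k \<in> e \<longrightarrow> k \<in> L \<longrightarrow> q (k, First) \<noteq> 0) \<and> (\<forall>w c. w \<notin> e \<longrightarrow> v (w, c) = 0)"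
    using e
  proof (cases rule: pair_cases)
    case (PP x y)
    define s where "s = q (y, Second) - q (x, Second)"
    have s0: "s \<noteq> 0" using nz PP(5) by (simp add: hlin q_def s_def)
    have "q (x, First) - q (y, First) + t * (q (x, Second) - q (y, Second)) = 0"
      using kill PP(5) by (simp add: hlin q_def)
    then have ts: "q (x, First) - q (y, First) = s * t" by (simp add: s_def algebra_simps)
    have L: "x \<notin> L" "y \<notin> L" using PP PL_disjoint by auto
    have "row idx (placement a q) {x, y} = s *\<^sub>R (unit_vec (x, First) - unit_vec (y, First)) +
        (s * t) *\<^sub>R (unit_vec (x, Second) - unit_vec (y, Second))"
      unfolding row_PP[OF PP(3,4,2)] using PP(3,4) ts by (simp add: placement_def s_def)
    also have "\<dots> = s *\<^sub>R v" unfolding v_def PP(5) by (simp add: scaleR_add_right)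
    also have "v = rescale_columns q v"
      using L by (auto simp: rescale_columns_def v_def PP(5) unit_vec_apply fun_eq_iff)
    finally have "row idx (placement a q) e = s *\<^sub>R rescale_columns q v" unfolding PP(1) .
    moreover have "\<forall>k. k \<in> e \<longrightarrow> k \<in> L \<longrightarrow> q (k, First) \<noteq> 0" using PP(1) L by auto
    moreover have "\<forall>w c. w \<notin> e \<longrightarrow> v (w, c) = 0"
      unfolding v_def PP(5) by (auto simp: PP(1) unit_vec_apply)
    ultimately show ?thesis using s0 by blast
  next
    case (PL x y)
    have xy: "x \<notin> L" "y \<notin> P" "x \<noteq> y" using PL PL_disjoint by auto
    have "q (x, First) - a y * q (x, Second) - q (y, Second) + t * q (y, First) = 0"
      using kill PL(4,5) by (simp add: hlin q_def incidence_vec_def)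
    then have rel: "q (x, Second) * a y - q (x, First) = t * q (y, First) - q (y, Second)"
      by (simp add: algebra_simps)
    have "row idx (placement a q) {x, y} = incidence_vec a x y +
        (t * q (y, First) - q (y, Second)) *\<^sub>R unit_vec (y, First)"
      unfolding row_PL[OF PL(2,3)] rel[symmetric] using PL(2) xy
      by (simp add: placement_def incidence_vec_def)
    also have "\<dots> = 1 *\<^sub>R rescale_columns q v"
    proof
      fix z :: "'v \<times> coord"
      obtain w c where z: "z = (w, c)" by (cases z)
      consider "w = x" | "w = y" | "w \<noteq> x" "w \<noteq> y" by blast
      then show "(incidence_vec a x y + (t * q (y, First) - q (y, Second)) *\<^sub>R unit_vec (y, First)) z =
          (1 *\<^sub>R rescale_columns q v) z"
        unfolding z v_def PL(4,5) rescale_columns_def incidence_vec_def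
        using xy PL(3) by cases (cases c; simp add: unit_vec_apply algebra_simps)+
    qed
    finally have "row idx (placement a q) e = 1 *\<^sub>R rescale_columns q v" unfolding PL(1) .
    moreover have "\<forall>k. k \<in> e \<longrightarrow> k \<in> L \<longrightarrow> q (k, First) \<noteq> 0"
      using nz PL xy by (auto simp: q_def)
    moreover have "\<forall>w c. w \<notin> e \<longrightarrow> v (w, c) = 0"
      unfolding v_def PL(4,5) by (auto simp: PL(1) incidence_vec_def unit_vec_apply)
    ultimately show ?thesis by (metis zero_neq_one)
  next
    case (LL x y)
    have rel: "q (x, First) + t * q (y, First) = 0" using kill LL(5,6) by (simp add: hlin q_def)
    have y0: "q (y, First) \<noteq> 0" using nz LL(6) by (simp add: q_def)
    then have x0: "q (x, First) \<noteq> 0" using rel t by auto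
    obtain s where s: "s = 1 \<or> s = -1"
      "row idx (placement a q) {x, y} = s *\<^sub>R (unit_vec (x, First) - unit_vec (y, First))"
      using row_LL[OF LL(3,4,2) idx] by metis
    have "q (x, First) *\<^sub>R (unit_vec (x, First) - unit_vec (y, First)) = rescale_columns q v"
    proof
      fix z :: "'v \<times> coord"
      obtain w c where z: "z = (w, c)" by (cases z)
      have yt: "q (y, First) * t = - q (x, First)" using rel by (simp add: algebra_simps)
      consider "w = x" | "w = y" | "w \<noteq> x" "w \<noteq> y" by blast
      then show "(q (x, First) *\<^sub>R (unit_vec (x, First) - unit_vec (y, First))) z = rescale_columns q v z"
        unfolding z v_def LL(5,6) rescale_columns_def
        using LL(2,3,4) yt by cases (cases c; simp add: unit_vec_apply)+
    qed
    then have "row idx (placement a q) e = (s / q (x, First)) *\<^sub>R rescale_columns q v"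
      unfolding LL(1) s(2) using x0 by (simp flip: \<open>_ = rescale_columns q v\<close>)
    moreover have "s / q (x, First) \<noteq> 0" using s(1) x0 by auto
    moreover have "\<forall>k. k \<in> e \<longrightarrow> k \<in> L \<longrightarrow> q (k, First) \<noteq> 0" using LL(1) x0 y0 by auto
    moreover have "\<forall>w c. w \<notin> e \<longrightarrow> v (w, c) = 0"
      unfolding v_def LL(5,6) by (auto simp: LL(1) unit_vec_apply)
    ultimately show ?thesis by blast
  qed
  then show "\<exists>s. s \<noteq> 0 \<and> row idx (placement a q) e = s *\<^sub>R rescale_columns q v"
    and "\<And>k. k \<in> e \<Longrightarrow> k \<in> L \<Longrightarrow> q (k, First) \<noteq> 0"
    and "\<And>w c. w \<notin> e \<Longrightarrow> v (w, c) = 0" by blast+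
qed

lemma independent_placement:
  assumes idx: "inj_on idx L" and I: "I \<subseteq> edges G"
    and count: "\<And>J. J \<noteq> {} \<Longrightarrow> J \<subseteq> I \<Longrightarrow> int (card J) \<le> rho G J + nu_L G J - 1"
  shows "\<exists>p. family_independent (row idx p) I"
proof -
  have Ip: "I \<subseteq> pairs" using I edges_subset_pairs by blast
  have finI: "finite I" using finite_subset[OF Ip finite_pairs] .
  obtain a where a: "maximal_slopes a" using ex_maximal_slopes by blast
  let ?b = "\<lambda>e. edge_gen G a (e, First)" and ?c = "\<lambda>e. edge_gen G a (e, Second)"
  have "card J + 1 \<le> dim (?b ` J \<union> ?c ` J)" if JI: "J \<subseteq> I" "J \<noteq> {}" for J
  proof -
    have "J \<subseteq> pairs" using JI(1) Ip by blast
    then interpret maximal_placement G a J using a by unfold_locales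
    have "edge_gen G a ` (J \<times> UNIV) = ?b ` J \<union> ?c ` J" by (auto simp: UNIV_coord)
    then show ?thesis
      using rho_plus_nu_L_le_edge_rank count[OF JI(2,1)] by (simp add: edge_rank_def)
  qed
  from generic_transversal_of_planes[OF finI this]
  obtain t where t: "\<forall>e\<in>I. t e \<noteq> 0" "family_independent (\<lambda>e. ?b e + t e *\<^sub>R ?c e) I"
    "\<forall>f\<in>I. ?c f \<notin> span ((\<lambda>e. ?b e + t e *\<^sub>R ?c e) ` I)" by blast
  define v where "v e = ?b e + t e *\<^sub>R ?c e" for e
  have "\<exists>\<phi>::('v \<times> coord \<Rightarrow> real) \<Rightarrow> real. linear \<phi> \<and> (\<forall>x\<in>v ` I. \<phi> x = 0) \<and> (\<forall>y\<in>?c ` I. \<phi> y \<noteq> 0)"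
    by (rule linear_functional_separates_finite) (use finI t(3) in \<open>auto simp: v_def[abs_def]\<close>)
  then obtain \<phi> :: "('v \<times> coord \<Rightarrow> real) \<Rightarrow> real" where "linear \<phi>"
    and "\<forall>x\<in>v ` I. \<phi> x = 0" and "\<forall>y\<in>?c ` I. \<phi> y \<noteq> 0" by (elim exE conjE)
  then have \<phi>: "linear \<phi>" "\<And>e. e \<in> I \<Longrightarrow> \<phi> (v e) = 0" "\<And>e. e \<in> I \<Longrightarrow> \<phi> (?c e) \<noteq> 0"
    by simp_all
  define q where "q = (\<lambda>c. \<phi> (unit_vec c))"
  let ?p = "placement a q"
  have edge: "\<exists>s. s \<noteq> 0 \<and> row idx ?p e = s *\<^sub>R rescale_columns q (v e)"
    "k \<in> e \<Longrightarrow> k \<in> L \<Longrightarrow> q (k, First) \<noteq> 0" "w \<notin> e \<Longrightarrow> v e (w, c) = 0" if e: "e \<in> I" for e k w c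
  proof -
    have ep: "e \<in> pairs" using e Ip by blast
    have t0: "t e \<noteq> 0" using t(1) e by blast
    note resc = row_eq_rescaled_transversal[OF ep idx t0 \<phi>(1) \<phi>(2)[OF e, unfolded v_def] \<phi>(3)[OF e]]
    show "\<exists>s. s \<noteq> 0 \<and> row idx ?p e = s *\<^sub>R rescale_columns q (v e)"
      unfolding q_def v_def by (rule resc(1))
    show "q (k, First) \<noteq> 0" if "k \<in> e" "k \<in> L"
      unfolding q_def by (rule resc(2)[OF that])
    show "v e (w, c) = 0" if "w \<notin> e"
      unfolding v_def by (rule resc(3)[OF that])
  qed
  have "\<forall>e\<in>I. \<exists>s. s \<noteq> 0 \<and> row idx ?p e = s *\<^sub>R rescale_columns q (v e)" using edge(1) by blast
  from bchoice[OF this] obtain s where s: "\<And>e. e \<in> I \<Longrightarrow> s e \<noteq> 0"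
    "\<And>e. e \<in> I \<Longrightarrow> row idx ?p e = s e *\<^sub>R rescale_columns q (v e)" by blast
  have "family_independent (row idx ?p) I"
  proof (rule family_independentI)
    fix l e assume rel: "(\<Sum>e\<in>I. l e *\<^sub>R row idx ?p e) = 0" and e: "e \<in> I"
    define D where "D x = (\<Sum>e\<in>I. l e * s e * v e x)" for x
    have row0: "(\<Sum>e\<in>I. l e * s e * rescale_columns q (v e) x) = 0" for x
    proof -
      have "(\<Sum>e\<in>I. l e * s e * rescale_columns q (v e) x) = (\<Sum>e\<in>I. l e *\<^sub>R row idx ?p e) x"
        unfolding sum_fun_apply using s(2)
        by (intro sum.cong refl) (simp del: rigidity_matrix.simps)
      then show ?thesis by (simp only: rel zero_fun_apply)
    qed
    have other: "D (w, c) = 0" if "\<not> (w \<in> L \<and> c = First)" for w c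
      using row0[of "(w, c)"] that by (simp add: D_def rescale_columns_def)
    have first: "D (k, First) = 0" if k: "k \<in> L" for k
    proof (cases "\<exists>e\<in>I. k \<in> e")
      case True
      then have "q (k, First) \<noteq> 0" using edge(2) k by blast
      have "0 = (\<Sum>e\<in>I. q (k, First) * (l e * s e * v e (k, First)) +
          q (k, Second) * (l e * s e * v e (k, Second)))"
        using row0[of "(k, First)"] k by (simp add: rescale_columns_def algebra_simps)
      also have "\<dots> = q (k, First) * D (k, First) + q (k, Second) * D (k, Second)"
        by (simp add: D_def sum.distrib sum_distrib_left)
      finally show ?thesis using other[of k Second] \<open>q (k, First) \<noteq> 0\<close> by simp
    next
      case False
      then show ?thesis unfolding D_def using edge(3) by (intro sum.neutral) auto
    qed
    have "(\<Sum>e\<in>I. (l e * s e) *\<^sub>R v e) = 0"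
    proof
      fix x :: "'v \<times> coord"
      obtain w c where x: "x = (w, c)" by (cases x)
      have "D x = 0"
        unfolding x using first[of w] other[of w c] by (cases "w \<in> L \<and> c = First") auto
      then show "(\<Sum>e\<in>I. (l e * s e) *\<^sub>R v e) x = 0 x" by (simp add: D_def)
    qed
    moreover have "family_independent v I" using t(2) by (simp add: v_def[abs_def])
    ultimately have "l e * s e = 0" using family_independentD[of v I "\<lambda>e. l e * s e"] e by blast
    then show "l e = 0" using s(1)[OF e] by simp
  qed
  then show ?thesis by blast
qed

lemma tendsto_row:
  assumes "\<And>w. ((\<lambda>n. fst (p' n w)) \<longlongrightarrow> fst (p w)) F" "\<And>w. ((\<lambda>n. snd (p' n w)) \<longlongrightarrow> snd (p w)) F"
  shows "((\<lambda>n. row idx (p' n) e x) \<longlongrightarrow> row idx p e x) F"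
proof (cases x)
  case (Pair w c)
  show ?thesis unfolding Pair
    by (cases c) (auto simp: Let_def intro!: tendsto_intros assms)
qed

text \<open>
  Algebraically independent coordinates converge to those of \<open>p\<close>, and
  independence of the rows persists near \<open>p\<close>.
\<close>

lemma generic_independent_placement:
  assumes I: "I \<subseteq> edges G" and ind: "family_independent (row idx p) I"
  shows "\<exists>p'. generic G p' \<and> family_independent (row idx p') I"
proof -
  let ?K = "P \<times> {First, Second} \<union> L \<times> {First}"
  have finK: "finite ?K" using finite_P finite_L by simp
  have "\<exists>t. alg_independent_rat ?K t \<and> (\<forall>i\<in>?K. \<bar>t i - coordinate p i\<bar> < inverse (real (Suc n)))" for n
    by (rule alg_independent_rat_dense[OF finK]) simp
  then obtain t where t: "\<And>n. alg_independent_rat ?K (t n)"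
    "\<And>n i. i \<in> ?K \<Longrightarrow> \<bar>t n i - coordinate p i\<bar> < inverse (real (Suc n))" by metis
  have tlim: "(\<lambda>n. t n i) \<longlonglongrightarrow> coordinate p i" if "i \<in> ?K" for i
  proof -
    have "(\<lambda>n. t n i - coordinate p i) \<longlonglongrightarrow> 0"
      by (rule tendsto_0_le[OF LIMSEQ_inverse_real_of_nat, of _ 1])
        (use t(2)[OF that] in \<open>auto intro!: always_eventually less_imp_le\<close>)
    then show ?thesis by (simp add: LIM_zero_iff)
  qed
  define p' where "p' n w = (if w \<in> P \<union> L then t n (w, First) else fst (p w),
    if w \<in> P then t n (w, Second) else snd (p w))" for n w
  have gen: "generic G (p' n)" for n
  proof -
    have "coordinate (p' n) i = t n i" if "i \<in> ?K" for i using that by (auto simp: p'_def)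
    then show ?thesis unfolding generic_def using t(1)[of n] alg_independent_rat_cong by metis
  qed
  have "(\<lambda>n. fst (p' n w)) \<longlonglongrightarrow> fst (p w)" for w
    using tlim[of "(w, First)"] by (cases "w \<in> P \<union> L") (auto simp: p'_def)
  moreover have "(\<lambda>n. snd (p' n w)) \<longlonglongrightarrow> snd (p w)" for w
    using tlim[of "(w, Second)"] by (cases "w \<in> P") (auto simp: p'_def)
  ultimately have lim: "(\<lambda>n. row idx (p' n) e x) \<longlonglongrightarrow> row idx p e x" for e x
    by (rule tendsto_row)
  have Ip: "I \<subseteq> pairs" using I edges_subset_pairs by blast
  have "\<forall>\<^sub>F n in sequentially. family_independent (row idx (p' n)) I"
  proof (rule eventually_family_independent[OF ind, of "(P \<union> L) \<times> UNIV"])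
    show "finite I" using finite_subset[OF Ip finite_pairs] .
    show "finite ((P \<union> L) \<times> (UNIV :: coord set))" using finite_P finite_L by simp
    show "(\<lambda>n. row idx (p' n) e x) \<longlonglongrightarrow> row idx p e x" for e x by (rule lim)
    have "row idx p e x = 0" if "e \<in> I" "x \<notin> (P \<union> L) \<times> UNIV" for p e x
    proof (cases x)
      case (Pair w c)
      then have "w \<notin> e" using that Ip by (auto simp: pairs_def)
      then show ?thesis unfolding Pair by (rule row_support)
    qed
    then show "e \<in> I \<Longrightarrow> x \<notin> (P \<union> L) \<times> UNIV \<Longrightarrow> row idx p e x = 0"
      "e \<in> I \<Longrightarrow> x \<notin> (P \<union> L) \<times> UNIV \<Longrightarrow> row idx (p' n) e x = 0" for e x n by blast+
  qed
  then obtain n where "family_independent (row idx (p' n)) I"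
    using eventually_happens'[OF sequentially_bot] by blast
  then show ?thesis using gen by blast
qed

end

theorem theorem4p8:
  fixes G :: "'v pl_graph" and idx :: "'v \<Rightarrow> nat"
  assumes "point_line_graph G"
    and "bij_betw idx (line_verts G) {1..card (line_verts G)}"
  shows "rigidity_matroid G idx = sharp_matroid G"
proof -
  interpret point_line G by unfold_locales (rule assms(1))
  have idx: "inj_on idx (line_verts G)" using assms(2) by (simp add: bij_betw_def)
  have "(\<exists>p. generic G p \<and> rows_independent (rigidity_matrix G idx p) (verts G \<times> {First, Second}) S) \<longleftrightarrow>
      (\<forall>J. J \<noteq> {} \<and> J \<subseteq> S \<longrightarrow> int (card J) \<le> rho G J + nu_L G J - 1)" (is "?l \<longleftrightarrow> ?r")
    if S: "S \<subseteq> edges G" for S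
  proof
    assume ?l
    then obtain p where p: "generic G p" "family_independent (rigidity_matrix G idx p) S"
      using rows_independent_iff_family[OF S] by blast
    show ?r
    proof (intro allI impI, elim conjE)
      fix J assume J: "J \<noteq> {}" "J \<subseteq> S"
      have "finite S" using S edges_subset_pairs finite_pairs by (meson finite_subset)
      then have "family_independent (rigidity_matrix G idx p) J"
        using p(2) J(2) finite_subset[OF J(2)] unfolding family_independent_iff[OF \<open>finite S\<close>]
        by (metis family_independent_iff image_mono inj_on_subset real_vector.independent_mono)
      then show "int (card J) \<le> rho G J + nu_L G J - 1"
        using card_le_if_rows_independent[OF p(1) idx] J S by blast
    qed
  next
    assume ?r
    then obtain p where "family_independent (rigidity_matrix G idx p) S"
      using independent_placement[OF idx S] by blast
    then show ?l
      using generic_independent_placement[OF S] rows_independent_iff_family[OF S] by blast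
  qed
  then show ?thesis
    unfolding rigidity_matroid_def sharp_matroid_def induced_matroid_def by auto
qed

end
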